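(* Let $n\ge 3$. In the class of Lagrangian submanifolds of $\mathbb{R}^{2n}\simeq\mathbb{C}^n$ which are foliated by round $(n-1)$-spheres, there are no self-translators, and the only self-shrinkers/expanders are the centered ones described in the earlier work of H. Anciaux on self-similar Lagrangian submanifolds, i.e. the immersions $(s,x)\mapsto\gamma(s)x$ whose planar profile curve $\gamma$ satisfies the ordinary differential equation to which the self-similar equation reduces in the centered case (written out in the context).
   Context: $\mathbb{C}^n\simeq\mathbb{R}^{2n}$ has coordinates $z_j=x_j+iy_j$, the Euclidean metric and the symplectic form $\omega=\sum_{j=1}^n dx_j\wedge dy_j$. A submanifold is Lagrangian if it has real dimension $n$ and $\omega$ vanishes on its tangent spaces. $\mathbb{R}^n=\{y_1=\dots=y_n=0\}\subset\mathbb{C}^n$, and $\mathbb{S}^{n-1}$ is the unit sphere of this $\mathbb{R}^n$. An $n$-dimensional submanifold of $\mathbb{R}^{2n}$ foliated by round $(n-1)$-spheres is locally parametrized by immersions $(s,x)\in I\times\mathbb{S}^{n-1}\mapsto r(s)M(s)x+V(s)$, with $I$ an interval, $r(s)>0$, $M(s)\in SO(2n)$, $V(s)\in\mathbb{C}^n$. $\vec H$ is the mean curvature vector, normalized so that $n\vec H$ is the trace of the second fundamental form; $X$ is the position vector, and $\perp$ denotes projection onto the normal space of the submanifold. Self-translators are the submanifolds satisfying $\vec H=V_0^{\perp}$ for some fixed vector $V_0\in\mathbb{C}^n$. Self-shrinkers (respectively self-expanders) are the submanifolds satisfying $\vec H+\lambda X^{\perp}=0$ for some real constant $\lambda>0$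 (respectively $\lambda<0$). A submanifold is centered if it is locally parametrized by $(s,x)\in I\times\mathbb{S}^{n-1}\mapsto\gamma(s)x$ with $\gamma=re^{i\phi}$ a planar curve (all spherical leaves have the same center, the origin); it is then equivariant under the action $z\mapsto Az$ of $A\in SO(n)\subset U(n)$. The totally geodesic case (pieces of Lagrangian subspaces, where $\gamma$ lies on a line through the origin) is in particular centered. With $\gamma$ parametrized by arclength, $\dot\gamma=e^{i\theta}$, curvature $k=\dot\theta$ and $\alpha=\theta-\phi$, the self-similar equation for a centered submanifold reads $k+(n-1)\frac{\sin\alpha}{r}=n\lambda\, r\sin\alpha$.
   Formalization: "No self-translators" is proved for V0 ≠ 0 and submanifolds not in an affine Lagrangian subspace (V0 = 0 gives minimal ones; flat ones with parallel V0 are trivial translators); "centered" is up to a unitary map and reparametrization, with pieces of Lagrangian subspaces included. *)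

theory Defs
  imports "HOL-Analysis.Analysis"
begin

section \<open>Smooth functions of one real variable\<close>

text \<open>Intended for open \<open>T\<close> only.\<close>

primrec Ck_on :: "nat \<Rightarrow> real set \<Rightarrow> (real \<Rightarrow> 'a::real_normed_vector) \<Rightarrow> bool" where
  "Ck_on 0 T f \<longleftrightarrow> continuous_on T f"
| "Ck_on (Suc k) T f \<longleftrightarrow>
     (\<forall>t\<in>T. f differentiable (at t)) \<and> Ck_on k T (\<lambda>t. vector_derivative f (at t))"

definition smooth_on :: "real set \<Rightarrow> (real \<Rightarrow> 'a::real_normed_vector) \<Rightarrow> bool" where
  "smooth_on T f \<longleftrightarrow> (\<forall>k. Ck_on k T f)"


section \<open>Complex Euclidean space\<close>

text \<open>On \<^typ>\<open>complex^'n\<close> the library inner product \<open>\<bullet>\<close> is already the real Euclidean one, and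
  \<open>z *s v\<close> is multiplication of a vector by a complex scalar.\<close>

definition symp :: "complex^'n \<Rightarrow> complex^'n \<Rightarrow> real" where
  "symp u v = (\<Sum>j\<in>UNIV. Re (u $ j) * Im (v $ j) - Im (u $ j) * Re (v $ j))"

definition lagrangian_subspace :: "(complex^'n) set \<Rightarrow> bool" where
  "lagrangian_subspace L \<longleftrightarrow>
     subspace L \<and> dim L = CARD('n) \<and> (\<forall>u\<in>L. \<forall>v\<in>L. symp u v = 0)"

definition unitary_matrix :: "complex^'n^'n \<Rightarrow> bool" where
  "unitary_matrix A \<longleftrightarrow> (\<chi> i j. cnj (A $ j $ i)) ** A = mat 1"

definition cvec :: "real^'n \<Rightarrow> complex^'n" where
  "cvec x = (\<chi> j. complex_of_real (x $ j))"

text \<open>The identification of complex \<open>n\<close>-space with real \<open>2n\<close>-space: the index \<open>Inl j\<close> carries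
  the coordinate \<open>x\<^sub>j\<close> and \<open>Inr j\<close> the coordinate \<open>y\<^sub>j\<close>.\<close>

definition to_real :: "complex^'n \<Rightarrow> real^('n + 'n)" where
  "to_real z = (\<chi> k. case k of Inl j \<Rightarrow> Re (z $ j) | Inr j \<Rightarrow> Im (z $ j))"

definition to_cplx :: "real^('n + 'n) \<Rightarrow> complex^'n" where
  "to_cplx v = (\<chi> j. Complex (v $ Inl j) (v $ Inr j))"


section \<open>Extrinsic geometry of an immersion\<close>

text \<open>\<open>N\<close> is a smooth submanifold of some normed space (below it is \<open>I \<times> S\<^sup>n\<^sup>-\<^sup>1\<close> inside
  \<open>\<real> \<times> \<real>\<^sup>n\<close>) and \<open>f\<close> a map on \<open>N\<close>; only the values of \<open>f\<close> on \<open>N\<close> matter. Tangent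
  vectors are velocities of smooth curves.\<close>

definition curve_through :: "'a::real_normed_vector set \<Rightarrow> 'a \<Rightarrow> (real \<Rightarrow> 'a) \<Rightarrow> bool" where
  "curve_through N p c \<longleftrightarrow>
     c 0 = p \<and> (\<exists>e>0. smooth_on {-e<..<e} c \<and> c ` {-e<..<e} \<subseteq> N)"

text \<open>Smoothness of \<open>f\<close> is expressed by smoothness along curves (for finite-dimensional
  manifolds this is ordinary smoothness, by Boman's theorem).\<close>

definition immersion_on ::
    "'a::real_normed_vector set \<Rightarrow> ('a \<Rightarrow> 'b::real_normed_vector) \<Rightarrow> bool" where
  "immersion_on N f \<longleftrightarrow> (\<forall>p\<in>N. \<forall>c. curve_through N p c \<longrightarrow>
     (\<exists>e>0. smooth_on {-e<..<e} (f \<circ> c)) \<and>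
     (vector_derivative c (at 0) \<noteq> 0 \<longrightarrow> vector_derivative (f \<circ> c) (at 0) \<noteq> 0))"

text \<open>The image of the differential of \<open>f\<close> at \<open>p\<close>.\<close>

definition tangent_space ::
    "'a::real_normed_vector set \<Rightarrow> ('a \<Rightarrow> 'b::real_normed_vector) \<Rightarrow> 'a \<Rightarrow> 'b set" where
  "tangent_space N f p = {vector_derivative (f \<circ> c) (at 0) | c. curve_through N p c}"

text \<open>The orthogonal projection of \<open>v\<close> to the orthogonal complement of the subspace \<open>T\<close>.\<close>

definition normal_part :: "'b::euclidean_space set \<Rightarrow> 'b \<Rightarrow> 'b" where
  "normal_part T v = (THE w. w \<in> orthogonal_comp T \<and> v - w \<in> T)"

definition tangent_field_along ::
    "'a::real_normed_vector set \<Rightarrow> ('a \<Rightarrow> 'b::real_normed_vector) \<Rightarrow> (real \<Rightarrow> 'a) \<Rightarrow> (real \<Rightarrow> 'b) \<Rightarrow> bool" where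
  "tangent_field_along N f c W \<longleftrightarrow>
     (\<exists>e>0. smooth_on {-e<..<e} W \<and> (\<forall>t\<in>{-e<..<e}. W t \<in> tangent_space N f (c t)))"

text \<open>By the Gauss formula, the second fundamental form of the tangent vectors \<open>v\<close>, \<open>w\<close> is the
  normal part of the derivative, in direction \<open>v\<close>, of any tangent field extending \<open>w\<close>; for an
  immersion the result does not depend on the curve and the field.\<close>

definition second_fundamental_form ::
    "'a::real_normed_vector set \<Rightarrow> ('a \<Rightarrow> 'b::euclidean_space) \<Rightarrow> 'a \<Rightarrow> 'b \<Rightarrow> 'b \<Rightarrow> 'b" where
  "second_fundamental_form N f p v w =
     (THE h. \<exists>c W. curve_through N p c \<and> vector_derivative (f \<circ> c) (at 0) = v \<and>
        tangent_field_along N f c W \<and> W 0 = w \<and>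
        h = normal_part (tangent_space N f p) (vector_derivative W (at 0)))"

definition orthonormal_basis_of :: "'b::euclidean_space set \<Rightarrow> 'b set \<Rightarrow> bool" where
  "orthonormal_basis_of T B \<longleftrightarrow>
     pairwise orthogonal B \<and> (\<forall>e\<in>B. norm e = 1) \<and> span B = T"

text \<open>The trace does not depend on the orthonormal basis chosen.\<close>

definition mean_curvature ::
    "'a::real_normed_vector set \<Rightarrow> ('a \<Rightarrow> 'b::euclidean_space) \<Rightarrow> 'a \<Rightarrow> 'b" where
  "mean_curvature N f p =
     (1 / real (dim (tangent_space N f p))) *\<^sub>R
       (\<Sum>e\<in>(SOME B. orthonormal_basis_of (tangent_space N f p) B).
          second_fundamental_form N f p e e)"

definition lagrangian_on :: "'a::real_normed_vector set \<Rightarrow> ('a \<Rightarrow> complex^'n) \<Rightarrow> bool" where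
  "lagrangian_on N f \<longleftrightarrow> (\<forall>p\<in>N. lagrangian_subspace (tangent_space N f p))"

definition self_translator ::
    "'a::real_normed_vector set \<Rightarrow> ('a \<Rightarrow> 'b::euclidean_space) \<Rightarrow> 'b \<Rightarrow> bool" where
  "self_translator N f V0 \<longleftrightarrow>
     (\<forall>p\<in>N. mean_curvature N f p = normal_part (tangent_space N f p) V0)"

text \<open>Self-shrinkers are the case \<open>lam > 0\<close>, self-expanders the case \<open>lam < 0\<close>.\<close>

definition self_similar ::
    "'a::real_normed_vector set \<Rightarrow> ('a \<Rightarrow> 'b::euclidean_space) \<Rightarrow> real \<Rightarrow> bool" where
  "self_similar N f lam \<longleftrightarrow>
     (\<forall>p\<in>N. mean_curvature N f p + lam *\<^sub>R normal_part (tangent_space N f p) (f p) = 0)"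


section \<open>Submanifolds foliated by spheres\<close>

definition open_interval :: "real set \<Rightarrow> bool" where
  "open_interval I \<longleftrightarrow> open I \<and> is_interval I \<and> I \<noteq> {}"

definition sphere_foliated :: "real set \<Rightarrow> (real \<times> (real^'n) \<Rightarrow> complex^'n) \<Rightarrow> bool" where
  "sphere_foliated I F \<longleftrightarrow>
     open_interval I \<and>
     (\<exists>(r :: real \<Rightarrow> real) (M :: real \<Rightarrow> real^('n + 'n)^('n + 'n)) (V :: real \<Rightarrow> complex^'n).
        smooth_on I r \<and> smooth_on I M \<and> smooth_on I V \<and>
        (\<forall>s\<in>I. r s > 0 \<and> rotation_matrix (M s)) \<and>
        (\<forall>s\<in>I. \<forall>x\<in>sphere 0 1. F (s, x) = r s *\<^sub>R to_cplx (M s *v to_real (cvec x)) + V s)) \<and>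
     immersion_on (I \<times> sphere 0 1) F"

text \<open>The image is a piece of a Lagrangian linear subspace, respectively of a translate of one.\<close>

definition in_lagrangian_subspace :: "'a set \<Rightarrow> ('a \<Rightarrow> complex^'n) \<Rightarrow> bool" where
  "in_lagrangian_subspace N f \<longleftrightarrow> (\<exists>L. lagrangian_subspace L \<and> f ` N \<subseteq> L)"

definition in_affine_lagrangian_subspace :: "'a set \<Rightarrow> ('a \<Rightarrow> complex^'n) \<Rightarrow> bool" where
  "in_affine_lagrangian_subspace N f \<longleftrightarrow>
     (\<exists>a L. lagrangian_subspace L \<and> f ` N \<subseteq> (\<lambda>v. a + v) ` L)"

definition centered_immersion :: "(real \<Rightarrow> complex) \<Rightarrow> real \<times> (real^'n) \<Rightarrow> complex^'n" where
  "centered_immersion g = (\<lambda>(s, x). g s *s cvec x)"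

text \<open>Arclength-parametrized planar curves \<open>g = r e\<^sup>i\<^sup>\<phi>\<close>, \<open>g' = e\<^sup>i\<^sup>\<theta>\<close> that avoid the origin and
  satisfy, with curvature \<open>k = \<theta>'\<close> and \<open>\<alpha> = \<theta> - \<phi>\<close>, the equation
  \<open>k + (n - 1) sin \<alpha> / r = n lam r sin \<alpha>\<close>.\<close>

definition self_similar_profile :: "nat \<Rightarrow> real \<Rightarrow> real set \<Rightarrow> (real \<Rightarrow> complex) \<Rightarrow> bool" where
  "self_similar_profile n lam J g \<longleftrightarrow>
     (\<exists>r \<phi> \<theta> :: real \<Rightarrow> real. smooth_on J r \<and> smooth_on J \<phi> \<and> smooth_on J \<theta> \<and>
       (\<forall>s\<in>J. r s > 0 \<and> g s = of_real (r s) * cis (\<phi> s) \<and>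
          (g has_vector_derivative cis (\<theta> s)) (at s) \<and>
          deriv \<theta> s + (real n - 1) * (sin (\<theta> s - \<phi> s) / r s)
            = real n * lam * r s * sin (\<theta> s - \<phi> s)))"

text \<open>Up to a unitary transformation \<open>A\<close>, the immersion \<open>F\<close> is a reparametrization of the
  centered immersion of a profile curve as above. The change of parameters is
  \<open>(s, x) \<mapsto> (\<psi> s, R s x)\<close>, with \<open>\<psi>\<close> a diffeomorphism of intervals and \<open>R s\<close> orthogonal;
  it maps \<open>I \<times> S\<^sup>n\<^sup>-\<^sup>1\<close> diffeomorphically to \<open>J \<times> S\<^sup>n\<^sup>-\<^sup>1\<close>.\<close>

definition centered_with_profile ::
    "real \<Rightarrow> real set \<Rightarrow> (real \<times> (real^'n) \<Rightarrow> complex^'n) \<Rightarrow> bool" where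
  "centered_with_profile lam I F \<longleftrightarrow>
     (\<exists>(A :: complex^'n^'n) J g \<psi> (R :: real \<Rightarrow> real^'n^'n).
        unitary_matrix A \<and> open_interval J \<and> self_similar_profile CARD('n) lam J g \<and>
        bij_betw \<psi> I J \<and> smooth_on I \<psi> \<and> (\<forall>s\<in>I. deriv \<psi> s \<noteq> 0) \<and>
        smooth_on I R \<and> (\<forall>s\<in>I. orthogonal_matrix (R s)) \<and>
        (\<forall>s\<in>I. \<forall>x\<in>sphere 0 1. F (s, x) = A *v centered_immersion g (\<psi> s, R s *v x)))"

end

theory Submission
  imports Defs
begin

text \<open>For \<open>n \<ge> 3\<close> the Lagrangian condition along a family of round spheres forces the planes of
  the spheres to be Lagrangian and to rotate, up to a fixed unitary map, by a phase and by
  reparametrizations of the spheres. Hence the immersion is, up to reparametrization,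
  \<open>(s, y) \<mapsto> A (\<gamma> s y + V s)\<close> with \<open>V' = \<gamma> w\<close>, \<open>w\<close> real. Writing \<open>\<zeta> = \<gamma>' + \<gamma> (w \<bullet> y)\<close>, the mean
  curvature in the normal direction \<open>\<i> \<gamma> q\<close>, \<open>q\<close> orthogonal to \<open>y\<close>, is a multiple of
  \<open>Im (\<gamma>' / \<gamma>) (w \<bullet> q) / |\<zeta>|\<^sup>2\<close>, whereas the right-hand side of either equation depends linearly on
  \<open>q\<close> only. Comparing the dependence on \<open>y\<close> shows that \<open>V\<close> (respectively the translation vector) is a
  real multiple of \<open>\<gamma>\<close>; differentiating, at each parameter either it vanishes or
  \<open>Im (\<gamma>' / \<gamma>) = 0\<close>. For translators the second alternative holds everywhere and the
  submanifold is flat. For self-similar submanifolds a first integral of the profile equation shows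
  that \<open>Im (\<gamma>' / \<gamma>)\<close> vanishes either identically or nowhere, so that the submanifold is flat or
  centered.\<close>

section \<open>Smooth functions\<close>

text \<open>The geometric notions are definite descriptions and choices, so nothing can be computed
  before they are known to be well defined. Both tasks are done by pairing with normal fields: the
  derivative of a normal field along a curve sees only the velocity of the curve, and since the
  chosen fields separate normal vectors (\<open>normals_total\<close>), these pairings determine the
  second fundamental form. The trace is then taken over an orthonormal basis about which nothing is
  known, by writing each summand as a quadratic expression in pairings with fixed tangent vectors
  and applying Parseval. The two kinds of normal fields divide the work. The fields
  \<open>normal_q\<close> detect only the motion of the centers and need no second derivatives of
  the family; they give the rigidity of \<open>V\<close>. The field \<open>normal_0\<close> gives
  the profile equation, but it involves \<open>V''\<close>, so it is evaluated only on an open set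
  where \<open>V\<close> is already known to vanish. This is why the equation is at first available
  only where \<open>\<mu>\<close> is nonzero.\<close>

lemma Ck_on_cong:
  assumes "open T" "\<And>t. t \<in> T \<Longrightarrow> g t = h t"
  shows "Ck_on k T g = Ck_on k T h"
  using assms(2)
proof (induction k arbitrary: g h)
  case 0
  then show ?case by (auto cong: continuous_on_cong)
next
  case (Suc k)
  \<comment> \<open>The derivative is a choice made from \<open>has_vector_derivative\<close>; the
    equivalence for every candidate \<open>d\<close> is what makes the two choices equal.\<close>
  have eq: "(g has_vector_derivative d) (at t) \<longleftrightarrow> (h has_vector_derivative d) (at t)"
    if "t \<in> T" for t d
    using has_vector_derivative_transform_within_open[of g d t T h]
      has_vector_derivative_transform_within_open[of h d t T g] assms(1) Suc.prems that by auto
  then have "vector_derivative g (at t) = vector_derivative h (at t)" if "t \<in> T" for t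
    unfolding vector_derivative_def using that by simp
  moreover have "g differentiable (at t) \<longleftrightarrow> h differentiable (at t)" if "t \<in> T" for t
    using eq[OF that] by (meson differentiableI_vector vector_derivative_works)
  ultimately show ?case
    using Suc.IH[of "\<lambda>t. vector_derivative g (at t)" "\<lambda>t. vector_derivative h (at t)"] by simp
qed

lemma Ck_on_SucI:
  assumes "\<And>t. t \<in> T \<Longrightarrow> (f has_vector_derivative f' t) (at t)"
    and "open T" "Ck_on k T f'"
  shows "Ck_on (Suc k) T f"
proof -
  have "vector_derivative f (at t) = f' t" if "t \<in> T" for t
    using assms(1)[OF that] by (rule vector_derivative_at)
  then have "Ck_on k T (\<lambda>t. vector_derivative f (at t))"
    using Ck_on_cong[OF assms(2), of "\<lambda>t. vector_derivative f (at t)" f'] assms(3) by simp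
  then show ?thesis
    using assms(1) by (auto intro: differentiableI_vector)
qed

lemma Ck_on_Suc_imp: "Ck_on (Suc k) T f \<Longrightarrow> Ck_on k T f"
proof (induction k arbitrary: f)
  case 0
  then show ?case
    by (simp add: continuous_at_imp_continuous_on differentiable_imp_continuous_within)
next
  case (Suc k)
  have "\<forall>t\<in>T. f differentiable (at t)" "Ck_on k T (\<lambda>t. vector_derivative f (at t))"
    using Suc.prems Suc.IH[of "\<lambda>t. vector_derivative f (at t)"] by (auto simp only: Ck_on.simps)
  then show ?case by simp
qed

lemma Ck_on_subset: "Ck_on k T f \<Longrightarrow> S \<subseteq> T \<Longrightarrow> Ck_on k S f"
  by (induction k arbitrary: f) (auto intro: continuous_on_subset)

lemma Ck_on_const: "Ck_on k T (\<lambda>_. c)"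
  by (induction k arbitrary: c) auto

lemma Ck_on_has_derivative:
  "Ck_on (Suc k) T f \<Longrightarrow> t \<in> T \<Longrightarrow> (f has_vector_derivative vector_derivative f (at t)) (at t)"
  by (simp add: vector_derivative_works)

lemma Ck_on_add:
  assumes "open T" "Ck_on k T f" "Ck_on k T g"
  shows "Ck_on k T (\<lambda>t. f t + g t)"
  using assms(2,3)
proof (induction k arbitrary: f g)
  case 0
  then show ?case by (auto intro: continuous_intros)
next
  case (Suc k)
  show ?case
    by (rule Ck_on_SucI[where f'="\<lambda>t. vector_derivative f (at t) + vector_derivative g (at t)"])
      (use has_vector_derivative_add[OF Ck_on_has_derivative[OF Suc.prems(1)]
          Ck_on_has_derivative[OF Suc.prems(2)]] Suc assms(1) in auto)
qed

lemma Ck_on_linear: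
  assumes "open T" "bounded_linear h" "Ck_on k T f"
  shows "Ck_on k T (\<lambda>t. h (f t))"
  using assms(3)
proof (induction k arbitrary: f)
  case 0
  then show ?case using bounded_linear.continuous_on[OF assms(2)] by simp
next
  case (Suc k)
  show ?case
    by (rule Ck_on_SucI[where f'="\<lambda>t. h (vector_derivative f (at t))"])
      (use bounded_linear.has_vector_derivative[OF assms(2) Ck_on_has_derivative[OF Suc.prems]]
        Suc assms(1) in auto)
qed

lemma Ck_on_bilinear:
  assumes "open T" "bounded_bilinear h" "Ck_on k T f" "Ck_on k T g"
  shows "Ck_on k T (\<lambda>t. h (f t) (g t))"
  using assms(3,4)
proof (induction k arbitrary: f g)
  case 0
  then show ?case using bounded_bilinear.continuous_on[OF assms(2)] by simp
next
  case (Suc k)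
  have lower: "Ck_on k T f" "Ck_on k T g"
    using Suc.prems[THEN Ck_on_Suc_imp] by blast+
  show ?case
  proof (rule Ck_on_SucI[where f'="\<lambda>t. h (f t) (vector_derivative g (at t)) + h (vector_derivative f (at t)) (g t)"])
    show "Ck_on k T (\<lambda>t. h (f t) (vector_derivative g (at t)) + h (vector_derivative f (at t)) (g t))"
      by (rule Ck_on_add[OF assms(1) Suc.IH Suc.IH]) (use Suc.prems lower in auto)
  qed (use bounded_bilinear.has_vector_derivative[OF assms(2)
        Ck_on_has_derivative[OF Suc.prems(1)] Ck_on_has_derivative[OF Suc.prems(2)]]
        assms(1) in auto)
qed

lemma Ck_on_compose:
  fixes h :: "real \<Rightarrow> real"
  assumes "open T" "Ck_on k T h" "h ` T \<subseteq> S" "Ck_on k S g"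
  shows "Ck_on k T (\<lambda>t. g (h t))"
  using assms(2-4)
proof (induction k arbitrary: g)
  case 0
  then show ?case by (auto intro: continuous_on_compose2)
next
  case (Suc k)
  show ?case
  proof (rule Ck_on_SucI[where f'="\<lambda>t. vector_derivative h (at t) *\<^sub>R vector_derivative g (at (h t))"])
    show "((\<lambda>t. g (h t)) has_vector_derivative vector_derivative h (at t) *\<^sub>R vector_derivative g (at (h t))) (at t)"
      if "t \<in> T" for t
    proof -
      have "h t \<in> S" using Suc.prems(2) that by auto
      then show ?thesis
        using vector_diff_chain_at[OF Ck_on_has_derivative[OF Suc.prems(1) that]
            Ck_on_has_derivative[OF Suc.prems(3)]] by (simp add: o_def)
    qed
    show "Ck_on k T (\<lambda>t. vector_derivative h (at t) *\<^sub>R vector_derivative g (at (h t)))"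
    proof (rule Ck_on_bilinear[OF assms(1) bounded_bilinear_scaleR])
      show "Ck_on k T (\<lambda>t. vector_derivative h (at t))" using Suc.prems(1) by simp
      show "Ck_on k T (\<lambda>t. vector_derivative g (at (h t)))"
        by (rule Suc.IH[OF Ck_on_Suc_imp[OF Suc.prems(1)] Suc.prems(2)]) (use Suc.prems(3) in simp)
    qed
  qed (rule assms(1))
qed

section \<open>Closure properties of smooth functions\<close>

lemma smooth_on_derivative:
  "smooth_on T f \<Longrightarrow> t \<in> T \<Longrightarrow> (f has_vector_derivative vector_derivative f (at t)) (at t)"
  unfolding smooth_on_def using Ck_on_has_derivative by blast

lemma smooth_on_vector_derivative:
  "smooth_on T f \<Longrightarrow> smooth_on T (\<lambda>t. vector_derivative f (at t))"
  unfolding smooth_on_def using Ck_on.simps(2) by blast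

lemma smooth_onI:
  assumes "\<And>t. t \<in> T \<Longrightarrow> (f has_vector_derivative f' t) (at t)"
    and "open T" "smooth_on T f'"
  shows "smooth_on T f"
  unfolding smooth_on_def
  using Ck_on_SucI[OF assms(1,2)] assms(3) Ck_on_Suc_imp unfolding smooth_on_def by blast

lemma smooth_on_continuous: "smooth_on T f \<Longrightarrow> continuous_on T f"
  unfolding smooth_on_def using Ck_on.simps(1) by blast

lemma smooth_on_subset: "smooth_on T f \<Longrightarrow> S \<subseteq> T \<Longrightarrow> smooth_on S f"
  unfolding smooth_on_def using Ck_on_subset by blast

lemma smooth_on_cong:
  assumes "smooth_on T f" "open T" "\<And>t. t \<in> T \<Longrightarrow> f t = g t"
  shows "smooth_on T g"
  using assms Ck_on_cong[OF assms(2,3)] unfolding smooth_on_def by simp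

lemma smooth_on_const [simp]: "smooth_on T (\<lambda>_. c)"
  unfolding smooth_on_def by (simp add: Ck_on_const)

lemma smooth_on_ident [simp]: "open T \<Longrightarrow> smooth_on T (\<lambda>t. t)"
  by (rule smooth_onI[where f'="\<lambda>_. 1"]) (auto intro: derivative_eq_intros)

lemma smooth_on_add:
  "open T \<Longrightarrow> smooth_on T f \<Longrightarrow> smooth_on T g \<Longrightarrow> smooth_on T (\<lambda>t. f t + g t)"
  unfolding smooth_on_def by (blast intro: Ck_on_add)

lemma smooth_on_linear:
  "open T \<Longrightarrow> smooth_on T f \<Longrightarrow> bounded_linear h \<Longrightarrow> smooth_on T (\<lambda>t. h (f t))"
  unfolding smooth_on_def by (blast intro: Ck_on_linear)

lemma smooth_on_bilinear:
  "open T \<Longrightarrow> smooth_on T f \<Longrightarrow> smooth_on T g \<Longrightarrow> bounded_bilinear h \<Longrightarrow>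
    smooth_on T (\<lambda>t. h (f t) (g t))"
  unfolding smooth_on_def by (blast intro: Ck_on_bilinear)

lemma smooth_on_compose:
  fixes h :: "real \<Rightarrow> real"
  assumes "open T" "smooth_on T h" "smooth_on S g" "h ` T \<subseteq> S"
  shows "smooth_on T (\<lambda>t. g (h t))"
  using assms Ck_on_compose[of T _ h S g] unfolding smooth_on_def by blast

lemma smooth_on_minus: "open T \<Longrightarrow> smooth_on T f \<Longrightarrow> smooth_on T (\<lambda>t. - f t)"
  using smooth_on_linear[OF _ _ bounded_linear_minus[OF bounded_linear_ident]] .

lemma smooth_on_diff:
  assumes "open T" "smooth_on T f" "smooth_on T g"
  shows "smooth_on T (\<lambda>t. f t - g t)"
  using smooth_on_add[OF assms(1,2) smooth_on_minus[OF assms(1,3)]] by simp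

lemma smooth_on_mult:
  fixes f g :: "real \<Rightarrow> 'a::real_normed_algebra"
  shows "open T \<Longrightarrow> smooth_on T f \<Longrightarrow> smooth_on T g \<Longrightarrow> smooth_on T (\<lambda>t. f t * g t)"
  by (rule smooth_on_bilinear[OF _ _ _ bounded_bilinear_mult])

lemma smooth_on_scaleR:
  "open T \<Longrightarrow> smooth_on T f \<Longrightarrow> smooth_on T g \<Longrightarrow> smooth_on T (\<lambda>t. f t *\<^sub>R g t)"
  by (rule smooth_on_bilinear[OF _ _ _ bounded_bilinear_scaleR])

lemma smooth_on_Re: "open T \<Longrightarrow> smooth_on T f \<Longrightarrow> smooth_on T (\<lambda>t. Re (f t))"
  by (rule smooth_on_linear[OF _ _ bounded_linear_Re])

lemma smooth_on_Im: "open T \<Longrightarrow> smooth_on T f \<Longrightarrow> smooth_on T (\<lambda>t. Im (f t))"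
  by (rule smooth_on_linear[OF _ _ bounded_linear_Im])

lemma smooth_on_cnj: "open T \<Longrightarrow> smooth_on T f \<Longrightarrow> smooth_on T (\<lambda>t. cnj (f t))"
  by (rule smooth_on_linear[OF _ _ bounded_linear_cnj])

lemma smooth_on_of_real:
  "open T \<Longrightarrow> smooth_on T f \<Longrightarrow> smooth_on T (\<lambda>t. complex_of_real (f t))"
  by (rule smooth_on_linear[OF _ _ bounded_linear_of_real])

lemma smooth_on_Pair:
  assumes "open T" "smooth_on T f" "smooth_on T g"
  shows "smooth_on T (\<lambda>t. (f t, g t))"
proof -
  have "smooth_on T (\<lambda>t. (f t, 0) + (0, g t))"
    by (intro smooth_on_add assms smooth_on_linear[OF _ assms(2)] smooth_on_linear[OF _ assms(3)]
        bounded_linear_Pair bounded_linear_ident bounded_linear_zero)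
  then show ?thesis by simp
qed

text \<open>The two inductions run together because differentiation exchanges the functions up to
  sign.\<close>

lemma smooth_on_sin_cos: "smooth_on UNIV sin \<and> smooth_on UNIV (cos :: real \<Rightarrow> real)"
proof -
  have "Ck_on k UNIV (sin :: real \<Rightarrow> real) \<and> Ck_on k UNIV (cos :: real \<Rightarrow> real)" for k
  proof (induction k)
    case 0
    then show ?case by (auto intro: continuous_intros)
  next
    case (Suc k)
    have "Ck_on k UNIV (\<lambda>t::real. - sin t)"
      using Suc Ck_on_linear[OF _ bounded_linear_minus[OF bounded_linear_ident], of UNIV k sin] by simp
    then show ?case
      using Suc
      by (intro conjI Ck_on_SucI[of _ sin cos] Ck_on_SucI[of _ cos "\<lambda>t. - sin t"])
        (auto simp: has_real_derivative_iff_has_vector_derivative[symmetric]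
          intro!: derivative_eq_intros)
  qed
  then show ?thesis unfolding smooth_on_def by blast
qed

lemma smooth_on_cis:
  assumes "open T" "smooth_on T f"
  shows "smooth_on T (\<lambda>t. cis (f t))"
proof -
  have "smooth_on T (\<lambda>t. complex_of_real (cos (f t)) + \<i> * complex_of_real (sin (f t)))"
    using smooth_on_compose[OF assms(1,2), of UNIV] smooth_on_sin_cos
    by (intro smooth_on_add smooth_on_of_real smooth_on_mult assms smooth_on_const) auto
  then show ?thesis by (simp add: cis_conv_exp exp_Euler cos_of_real sin_of_real)
qed

lemma smooth_on_inverse:
  fixes f :: "real \<Rightarrow> real"
  assumes "open T" "smooth_on T f" "\<And>t. t \<in> T \<Longrightarrow> f t \<noteq> 0"
  shows "smooth_on T (\<lambda>t. inverse (f t))"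
proof -
  have op: "open {t::real. t \<noteq> 0}"
    by (simp add: open_Collect_neq)
  have "Ck_on k {t. t \<noteq> 0} (inverse :: real \<Rightarrow> real)" for k
  proof (induction k)
    case 0
    then show ?case by (auto intro: continuous_intros)
  next
    case (Suc k)
    \<comment> \<open>The derivative of \<open>inverse\<close> is a polynomial in
      \<open>inverse\<close> itself, so the induction hypothesis controls it.\<close>
    have "Ck_on k {t. t \<noteq> 0} (\<lambda>t::real. - (inverse t * inverse t))"
      by (intro Ck_on_linear[OF op bounded_linear_minus[OF bounded_linear_ident]]
          Ck_on_bilinear[OF op bounded_bilinear_mult] Suc)
    then show ?case
      by (intro Ck_on_SucI[OF _ op, of inverse "\<lambda>t. - (inverse t * inverse t)"])
        (auto simp: has_real_derivative_iff_has_vector_derivative[symmetric]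
          intro!: derivative_eq_intros)
  qed
  then have "smooth_on {t. t \<noteq> 0} (inverse :: real \<Rightarrow> real)"
    unfolding smooth_on_def by blast
  from smooth_on_compose[OF assms(1,2) this] show ?thesis
    using assms(3) by (simp add: image_subset_iff)
qed

lemma smooth_on_divide:
  fixes f g :: "real \<Rightarrow> real"
  assumes "open T" "smooth_on T f" "smooth_on T g" "\<And>t. t \<in> T \<Longrightarrow> g t \<noteq> 0"
  shows "smooth_on T (\<lambda>t. f t / g t)"
  using smooth_on_mult[OF assms(1,2) smooth_on_inverse[OF assms(1,3,4)]]
  by (simp add: divide_inverse)

lemma smooth_on_sqrt:
  assumes "open T" "smooth_on T f" "\<And>t. t \<in> T \<Longrightarrow> f t > 0"
  shows "smooth_on T (\<lambda>t. sqrt (f t))"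
proof -
  have inv: "smooth_on {t. t \<noteq> 0} (inverse :: real \<Rightarrow> real)"
    by (rule smooth_on_inverse) (auto simp: open_Collect_neq)
  have "Ck_on k {0<..} sqrt" for k
  proof (induction k)
    case 0
    then show ?case by (auto intro: continuous_intros)
  next
    case (Suc k)
    have "Ck_on k {0<..} (\<lambda>t. inverse (sqrt t))"
      by (rule Ck_on_compose[OF _ Suc, of "{t. t \<noteq> 0}"]) (use inv in \<open>auto simp: smooth_on_def\<close>)
    then have "Ck_on k {0<..} (\<lambda>t. inverse (sqrt t) / 2)"
      by (intro Ck_on_linear[OF _ bounded_linear_divide]) auto
    then show ?case
      by (rule Ck_on_SucI[rotated 2])
        (auto simp: has_real_derivative_iff_has_vector_derivative[symmetric] intro: DERIV_real_sqrt)
  qed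
  then have "smooth_on {0<..} sqrt"
    unfolding smooth_on_def by blast
  from smooth_on_compose[OF assms(1,2) this] show ?thesis
    using assms(3) by (simp add: image_subset_iff)
qed

lemma smooth_on_antiderivative:
  fixes f :: "real \<Rightarrow> real"
  assumes "open_interval I" "smooth_on I f" "s0 \<in> I"
  obtains g where "smooth_on I g" "g s0 = c" "\<And>s. s \<in> I \<Longrightarrow> (g has_vector_derivative f s) (at s)"
proof -
  have I: "open I" "is_interval I" using assms(1) by (auto simp: open_interval_def)
  have cont: "continuous_on I f" using assms(2) by (rule smooth_on_continuous)
  \<comment> \<open>An integral over an empty interval is 0, so on either side of \<open>s0\<close>
    only one term survives and \<open>h\<close> is the signed integral from \<open>s0\<close> to
    \<open>s\<close>.\<close>
  define h where "h s = integral {s0..s} f - integral {s..s0} f" for s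
  have seg: "{a..b} \<subseteq> I" if "a \<in> I" "b \<in> I" for a b
    using I(2) that unfolding is_interval_1 by (meson atLeastAtMost_iff subsetI)
  have h: "(h has_vector_derivative f s) (at s)" if "s \<in> I" for s
  proof -
    obtain e where e: "e > 0" "cball s e \<subseteq> I" using I(1) \<open>s \<in> I\<close> by (meson open_contains_cball)
    define a b where "a = min s0 (s - e)" and "b = max s0 (s + e)"
    have ab: "a \<in> I" "b \<in> I" "a \<le> s0" "s0 \<le> b" "a < s" "s < b"
      using e assms(3) by (auto simp: a_def b_def min_def max_def cball_def dist_real_def)
    have cab: "continuous_on {a..b} f" using cont seg[OF ab(1,2)] continuous_on_subset by blast
    have "((\<lambda>u. integral {a..u} f) has_vector_derivative f s) (at s within {a..b})"
      by (rule integral_has_vector_derivative[OF cab]) (use ab in auto)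
    then have d: "((\<lambda>u. integral {a..u} f) has_vector_derivative f s) (at s)"
      using ab by (simp add: at_within_Icc_at)
    have eq: "integral {a..u} f - integral {a..s0} f = h u" if "u \<in> {a<..<b}" for u
    proof -
      have int: "f integrable_on {c..d}" if "a \<le> c" "d \<le> b" for c d
        using integrable_continuous_interval[OF continuous_on_subset[OF cab]] that by auto
      show ?thesis
      proof (cases "u \<le> s0")
        case True
        then have "integral {a..u} f + integral {u..s0} f = integral {a..s0} f"
          by (intro Henstock_Kurzweil_Integration.integral_combine int) (use that ab in auto)
        moreover have "integral {s0..u} f = 0" using True by (cases "u = s0") auto
        ultimately show ?thesis by (simp add: h_def)
      next
        case False
        then have "integral {a..s0} f + integral {s0..u} f = integral {a..u} f"
          by (intro Henstock_Kurzweil_Integration.integral_combine int) (use that ab in auto)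
        then show ?thesis using False by (simp add: h_def)
      qed
    qed
    have "((\<lambda>u. integral {a..u} f - integral {a..s0} f) has_vector_derivative f s) (at s)"
      using d by (auto intro!: derivative_eq_intros)
    then show ?thesis
      by (rule has_vector_derivative_transform_within_open[of _ _ _ "{a<..<b}"]) (use ab eq in auto)
  qed
  show ?thesis
  proof
    show d: "((\<lambda>s. h s + c) has_vector_derivative f s) (at s)" if "s \<in> I" for s
      using h[OF that] by (auto intro!: derivative_eq_intros)
    show "smooth_on I (\<lambda>s. h s + c)"
      by (rule smooth_onI[OF d I(1) assms(2)])
    show "h s0 + c = c" by (simp add: h_def)
  qed
qed

lemma open_interval_constant:
  assumes "open_interval I" "\<And>s. s \<in> I \<Longrightarrow> (f has_vector_derivative 0) (at s)"
    "s \<in> I" "t \<in> I"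
  shows "f s = f t"
proof (rule has_derivative_zero_unique[of I f s t])
  show "convex I" using assms(1) by (simp add: open_interval_def is_interval_convex_1)
  show "(f has_derivative (\<lambda>h. 0)) (at u within I)" if "u \<in> I" for u
    using has_vector_derivative_at_within[OF assms(2)[OF that]] by (simp add: has_vector_derivative_def)
qed (use assms in auto)

section \<open>Extrinsic geometry\<close>

text \<open>Turns the radii \<open>e\<close> of the definitions into statements about germs, so that
  several of them can be combined without taking minima.\<close>

lemma eventually_nhds_0_interval:
  "(\<forall>\<^sub>F t in nhds (0::real). P t) \<longleftrightarrow> (\<exists>e>0. \<forall>t\<in>{-e<..<e}. P t)"
  unfolding eventually_nhds_metric by (auto simp: dist_real_def abs_less_iff)

lemma vector_derivative_eventually_cong:
  assumes "\<forall>\<^sub>F t in nhds x. f t = g t"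
  shows "vector_derivative f (at x) = vector_derivative g (at x)"
  by (rule vector_derivative_cong_eq) (use assms in auto)

lemma curve_through_base: "curve_through N p c \<Longrightarrow> c 0 = p \<and> p \<in> N"
  unfolding curve_through_def by (metis (no_types, lifting) greaterThanLessThan_iff
      image_subset_iff neg_less_0_iff_less)

lemma curve_through_eventually: "curve_through N p c \<Longrightarrow> \<forall>\<^sub>F t in nhds 0. c t \<in> N"
  unfolding curve_through_def eventually_nhds_0_interval by auto

lemma curve_through_derivative:
  "curve_through N p c \<Longrightarrow> (c has_vector_derivative vector_derivative c (at 0)) (at 0)"
  unfolding curve_through_def using smooth_on_derivative[of _ c 0] by force

lemma curve_through_pair_derivatives:
  fixes c :: "real \<Rightarrow> real \<times> 'a::real_normed_vector"
  assumes "curve_through N (s, y) c" "vector_derivative c (at 0) = (a, u)"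
  shows "((\<lambda>t. snd (c t)) has_vector_derivative u) (at 0)"
    and "(f has_vector_derivative f') (at s) \<Longrightarrow> ((\<lambda>t. f (fst (c t))) has_vector_derivative a *\<^sub>R f') (at 0)"
proof -
  have dc: "(c has_vector_derivative (a, u)) (at 0)"
    using curve_through_derivative[OF assms(1)] assms(2) by simp
  show "((\<lambda>t. snd (c t)) has_vector_derivative u) (at 0)"
    using bounded_linear.has_vector_derivative[OF bounded_linear_snd dc] by simp
  have "((\<lambda>t. fst (c t)) has_vector_derivative a) (at 0)"
    using bounded_linear.has_vector_derivative[OF bounded_linear_fst dc] by simp
  from vector_diff_chain_at[OF this, of f f']
  show "((\<lambda>t. f (fst (c t))) has_vector_derivative a *\<^sub>R f') (at 0)"
    if "(f has_vector_derivative f') (at s)"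
    using that curve_through_base[OF assms(1)] by (simp add: o_def)
qed

lemma vector_derivative_shift:
  assumes "f differentiable (at t)"
  shows "vector_derivative (\<lambda>s. f (t + s)) (at 0) = vector_derivative f (at (t::real))"
proof -
  have f: "(f has_vector_derivative vector_derivative f (at t)) (at (t + 0))"
    using assms by (simp add: vector_derivative_works)
  have "((\<lambda>s. t + s) has_vector_derivative 1) (at (0::real))"
    by (auto intro!: derivative_eq_intros)
  from vector_diff_chain_at[OF this f] show ?thesis
    by (auto simp: o_def intro: vector_derivative_at)
qed

lemma curve_through_shift:
  assumes "smooth_on {-e<..<e} c" "c ` {-e<..<e} \<subseteq> N" "t \<in> {-e<..<e}"
  shows "curve_through N (c t) (\<lambda>s. c (t + s))"
proof -
  \<comment> \<open>The distance from \<open>t\<close> to the nearer end of the interval.\<close>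
  define d where "d = min (e - t) (e + t)"
  have sub: "(\<lambda>s. t + s) ` {-d<..<d} \<subseteq> {-e<..<e}"
    by (auto simp: d_def)
  have "smooth_on {-d<..<d} (\<lambda>s. c (t + s))"
    by (rule smooth_on_compose[OF _ _ assms(1) sub])
      (auto intro!: smooth_on_add)
  moreover have "(\<lambda>s. c (t + s)) ` {-d<..<d} \<subseteq> N"
    using sub assms(2) by (auto simp: image_subset_iff)
  moreover have "d > 0" using assms(3) by (auto simp: d_def)
  ultimately show ?thesis unfolding curve_through_def by auto
qed

text \<open>Supplies a witness for the description that defines the second fundamental form. The
  velocity at time \<open>t\<close> is the velocity at time 0 of the shifted curve, hence tangent at
  \<open>c t\<close>.\<close>

lemma tangent_field_velocity:
  assumes "curve_through N p c" "\<exists>e>0. smooth_on {-e<..<e} (f \<circ> c)"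
  shows "tangent_field_along N f c (\<lambda>t. vector_derivative (f \<circ> c) (at t))"
proof -
  obtain a b where ab: "a > 0" "b > 0" "smooth_on {-a<..<a} c" "c ` {-a<..<a} \<subseteq> N"
      "smooth_on {-b<..<b} (f \<circ> c)"
    using assms unfolding curve_through_def by auto
  define e where "e = min a b"
  have e: "e > 0" "{-e<..<e} \<subseteq> {-a<..<a}" "{-e<..<e} \<subseteq> {-b<..<b}"
    using ab by (auto simp: e_def)
  have "vector_derivative (f \<circ> c) (at t) \<in> tangent_space N f (c t)" if "t \<in> {-e<..<e}" for t
  proof -
    have "(f \<circ> c) differentiable (at t)"
      using smooth_on_derivative[OF ab(5), of t] that e(3) by (blast intro: differentiableI_vector)
    from vector_derivative_shift[OF this]
    have "vector_derivative (f \<circ> c) (at t) = vector_derivative (f \<circ> (\<lambda>s. c (t + s))) (at 0)"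
      by (simp add: o_def)
    then show ?thesis
      using curve_through_shift[OF ab(3,4), of t] that e unfolding tangent_space_def by blast
  qed
  then show ?thesis
    unfolding tangent_field_along_def
    using e smooth_on_subset[OF smooth_on_vector_derivative[OF ab(5)], of "{-e<..<e}"] by blast
qed

section \<open>Normal projections and the second fundamental form\<close>

lemma normal_part_exists1:
  fixes T :: "'b::euclidean_space set"
  assumes "subspace T"
  shows "\<exists>!w. w \<in> orthogonal_comp T \<and> v - w \<in> T"
proof -
  have "v \<in> T + orthogonal_comp T"
    using subspace_sum_orthogonal_comp[OF assms] by simp
  then obtain t w where tw: "v = t + w" "t \<in> T" "w \<in> orthogonal_comp T"
    by (auto elim: set_plus_elim)
  show ?thesis
  proof
    show "w \<in> orthogonal_comp T \<and> v - w \<in> T" using tw by simp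
    fix u assume u: "u \<in> orthogonal_comp T \<and> v - u \<in> T"
    then have "u - w \<in> orthogonal_comp T" "(v - w) - (v - u) \<in> T"
      using subspace_diff[OF subspace_orthogonal_comp, of u T w]
        subspace_diff[OF assms, of "v - w" "v - u"] tw u by auto
    then have "(u - w) \<bullet> (u - w) = 0"
      by (simp add: orthogonal_comp_def orthogonal_def)
    then show "u = w" by simp
  qed
qed

lemma normal_part_in:
  assumes "subspace T"
  shows "normal_part T v \<in> orthogonal_comp T" "v - normal_part T v \<in> T"
  using theI'[OF normal_part_exists1[OF assms, of v]] unfolding normal_part_def by auto

lemma normal_part_eqI:
  assumes "subspace T" "w \<in> orthogonal_comp T" "v - w \<in> T"
  shows "normal_part T v = w"
  unfolding normal_part_def using normal_part_exists1[OF assms(1), of v] assms by (auto intro: the1_equality)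

lemma normal_part_inner:
  assumes "subspace T" "n \<in> orthogonal_comp T"
  shows "normal_part T v \<bullet> n = v \<bullet> n"
proof -
  have "(v - normal_part T v) \<bullet> n = 0"
    using normal_part_in(2)[OF assms(1)] assms(2) by (simp add: orthogonal_comp_def orthogonal_def)
  then show ?thesis by (simp add: inner_diff_left)
qed

text \<open>A normal field stays orthogonal to a tangent field, so the
  derivative can be moved from one to the other.\<close>

lemma weingarten:
  assumes c: "curve_through N p c" and W: "tangent_field_along N f c W"
    and T: "subspace (tangent_space N f p)"
    and \<nu>: "\<And>q. q \<in> N \<Longrightarrow> \<nu> q \<in> orthogonal_comp (tangent_space N f q)"
    and D: "(\<nu> has_derivative D) (at p)"
  shows "normal_part (tangent_space N f p) (vector_derivative W (at 0)) \<bullet> \<nu> p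
    = - (W 0 \<bullet> D (vector_derivative c (at 0)))"
proof -
  have p: "c 0 = p" "p \<in> N" using curve_through_base[OF c] by auto
  obtain e where e: "e > 0" "smooth_on {-e<..<e} W"
      "\<And>t. t \<in> {-e<..<e} \<Longrightarrow> W t \<in> tangent_space N f (c t)"
    using W unfolding tangent_field_along_def by auto
  have dW: "(W has_vector_derivative vector_derivative W (at 0)) (at 0)"
    using smooth_on_derivative[OF e(2), of 0] e(1) by simp
  have "((\<lambda>t. \<nu> (c t)) has_derivative (\<lambda>h. D (h *\<^sub>R vector_derivative c (at 0)))) (at 0)"
    using diff_chain_at[OF curve_through_derivative[OF c, unfolded has_vector_derivative_def], of \<nu> D] D
    by (simp add: o_def p)
  then have d\<nu>: "((\<lambda>t. \<nu> (c t)) has_vector_derivative D (vector_derivative c (at 0))) (at 0)"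
    unfolding has_vector_derivative_def
    by (simp add: linear_cmul[OF bounded_linear.linear[OF has_derivative_bounded_linear[OF D]]])
  have "\<forall>\<^sub>F t in nhds 0. W t \<in> tangent_space N f (c t)"
    unfolding eventually_nhds_0_interval using e by auto
  then have "\<forall>\<^sub>F t in nhds 0. W t \<bullet> \<nu> (c t) = 0"
    using curve_through_eventually[OF c]
    by eventually_elim (use \<nu> in \<open>auto simp: orthogonal_comp_def orthogonal_def\<close>)
  then have "vector_derivative (\<lambda>t. W t \<bullet> \<nu> (c t)) (at 0) = 0"
    using vector_derivative_eventually_cong[of "\<lambda>t. W t \<bullet> \<nu> (c t)" "\<lambda>_. 0" 0] by simp
  moreover have "((\<lambda>t. W t \<bullet> \<nu> (c t)) has_vector_derivative
      W 0 \<bullet> D (vector_derivative c (at 0)) + vector_derivative W (at 0) \<bullet> \<nu> (c 0)) (at 0)"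
    by (rule bounded_bilinear.has_vector_derivative[OF bounded_bilinear_inner dW d\<nu>])
  ultimately have "W 0 \<bullet> D (vector_derivative c (at 0)) + vector_derivative W (at 0) \<bullet> \<nu> p = 0"
    using vector_derivative_at p(1) by metis
  then show ?thesis
    using normal_part_inner[OF T \<nu>[OF p(2)]] by simp
qed

text \<open>The trace needs equal arguments only, and then the velocity field of the curve is an
  admissible extension, which gives existence. For uniqueness, two admissible values have the same
  pairing with every field of \<open>\<V>\<close> by \<open>weingarten\<close>, because
  \<open>inj\<close> makes the velocities of their curves agree, and \<open>\<V>\<close> separates
  normal vectors.\<close>

lemma second_fundamental_form_diag:
  assumes T: "subspace (tangent_space N f p)"
    and normal: "\<And>\<nu> q. \<nu> \<in> \<V> \<Longrightarrow> q \<in> N \<Longrightarrow> \<nu> q \<in> orthogonal_comp (tangent_space N f q)"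
    and D: "\<And>\<nu>. \<nu> \<in> \<V> \<Longrightarrow> (\<nu> has_derivative D \<nu>) (at p)"
    and total: "\<And>h. h \<in> orthogonal_comp (tangent_space N f p) \<Longrightarrow> (\<And>\<nu>. \<nu> \<in> \<V> \<Longrightarrow> h \<bullet> \<nu> p = 0) \<Longrightarrow> h = 0"
    and inj: "\<And>c d. curve_through N p c \<Longrightarrow> curve_through N p d \<Longrightarrow>
        vector_derivative (f \<circ> c) (at 0) = vector_derivative (f \<circ> d) (at 0) \<Longrightarrow>
        vector_derivative c (at 0) = vector_derivative d (at 0)"
    and c: "curve_through N p c" "\<exists>e>0. smooth_on {-e<..<e} (f \<circ> c)"
    and v: "vector_derivative (f \<circ> c) (at 0) = v"
  shows "second_fundamental_form N f p v v \<in> orthogonal_comp (tangent_space N f p)"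
    and "\<nu> \<in> \<V> \<Longrightarrow> second_fundamental_form N f p v v \<bullet> \<nu> p = - (v \<bullet> D \<nu> (vector_derivative c (at 0)))"
proof -
  let ?T = "tangent_space N f p"
  let ?W = "\<lambda>t. vector_derivative (f \<circ> c) (at t)"
  have W: "tangent_field_along N f c ?W"
    by (rule tangent_field_velocity[OF c])
  have sff: "second_fundamental_form N f p v v = normal_part ?T (vector_derivative ?W (at 0))"
    unfolding second_fundamental_form_def
  proof (rule the_equality)
    show "\<exists>c' W. curve_through N p c' \<and> vector_derivative (f \<circ> c') (at 0) = v \<and>
        tangent_field_along N f c' W \<and> W 0 = v \<and>
        normal_part ?T (vector_derivative ?W (at 0)) = normal_part ?T (vector_derivative W (at 0))"
      using c(1) v W by blast
  next
    fix h
    assume "\<exists>c W. curve_through N p c \<and> vector_derivative (f \<circ> c) (at 0) = v \<and>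
        tangent_field_along N f c W \<and> W 0 = v \<and> h = normal_part ?T (vector_derivative W (at 0))"
    then obtain d W where d: "curve_through N p d" "vector_derivative (f \<circ> d) (at 0) = v"
        "tangent_field_along N f d W" "W 0 = v" "h = normal_part ?T (vector_derivative W (at 0))"
      by blast
    have same: "vector_derivative d (at 0) = vector_derivative c (at 0)"
      using inj[OF d(1) c(1)] d(2) v by simp
    have "h - normal_part ?T (vector_derivative ?W (at 0)) = 0"
    proof (rule total)
      show "h - normal_part ?T (vector_derivative ?W (at 0)) \<in> orthogonal_comp ?T"
        unfolding d(5) by (intro subspace_diff subspace_orthogonal_comp normal_part_in T)
      show "(h - normal_part ?T (vector_derivative ?W (at 0))) \<bullet> \<nu> p = 0" if "\<nu> \<in> \<V>" for \<nu>
        using weingarten[OF d(1,3) T normal[OF that] D[OF that]]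
          weingarten[OF c(1) W T normal[OF that] D[OF that]] same v d(4,5)
        by (simp add: inner_diff_left)
    qed
    then show "h = normal_part ?T (vector_derivative ?W (at 0))" by simp
  qed
  show "second_fundamental_form N f p v v \<in> orthogonal_comp ?T"
    unfolding sff by (rule normal_part_in(1)[OF T])
  show "second_fundamental_form N f p v v \<bullet> \<nu> p = - (v \<bullet> D \<nu> (vector_derivative c (at 0)))"
    if "\<nu> \<in> \<V>"
    unfolding sff using weingarten[OF c(1) W T normal[OF that] D[OF that]] v by simp
qed

lemma orthonormal_basis_of_finite:
  assumes "orthonormal_basis_of T B"
  shows "finite B" "card B = dim T"
proof -
  have ind: "independent B"
    using assms unfolding orthonormal_basis_of_def
    by (intro pairwise_orthogonal_independent) auto
  then show "finite B" by (rule independent_imp_finite)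
  show "card B = dim T"
    using ind assms dim_span_eq_card_independent unfolding orthonormal_basis_of_def by metis
qed

text \<open>Allows a trace to be evaluated in the basis picked by \<open>SOME\<close>, of which only
  orthonormality is known.\<close>

lemma orthonormal_basis_of_parseval:
  assumes "orthonormal_basis_of T B" "x \<in> T"
  shows "(\<Sum>e\<in>B. (e \<bullet> x) * (e \<bullet> y)) = x \<bullet> y"
proof -
  have "(\<Sum>e\<in>B. (x \<bullet> e) *\<^sub>R e) = x"
    using assms orthonormal_basis_of_finite(1)[OF assms(1)] unfolding orthonormal_basis_of_def
    by (intro orthonormal_basis_expand) auto
  then have "x \<bullet> y = (\<Sum>e\<in>B. (x \<bullet> e) *\<^sub>R e) \<bullet> y" by simp
  then show ?thesis by (simp add: inner_sum_left inner_commute[of x])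
qed

lemma orthonormal_basis_of_some:
  assumes "subspace T"
  shows "orthonormal_basis_of T (SOME B. orthonormal_basis_of T B)"
proof -
  obtain B where "pairwise orthogonal B" "\<And>x. x \<in> B \<Longrightarrow> norm x = 1" "span B = T"
    by (rule orthonormal_basis_subspace[OF assms], rule that)
  then have "orthonormal_basis_of T B" by (simp add: orthonormal_basis_of_def)
  then show ?thesis by (rule someI)
qed

text \<open>Here \<open>u\<close> recovers the parameter velocity from a tangent vector, so that
  \<open>D \<nu> (u e)\<close> makes sense for a basis vector \<open>e\<close> with no curve
  attached to it.\<close>

lemma mean_curvature_inner:
  assumes T: "subspace (tangent_space N f p)" "dim (tangent_space N f p) \<noteq> 0"
    and normal: "\<And>\<nu> q. \<nu> \<in> \<V> \<Longrightarrow> q \<in> N \<Longrightarrow> \<nu> q \<in> orthogonal_comp (tangent_space N f q)"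
    and D: "\<And>\<nu>. \<nu> \<in> \<V> \<Longrightarrow> (\<nu> has_derivative D \<nu>) (at p)"
    and total: "\<And>h. h \<in> orthogonal_comp (tangent_space N f p) \<Longrightarrow> (\<And>\<nu>. \<nu> \<in> \<V> \<Longrightarrow> h \<bullet> \<nu> p = 0) \<Longrightarrow> h = 0"
    and smooth: "\<And>c. curve_through N p c \<Longrightarrow> \<exists>e>0. smooth_on {-e<..<e} (f \<circ> c)"
    and u: "\<And>c. curve_through N p c \<Longrightarrow> vector_derivative c (at 0) = u (vector_derivative (f \<circ> c) (at 0))"
  obtains B where "orthonormal_basis_of (tangent_space N f p) B"
    "mean_curvature N f p \<in> orthogonal_comp (tangent_space N f p)"
    "\<And>\<nu>. \<nu> \<in> \<V> \<Longrightarrow> real (dim (tangent_space N f p)) * (mean_curvature N f p \<bullet> \<nu> p)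
       = - (\<Sum>e\<in>B. e \<bullet> D \<nu> (u e))"
proof -
  let ?T = "tangent_space N f p"
  define B where "B = (SOME B. orthonormal_basis_of ?T B)"
  have B: "orthonormal_basis_of ?T B"
    unfolding B_def by (rule orthonormal_basis_of_some[OF T(1)])
  have sff: "second_fundamental_form N f p v v \<in> orthogonal_comp ?T"
      "\<nu> \<in> \<V> \<Longrightarrow> second_fundamental_form N f p v v \<bullet> \<nu> p = - (v \<bullet> D \<nu> (u v))"
    if v: "v \<in> ?T" for v \<nu>
  proof -
    obtain c where c: "curve_through N p c" "vector_derivative (f \<circ> c) (at 0) = v"
      using v unfolding tangent_space_def by auto
    have inj: "vector_derivative c (at 0) = vector_derivative d (at 0)"
      if "curve_through N p c" "curve_through N p d"
        "vector_derivative (f \<circ> c) (at 0) = vector_derivative (f \<circ> d) (at 0)" for c d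
      using u that by metis
    show "second_fundamental_form N f p v v \<in> orthogonal_comp ?T"
      by (rule second_fundamental_form_diag(1)[where \<V>=\<V> and D=D and c=c])
        (fact T normal D total inj c smooth[OF c(1)])+
    have "second_fundamental_form N f p v v \<bullet> \<nu> p = - (v \<bullet> D \<nu> (vector_derivative c (at 0)))"
      if "\<nu> \<in> \<V>"
      by (rule second_fundamental_form_diag(2)[where \<V>=\<V> and D=D and c=c])
        (fact that T normal D total inj c smooth[OF c(1)])+
    then show "second_fundamental_form N f p v v \<bullet> \<nu> p = - (v \<bullet> D \<nu> (u v))" if "\<nu> \<in> \<V>"
      using that u[OF c(1)] c(2) by simp
  qed
  have BT: "e \<in> ?T" if "e \<in> B" for e
    using B that unfolding orthonormal_basis_of_def by (metis span_base)
  have H: "mean_curvature N f p = (1 / real (dim ?T)) *\<^sub>R (\<Sum>e\<in>B. second_fundamental_form N f p e e)"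
    unfolding mean_curvature_def B_def ..
  show ?thesis
  proof (rule that[OF B])
    show "mean_curvature N f p \<in> orthogonal_comp ?T"
      unfolding H by (intro subspace_scale subspace_sum subspace_orthogonal_comp sff BT)
    show "real (dim ?T) * (mean_curvature N f p \<bullet> \<nu> p) = - (\<Sum>e\<in>B. e \<bullet> D \<nu> (u e))"
      if "\<nu> \<in> \<V>" for \<nu>
      using T(2) sff(2)[OF BT that] unfolding H by (simp add: inner_sum_left sum_negf)
  qed
qed

section \<open>Invariance under reparametrization\<close>

text \<open>All extrinsic notions in use are defined through curves, so it suffices that germs of
  curves correspond under \<open>\<Phi>\<close>. The lift in the second clause is required only near
  time 0, since nothing else about a curve matters.\<close>

definition curve_equivalence ::
    "'a::real_normed_vector set \<Rightarrow> 'c::real_normed_vector set \<Rightarrow> ('a \<Rightarrow> 'c) \<Rightarrow> bool" where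
  "curve_equivalence N N' \<Phi> \<longleftrightarrow> \<Phi> ` N = N' \<and>
     (\<forall>p\<in>N. (\<forall>c. curve_through N p c \<longrightarrow> curve_through N' (\<Phi> p) (\<Phi> \<circ> c)) \<and>
        (\<forall>d. curve_through N' (\<Phi> p) d \<longrightarrow>
           (\<exists>c. curve_through N p c \<and> (\<forall>\<^sub>F t in nhds 0. d t = \<Phi> (c t)))))"

lemma tangent_field_along_cong:
  assumes "\<forall>\<^sub>F t in nhds 0. tangent_space N f (c t) = tangent_space N' g (d t)"
    and "tangent_field_along N f c W"
  shows "tangent_field_along N' g d W"
proof -
  obtain a b where ab: "a > 0" "b > 0"
      "\<And>t. t \<in> {-a<..<a} \<Longrightarrow> tangent_space N f (c t) = tangent_space N' g (d t)"
      "smooth_on {-b<..<b} W" "\<And>t. t \<in> {-b<..<b} \<Longrightarrow> W t \<in> tangent_space N f (c t)"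
    using assms unfolding eventually_nhds_0_interval tangent_field_along_def by auto
  define e where "e = min a b"
  have e: "e > 0" "{-e<..<e} \<subseteq> {-a<..<a}" "{-e<..<e} \<subseteq> {-b<..<b}"
    using ab by (auto simp: e_def)
  then show ?thesis
    unfolding tangent_field_along_def
    using ab smooth_on_subset[OF ab(4) e(3)] by (intro exI[of _ e]) (metis subsetD)
qed

context
  fixes N :: "'a::real_normed_vector set" and N' :: "'c::real_normed_vector set"
    and \<Phi> and f :: "'a \<Rightarrow> 'b::euclidean_space" and g
  assumes equiv: "curve_equivalence N N' \<Phi>" and fg: "\<And>p. p \<in> N \<Longrightarrow> f p = g (\<Phi> p)"
begin

lemma velocity_reparam:
  assumes "curve_through N p c" "\<forall>\<^sub>F t in nhds 0. d t = \<Phi> (c t)"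
  shows "vector_derivative (f \<circ> c) (at 0) = vector_derivative (g \<circ> d) (at 0)"
  by (rule vector_derivative_eventually_cong,
      use curve_through_eventually[OF assms(1)] assms(2) in eventually_elim) (simp add: fg)

lemma tangent_space_reparam:
  assumes "p \<in> N"
  shows "tangent_space N f p = tangent_space N' g (\<Phi> p)"
proof (intro subset_antisym subsetI)
  fix v assume "v \<in> tangent_space N f p"
  then obtain c where c: "curve_through N p c" "v = vector_derivative (f \<circ> c) (at 0)"
    unfolding tangent_space_def by auto
  then have "v = vector_derivative (g \<circ> (\<Phi> \<circ> c)) (at 0)"
    using velocity_reparam[OF c(1), of "\<Phi> \<circ> c"] by simp
  then show "v \<in> tangent_space N' g (\<Phi> p)"
    using equiv c(1) assms unfolding tangent_space_def curve_equivalence_def by blast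
next
  fix v assume "v \<in> tangent_space N' g (\<Phi> p)"
  then obtain d where d: "curve_through N' (\<Phi> p) d" "v = vector_derivative (g \<circ> d) (at 0)"
    unfolding tangent_space_def by auto
  then obtain c where c: "curve_through N p c" "\<forall>\<^sub>F t in nhds 0. d t = \<Phi> (c t)"
    using equiv assms unfolding curve_equivalence_def by blast
  then show "v \<in> tangent_space N f p"
    using velocity_reparam[OF c] d(2) unfolding tangent_space_def by (auto intro!: exI[of _ c])
qed

lemma tangent_field_reparam:
  assumes "curve_through N p c" "\<forall>\<^sub>F t in nhds 0. d t = \<Phi> (c t)"
  shows "tangent_field_along N f c W \<longleftrightarrow> tangent_field_along N' g d W"
proof -
  have "\<forall>\<^sub>F t in nhds 0. tangent_space N f (c t) = tangent_space N' g (d t)"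
    using curve_through_eventually[OF assms(1)] assms(2)
    by eventually_elim (simp add: tangent_space_reparam)
  moreover from this have "\<forall>\<^sub>F t in nhds 0. tangent_space N' g (d t) = tangent_space N f (c t)"
    by eventually_elim simp
  ultimately show ?thesis
    using tangent_field_along_cong[of N f c N' g d W] tangent_field_along_cong[of N' g d N f c W]
    by blast
qed

text \<open>The predicates under the two definite descriptions coincide, so the equality holds
  without knowing that either description is well defined. The same happens below with the choice of
  the basis, since the tangent spaces are equal.\<close>

lemma second_fundamental_form_reparam:
  assumes "p \<in> N"
  shows "second_fundamental_form N f p v w = second_fundamental_form N' g (\<Phi> p) v w"
proof -
  have "(\<exists>c W. curve_through N p c \<and> vector_derivative (f \<circ> c) (at 0) = v \<and>
        tangent_field_along N f c W \<and> W 0 = w \<and>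
        h = normal_part (tangent_space N f p) (vector_derivative W (at 0))) \<longleftrightarrow>
      (\<exists>d W. curve_through N' (\<Phi> p) d \<and> vector_derivative (g \<circ> d) (at 0) = v \<and>
        tangent_field_along N' g d W \<and> W 0 = w \<and>
        h = normal_part (tangent_space N' g (\<Phi> p)) (vector_derivative W (at 0)))"
    (is "?L h \<longleftrightarrow> ?R h") for h
  proof
    assume "?L h"
    then obtain c W where c: "curve_through N p c" "vector_derivative (f \<circ> c) (at 0) = v"
        "tangent_field_along N f c W" "W 0 = w"
        "h = normal_part (tangent_space N f p) (vector_derivative W (at 0))" by blast
    have "curve_through N' (\<Phi> p) (\<Phi> \<circ> c)"
      using equiv assms c(1) unfolding curve_equivalence_def by blast
    then show "?R h"
      using c velocity_reparam[OF c(1), of "\<Phi> \<circ> c"] tangent_field_reparam[OF c(1), of "\<Phi> \<circ> c" W]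
        tangent_space_reparam[OF assms]
      by (intro exI[of _ "\<Phi> \<circ> c"] exI[of _ W]) (simp add: o_def)
  next
    assume "?R h"
    then obtain d W where d: "curve_through N' (\<Phi> p) d" "vector_derivative (g \<circ> d) (at 0) = v"
        "tangent_field_along N' g d W" "W 0 = w"
        "h = normal_part (tangent_space N' g (\<Phi> p)) (vector_derivative W (at 0))" by blast
    obtain c where c: "curve_through N p c" "\<forall>\<^sub>F t in nhds 0. d t = \<Phi> (c t)"
      using equiv assms d(1) unfolding curve_equivalence_def by blast
    show "?L h"
      using c d velocity_reparam[OF c] tangent_field_reparam[OF c, of W]
        tangent_space_reparam[OF assms]
      by (intro exI[of _ c] exI[of _ W]) (simp add: o_def)
  qed
  then show ?thesis unfolding second_fundamental_form_def by simp
qed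

lemma mean_curvature_reparam:
  "p \<in> N \<Longrightarrow> mean_curvature N f p = mean_curvature N' g (\<Phi> p)"
  unfolding mean_curvature_def
  by (simp add: tangent_space_reparam second_fundamental_form_reparam)

lemma self_similar_reparam: "self_similar N f lam \<longleftrightarrow> self_similar N' g lam"
proof -
  have "N' = \<Phi> ` N" using equiv by (simp add: curve_equivalence_def)
  then show ?thesis
    unfolding self_similar_def
    by (simp add: mean_curvature_reparam tangent_space_reparam fg)
qed

lemma self_translator_reparam: "self_translator N f V0 \<longleftrightarrow> self_translator N' g V0"
proof -
  have "N' = \<Phi> ` N" using equiv by (simp add: curve_equivalence_def)
  then show ?thesis
    unfolding self_translator_def
    by (simp add: mean_curvature_reparam tangent_space_reparam)
qed

end

section \<open>Complex vectors with real directions\<close>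

definition vec_Re :: "complex^'n \<Rightarrow> real^'n" where "vec_Re u = (\<chi> j. Re (u $ j))"
definition vec_Im :: "complex^'n \<Rightarrow> real^'n" where "vec_Im u = (\<chi> j. Im (u $ j))"

lemma linear_vec_Im: "linear vec_Im"
  by (auto intro!: linearI simp: vec_Im_def vec_eq_iff)

lemma bounded_linear_vec_Im: "bounded_linear vec_Im"
  by (simp add: linear_conv_bounded_linear[symmetric] linear_vec_Im)

lemma bounded_bilinear_cvec: "bounded_bilinear (\<lambda>z x. z *s cvec x)"
  unfolding bilinear_conv_bounded_bilinear[symmetric] bilinear_def
  by (auto intro!: linearI simp: cvec_def vec_eq_iff complex_eq_iff algebra_simps)

lemma bounded_bilinear_vector_scalar_mult: "bounded_bilinear (\<lambda>z (v :: complex^'n). z *s v)"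
  unfolding bilinear_conv_bounded_bilinear[symmetric] bilinear_def
  by (auto intro!: linearI simp: vec_eq_iff algebra_simps)

interpretation cvec: bounded_bilinear "\<lambda>z x. z *s cvec x :: complex^'n"
  by (rule bounded_bilinear_cvec)

lemma cvec_scaleR: "z *s cvec (a *\<^sub>R x) = (of_real a * z) *s cvec x"
  by (simp add: cvec_def vec_eq_iff)

lemma cvec_assoc: "z *s (w *s cvec x) = (z * w) *s cvec x"
  by (simp add: vec_eq_iff)

lemma cvec_decomp: "u = 1 *s cvec (vec_Re u) + \<i> *s cvec (vec_Im u)"
  by (simp add: vec_eq_iff cvec_def vec_Re_def vec_Im_def complex_eq)

lemma vec_cvec [simp]: "vec_Re (z *s cvec x) = Re z *\<^sub>R x" "vec_Im (z *s cvec x) = Im z *\<^sub>R x"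
  by (simp_all add: vec_eq_iff cvec_def vec_Re_def vec_Im_def)

text \<open>In particular \<open>z *s cvec x\<close> and \<open>(\<i> * z) *s cvec y\<close> are
  always orthogonal, and so are vectors with orthogonal real directions whatever their coefficients.
  All normality computations rest on these two cases.\<close>

lemma inner_cvec: "(z *s cvec x) \<bullet> (w *s cvec y) = Re (cnj z * w) * (x \<bullet> y)"
  by (simp add: inner_vec_def cvec_def inner_complex_def sum_distrib_left sum.distrib algebra_simps)

lemma inner_cvec_right: "u \<bullet> (z *s cvec y) = vec_Re (cnj z *s u) \<bullet> y"
  by (simp add: inner_vec_def cvec_def vec_Re_def inner_complex_def algebra_simps)

lemma vector_scalar_mult_cancel:
  fixes v :: "complex^'n"
  assumes "z \<noteq> 0"
  shows "z *s (inverse z *s v) = v" "inverse z *s (z *s v) = v"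
  using assms by (simp_all add: vec_eq_iff)

lemma has_vector_derivative_cis:
  assumes "(f has_vector_derivative f') (at s)"
  shows "((\<lambda>s. cis (f s)) has_vector_derivative \<i> * of_real f' * cis (f s)) (at s)"
proof -
  have "(cis has_vector_derivative \<i> * cis (f s)) (at (f s))"
    unfolding has_vector_derivative_def
    by (rule has_derivative_eq_rhs[OF has_derivative_cis[OF has_derivative_ident]])
      (auto simp: scaleR_conv_of_real)
  from vector_diff_chain_at[OF assms this] show ?thesis
    by (simp add: o_def scaleR_conv_of_real mult_ac)
qed

section \<open>Translated multiples of the unit sphere\<close>

text \<open>The condition \<open>V' = \<gamma> w\<close> with \<open>w\<close> real is what the Lagrangian condition imposes on the
  motion of the centers.\<close>

locale sphere_family =
  fixes J :: "real set" and P :: "complex^'n \<Rightarrow> complex^'n" and \<gamma> :: "real \<Rightarrow> complex"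
    and V :: "real \<Rightarrow> complex^'n" and w :: "real \<Rightarrow> real^'n"
  assumes J: "open J"
    and smooth_\<gamma>: "smooth_on J \<gamma>" and smooth_V: "smooth_on J V"
    and \<gamma>_nz: "\<And>s. s \<in> J \<Longrightarrow> \<gamma> s \<noteq> 0"
    and linear_P: "linear P" and inner_P: "\<And>u v. P u \<bullet> P v = u \<bullet> v"
    and V': "\<And>s. s \<in> J \<Longrightarrow> (V has_vector_derivative \<gamma> s *s cvec (w s)) (at s)"
begin

definition G :: "real \<times> (real^'n) \<Rightarrow> complex^'n" where
  "G = (\<lambda>(s, y). P (\<gamma> s *s cvec y + V s))"

abbreviation "N \<equiv> J \<times> sphere (0 :: real^'n) 1"
abbreviation "\<gamma>' s \<equiv> vector_derivative \<gamma> (at s)"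
abbreviation "\<gamma>'' s \<equiv> vector_derivative \<gamma>' (at s)"
abbreviation "V'' s \<equiv> vector_derivative (\<lambda>s. vector_derivative V (at s)) (at s)"

definition dG :: "real \<Rightarrow> real^'n \<Rightarrow> real \<Rightarrow> real^'n \<Rightarrow> complex^'n" where
  "dG s y a u = P ((of_real a * \<gamma>' s) *s cvec y + \<gamma> s *s cvec (u + a *\<^sub>R w s))"

text \<open>The complex coefficient of the direction \<open>y\<close> in the
  \<open>s\<close>-derivative of the family; the map is an immersion precisely where it does not
  vanish.\<close>

definition \<zeta> where "\<zeta> s y = \<gamma>' s + \<gamma> s * of_real (w s \<bullet> y)"

text \<open>For \<open>\<gamma> = r e\<^sup>i\<^sup>\<phi>\<close> this is
  \<open>r\<^sup>2 \<phi>'\<close>, twice the areal velocity: it vanishes identically on an interval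
  exactly if the profile stays on a line through the origin.\<close>

definition \<mu> where "\<mu> s = Im (cnj (\<gamma> s) * \<gamma>' s)"

section \<open>The differential of the family\<close>

lemma bounded_linear_P: "bounded_linear P"
  using linear_P by (simp add: linear_conv_bounded_linear)

lemma P_simps: "P (u + v) = P u + P v" "P (u - v) = P u - P v" "P (r *\<^sub>R u) = r *\<^sub>R P u" "P 0 = 0"
  using linear_P by (simp_all add: linear_add linear_diff linear_cmul linear_0)

lemma P_eq_iff: "P u = P v \<longleftrightarrow> u = v"
proof
  assume "P u = P v"
  then have "(u - v) \<bullet> (u - v) = 0" using inner_P[of "u - v" "u - v"] by (simp add: P_simps)
  then show "u = v" by simp
qed simp

lemma surj_P: "surj P"
  using linear_P P_eq_iff by (intro linear_injective_imp_surjective) (auto simp: inj_on_def)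

text \<open>Splits \<open>w s\<close> into its parts along and across \<open>y\<close>. For a unit
  vector \<open>y\<close> and \<open>u\<close> orthogonal to it the two resulting summands are
  orthogonal, which decouples the radial and the spherical directions.\<close>

lemma dG_\<zeta>: "dG s y a u = P ((of_real a * \<zeta> s y) *s cvec y + \<gamma> s *s cvec (u + a *\<^sub>R (w s - (w s \<bullet> y) *\<^sub>R y)))"
  unfolding dG_def \<zeta>_def
  by (simp add: cvec.add_right cvec.diff_right cvec.add_left cvec_scaleR scaleR_diff_right algebra_simps)

lemma deriv_\<gamma>: "s \<in> J \<Longrightarrow> (\<gamma> has_vector_derivative \<gamma>' s) (at s)"
  by (rule smooth_on_derivative[OF smooth_\<gamma>])

lemma deriv_\<gamma>': "s \<in> J \<Longrightarrow> (\<gamma>' has_vector_derivative \<gamma>'' s) (at s)"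
  by (rule smooth_on_derivative[OF smooth_on_vector_derivative[OF smooth_\<gamma>]])

lemma deriv_V': "s \<in> J \<Longrightarrow> ((\<lambda>s. vector_derivative V (at s)) has_vector_derivative V'' s) (at s)"
  by (rule smooth_on_derivative[OF smooth_on_vector_derivative[OF smooth_V]])

lemma V'_eq: "s \<in> J \<Longrightarrow> vector_derivative V (at s) = \<gamma> s *s cvec (w s)"
  by (rule vector_derivative_at[OF V'])

lemma smooth_along_curve:
  assumes "curve_through N p c"
  shows "\<exists>e>0. smooth_on {-e<..<e} (G \<circ> c)"
proof -
  obtain e where e: "e > 0" "smooth_on {-e<..<e} c" "c ` {-e<..<e} \<subseteq> N"
    using assms unfolding curve_through_def by auto
  let ?E = "{-e<..<e}"
  have fst: "smooth_on ?E (\<lambda>t. fst (c t))" and snd: "smooth_on ?E (\<lambda>t. snd (c t))"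
    using smooth_on_linear[OF _ e(2) bounded_linear_fst] smooth_on_linear[OF _ e(2) bounded_linear_snd]
    by auto
  have sub: "(\<lambda>t. fst (c t)) ` ?E \<subseteq> J" using e(3) by auto
  have "smooth_on ?E (\<lambda>t. P (\<gamma> (fst (c t)) *s cvec (snd (c t)) + V (fst (c t))))"
    by (intro smooth_on_linear[OF _ _ bounded_linear_P] smooth_on_add open_greaterThanLessThan
        smooth_on_bilinear[OF _ _ _ bounded_bilinear_cvec] snd
        smooth_on_compose[OF _ fst smooth_\<gamma> sub] smooth_on_compose[OF _ fst smooth_V sub])
  then show ?thesis
    using e(1) by (auto simp: G_def o_def case_prod_beta)
qed

lemma velocity:
  assumes c: "curve_through N (s, y) c" and v: "vector_derivative c (at 0) = (a, u)"
  shows "vector_derivative (G \<circ> c) (at 0) = dG s y a u" and "u \<bullet> y = 0"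
proof -
  have c0: "c 0 = (s, y)" and sy: "s \<in> J" "y \<in> sphere 0 1"
    using curve_through_base[OF c] by auto
  note ds = curve_through_pair_derivatives(1)[OF c v]
  note d\<gamma> = curve_through_pair_derivatives(2)[OF c v deriv_\<gamma>[OF sy(1)]]
  note dV = curve_through_pair_derivatives(2)[OF c v V'[OF sy(1)]]
  have "((\<lambda>t. P (\<gamma> (fst (c t)) *s cvec (snd (c t)) + V (fst (c t)))) has_vector_derivative
      P ((\<gamma> s *s cvec u + (a *\<^sub>R \<gamma>' s) *s cvec y) + a *\<^sub>R (\<gamma> s *s cvec (w s)))) (at 0)"
    using bounded_bilinear.has_vector_derivative[OF bounded_bilinear_cvec d\<gamma> ds]
    by (intro bounded_linear.has_vector_derivative[OF bounded_linear_P] has_vector_derivative_add dV)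
      (simp add: c0)
  moreover have "(\<gamma> s *s cvec u + (a *\<^sub>R \<gamma>' s) *s cvec y) + a *\<^sub>R (\<gamma> s *s cvec (w s))
      = (of_real a * \<gamma>' s) *s cvec y + \<gamma> s *s cvec (u + a *\<^sub>R w s)"
    by (simp add: cvec.add_right cvec.scaleR_right scaleR_conv_of_real[of _ "\<gamma>' s"])
  ultimately have "(G \<circ> c has_vector_derivative dG s y a u) (at 0)"
    by (simp add: G_def o_def case_prod_beta dG_def)
  then show "vector_derivative (G \<circ> c) (at 0) = dG s y a u"
    by (rule vector_derivative_at)
  have "\<forall>\<^sub>F t in nhds 0. snd (c t) \<bullet> snd (c t) = 1"
    using curve_through_eventually[OF c]
    by eventually_elim (auto simp: norm_eq_1)
  then have "vector_derivative (\<lambda>t. snd (c t) \<bullet> snd (c t)) (at 0) = 0"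
    using vector_derivative_eventually_cong[of "\<lambda>t. snd (c t) \<bullet> snd (c t)" "\<lambda>_. 1" 0] by simp
  moreover have "((\<lambda>t. snd (c t) \<bullet> snd (c t)) has_vector_derivative y \<bullet> u + u \<bullet> y) (at 0)"
    using bounded_bilinear.has_vector_derivative[OF bounded_bilinear_inner ds ds] c0 by simp
  ultimately show "u \<bullet> y = 0"
    using vector_derivative_at by (fastforce simp: inner_commute)
qed

end

lemma curve_through_product_sphere:
  fixes y u :: "'a::euclidean_space" and a s :: real
  assumes "open J" "s \<in> J" "y \<in> sphere 0 1" "u \<bullet> y = 0"
  obtains c where "curve_through (J \<times> sphere 0 1) (s, y) c" "vector_derivative c (at 0) = (a, u)"
proof -
  \<comment> \<open>A great circle through \<open>y\<close> run with speed \<open>norm u\<close>.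
    For \<open>u = 0\<close> the quotient is \<open>0 / 0 = 0\<close> and the circle degenerates to
    the constant \<open>y\<close>.\<close>
  define c where "c t = (s + a * t, cos (norm u * t) *\<^sub>R y + (sin (norm u * t) / norm u) *\<^sub>R u)" for t
  have norm_y: "y \<bullet> y = 1" using assms(3) by (simp add: norm_eq_1)
  have "c t \<in> UNIV \<times> sphere 0 1" for t
  proof -
    let ?v = "cos (norm u * t) *\<^sub>R y + (sin (norm u * t) / norm u) *\<^sub>R u"
    have "?v \<bullet> ?v = (cos (norm u * t))\<^sup>2 + (sin (norm u * t) / norm u)\<^sup>2 * (u \<bullet> u)"
      using assms(4) norm_y by (simp add: inner_add_left inner_add_right inner_commute power2_eq_square)
    also have "\<dots> = 1"
      by (cases "u = 0") (simp_all add: power_divide flip: power2_norm_eq_inner)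
    finally show ?thesis by (simp add: c_def norm_eq_1)
  qed
  then have sphere: "snd (c t) \<in> sphere 0 1" for t
    by (metis mem_Times_iff)
  obtain e where e: "e > 0" "ball s e \<subseteq> J"
    using assms(1,2) open_contains_ball by blast
  \<comment> \<open>The summand 1 keeps the divisor positive for \<open>a = 0\<close>, and the first
    component still moves by less than \<open>e\<close>.\<close>
  define d where "d = e / (\<bar>a\<bar> + 1)"
  have d: "d > 0" using e by (simp add: d_def)
  have "fst (c t) \<in> J" if "t \<in> {-d<..<d}" for t
  proof -
    have "\<bar>a * t\<bar> \<le> (\<bar>a\<bar> + 1) * \<bar>t\<bar>" by (simp add: abs_mult algebra_simps)
    also have "\<dots> < (\<bar>a\<bar> + 1) * d" using that by (intro mult_strict_left_mono) auto
    also have "\<dots> = e" by (simp add: d_def)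
    finally show ?thesis using e(2) by (auto simp: c_def dist_real_def)
  qed
  then have "c ` {-d<..<d} \<subseteq> J \<times> sphere 0 1"
    using sphere by (auto simp: mem_Times_iff image_subset_iff)
  moreover have "smooth_on {-d<..<d} c"
  proof -
    have lin: "smooth_on {-d<..<d} (\<lambda>t. k * t)" for k :: real
      by (intro smooth_on_mult) auto
    show ?thesis
      unfolding c_def divide_inverse
      using smooth_on_sin_cos
      by (intro smooth_on_Pair smooth_on_add smooth_on_scaleR smooth_on_mult smooth_on_ident smooth_on_const
          smooth_on_compose[OF _ lin, of UNIV cos] smooth_on_compose[OF _ lin, of UNIV sin]) auto
  qed
  moreover have "c 0 = (s, y)" by (simp add: c_def)
  ultimately have "curve_through (J \<times> sphere 0 1) (s, y) c"
    using d unfolding curve_through_def by auto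
  moreover have "(c has_vector_derivative (a, u)) (at 0)"
  proof -
    have "((\<lambda>t. sin (norm u * t) / norm u) has_vector_derivative (if u = 0 then 0 else 1)) (at 0)"
      by (cases "u = 0") (auto intro!: derivative_eq_intros simp flip: has_real_derivative_iff_has_vector_derivative)
    moreover have "((\<lambda>t. cos (norm u * t)) has_vector_derivative 0) (at 0)"
      "((\<lambda>t. s + a * t) has_vector_derivative a) (at 0)"
      by (auto intro!: derivative_eq_intros simp flip: has_real_derivative_iff_has_vector_derivative)
    ultimately have "(c has_vector_derivative (a, (0 *\<^sub>R y) + (if u = 0 then 0 else 1) *\<^sub>R u)) (at 0)"
      unfolding c_def
      by (intro has_vector_derivative_Pair has_vector_derivative_add
          bounded_linear.has_vector_derivative[OF bounded_linear_scaleR_left])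
    then show ?thesis by (simp split: if_splits)
  qed
  then have "vector_derivative c (at 0) = (a, u)" by (rule vector_derivative_at)
  ultimately show ?thesis by (rule that)
qed

context sphere_family
begin

lemma tangent_space_G:
  assumes "s \<in> J" "y \<in> sphere 0 1"
  shows "tangent_space N G (s, y) = {dG s y a u | a u. u \<bullet> y = 0}"
proof (intro subset_antisym subsetI)
  fix v assume "v \<in> tangent_space N G (s, y)"
  then obtain c where c: "curve_through N (s, y) c" "v = vector_derivative (G \<circ> c) (at 0)"
    unfolding tangent_space_def by auto
  obtain a u where "vector_derivative c (at 0) = (a, u)" by fastforce
  then show "v \<in> {dG s y a u | a u. u \<bullet> y = 0}"
    using velocity[OF c(1)] c(2) by blast
next
  fix v assume "v \<in> {dG s y a u | a u. u \<bullet> y = 0}"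
  then obtain a u where au: "v = dG s y a u" "u \<bullet> y = 0" by blast
  obtain c where c: "curve_through N (s, y) c" "vector_derivative c (at 0) = (a, u)"
    using curve_through_product_sphere[OF J assms au(2)] .
  show "v \<in> tangent_space N G (s, y)"
    using velocity(1)[OF c] c(1) au(1) unfolding tangent_space_def by (auto intro!: exI[of _ c])
qed

lemma dG_linear:
  "dG s y a u + dG s y b v = dG s y (a + b) (u + v)" "r *\<^sub>R dG s y a u = dG s y (r * a) (r *\<^sub>R u)"
  unfolding dG_def P_simps(1,3)[symmetric] P_eq_iff
  by (simp_all add: vec_eq_iff cvec_def complex_eq_iff algebra_simps)

lemma subspace_tangent_space_G:
  assumes "s \<in> J" "y \<in> sphere 0 1"
  shows "subspace (tangent_space N G (s, y))"
  unfolding tangent_space_G[OF assms]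
proof (rule subspaceI)
  show "0 \<in> {dG s y a u |a u. u \<bullet> y = 0}"
    by (auto intro!: exI[of _ 0] simp: dG_def P_simps cvec.zero_right)
qed (auto simp: dG_linear inner_add_left, (metis dG_linear inner_add_left add_0 inner_scaleR_left mult_zero_right)+)

end

lemma has_derivative_fst_vector:
  assumes "(f has_vector_derivative d) (at s)"
  shows "((\<lambda>p. f (fst p)) has_derivative (\<lambda>h. fst h *\<^sub>R d)) (at (s, y))"
  using has_derivative_compose[OF has_derivative_fst[OF has_derivative_ident], of f "\<lambda>x. x *\<^sub>R d" "(s, y)" UNIV]
    assms by (simp add: has_vector_derivative_def)

locale immersed_sphere_family = sphere_family J P \<gamma> V w
  for J and P :: "complex^'n \<Rightarrow> complex^'n" and \<gamma> V w +
  assumes nondeg: "\<And>s y. s \<in> J \<Longrightarrow> y \<in> sphere 0 1 \<Longrightarrow>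
    vector_derivative \<gamma> (at s) + \<gamma> s * of_real (w s \<bullet> y) \<noteq> 0"
begin

text \<open>Multiplication by \<open>\<i>\<close> maps tangent vectors to normal ones; this turns the tangent frame
  into normal fields.\<close>

definition normal_q :: "real^'n \<Rightarrow> real \<times> (real^'n) \<Rightarrow> complex^'n" where
  "normal_q q = (\<lambda>p. P ((\<i> * \<gamma> (fst p)) *s cvec (q - (q \<bullet> snd p) *\<^sub>R snd p)))"

text \<open>This is \<open>\<i>\<close> times the \<open>s\<close>-derivative of \<open>G\<close>.
  It is written with the derivative of \<open>V\<close> instead of \<open>\<gamma> w\<close> because
  differentiability of \<open>w\<close> is not among the assumptions, while \<open>V\<close> is
  smooth.\<close>

definition normal_0 :: "real \<times> (real^'n) \<Rightarrow> complex^'n" where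
  "normal_0 = (\<lambda>p. P ((\<i> * \<gamma>' (fst p)) *s cvec (snd p) + \<i> *s vector_derivative V (at (fst p))))"

lemma unit: "y \<in> sphere 0 1 \<Longrightarrow> y \<bullet> y = 1"
  by (simp add: norm_eq_1)

text \<open>This pairing and the next read off the components of a tangent vector. They give
  injectivity of the differential, and later turn the summands of the trace into a form to which
  Parseval applies.\<close>

lemma inner_dG_\<zeta>:
  assumes "y \<in> sphere 0 1" "u \<bullet> y = 0"
  shows "dG s y a u \<bullet> P (\<zeta> s y *s cvec y) = a * (cmod (\<zeta> s y))\<^sup>2"
  unfolding dG_\<zeta> inner_P inner_add_left inner_cvec cmod_power2
  using assms(2) unit[OF assms(1)]
  by (simp add: inner_add_left inner_diff_left power2_eq_square algebra_simps)

lemma inner_dG_\<gamma>: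
  assumes "q \<bullet> y = 0"
  shows "dG s y a u \<bullet> P (\<gamma> s *s cvec q) = ((u + a *\<^sub>R w s) \<bullet> q) * (cmod (\<gamma> s))\<^sup>2"
  unfolding dG_def inner_P inner_add_left inner_cvec cmod_power2
  using assms by (simp add: inner_commute power2_eq_square)

lemma \<zeta>_nz: "s \<in> J \<Longrightarrow> y \<in> sphere 0 1 \<Longrightarrow> \<zeta> s y \<noteq> 0"
  unfolding \<zeta>_def by (rule nondeg)

lemma dG_inj:
  assumes "s \<in> J" "y \<in> sphere 0 1" "u \<bullet> y = 0" "v \<bullet> y = 0" "dG s y a u = dG s y b v"
  shows "a = b \<and> u = v"
proof -
  have "a * (cmod (\<zeta> s y))\<^sup>2 = b * (cmod (\<zeta> s y))\<^sup>2"
    using inner_dG_\<zeta>[OF assms(2,3)] inner_dG_\<zeta>[OF assms(2,4)] assms(5) by metis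
  then have ab: "a = b" using \<zeta>_nz[OF assms(1,2)] by simp
  have "(u + a *\<^sub>R w s) \<bullet> (u - v) = (v + a *\<^sub>R w s) \<bullet> (u - v)"
    using inner_dG_\<gamma>[of "u - v" y s a u] inner_dG_\<gamma>[of "u - v" y s a v] assms ab \<gamma>_nz[OF assms(1)]
    by (simp add: inner_diff_left)
  then have "(u - v) \<bullet> (u - v) = 0" by (simp add: inner_add_left inner_diff_left)
  then show ?thesis using ab by simp
qed

lemma \<zeta>_tangent:
  assumes "s \<in> J" "y \<in> sphere 0 1"
  shows "P (\<zeta> s y *s cvec y) \<in> tangent_space N G (s, y)"
proof -
  \<comment> \<open>The sphere component is chosen to cancel the part of \<open>w s\<close> across
    \<open>y\<close>, leaving the purely radial vector.\<close>
  have "dG s y 1 (- (w s - (w s \<bullet> y) *\<^sub>R y)) = P (\<zeta> s y *s cvec y)"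
    unfolding dG_\<zeta> by (simp add: cvec.zero_right)
  moreover have "- (w s - (w s \<bullet> y) *\<^sub>R y) \<bullet> y = 0"
    using unit[OF assms(2)] by (simp add: inner_diff_left)
  ultimately show ?thesis
    unfolding tangent_space_G[OF assms] by (metis (mono_tags, lifting) mem_Collect_eq)
qed

lemma normal_q_normal:
  assumes "s \<in> J" "y \<in> sphere 0 1"
  shows "normal_q q (s, y) \<in> orthogonal_comp (tangent_space N G (s, y))"
proof -
  have "dG s y a u \<bullet> normal_q q (s, y) = 0" if "u \<bullet> y = 0" for a u
    unfolding dG_def normal_q_def inner_P inner_add_left inner_cvec
    using that unit[OF assms(2)] by (simp add: inner_diff_right inner_commute)
  then show ?thesis
    unfolding tangent_space_G[OF assms] orthogonal_comp_def orthogonal_def by auto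
qed

lemma normal_0_eq:
  "s \<in> J \<Longrightarrow> normal_0 (s, y) = P ((\<i> * \<gamma>' s) *s cvec y + (\<i> * \<gamma> s) *s cvec (w s))"
  unfolding normal_0_def by (simp add: V'_eq cvec_assoc)

lemma normal_0_normal:
  assumes "s \<in> J" "y \<in> sphere 0 1"
  shows "normal_0 (s, y) \<in> orthogonal_comp (tangent_space N G (s, y))"
proof -
  have "dG s y a u \<bullet> normal_0 (s, y) = 0" if "u \<bullet> y = 0" for a u
    unfolding dG_def normal_0_eq[OF assms(1)] inner_P inner_add_left inner_add_right inner_cvec
    using that unit[OF assms(2)]
    by (simp add: inner_add_left inner_commute[of y u] inner_commute[of y "w s"] algebra_simps)
  then show ?thesis
    unfolding tangent_space_G[OF assms] orthogonal_comp_def orthogonal_def by auto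
qed

text \<open>Write \<open>h = P k\<close> with \<open>k = \<gamma> (a + \<i> b)\<close>,
  \<open>a\<close> and \<open>b\<close> real. Tangent vectors to the sphere annihilate the part of
  \<open>a\<close> across \<open>y\<close>, the fields \<open>normal_q\<close> that of
  \<open>b\<close>. So \<open>k\<close> is a complex multiple \<open>\<kappa>\<close> of
  \<open>y\<close>, and the radial tangent vector and \<open>normal_0\<close> give the real and
  imaginary part of \<open>cnj \<kappa> * \<zeta> = 0\<close>.\<close>

lemma normals_total:
  assumes sy: "s \<in> J" "y \<in> sphere 0 1"
    and h: "h \<in> orthogonal_comp (tangent_space N G (s, y))"
    and q: "\<And>q. q \<bullet> y = 0 \<Longrightarrow> h \<bullet> normal_q q (s, y) = 0" and 0: "h \<bullet> normal_0 (s, y) = 0"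
  shows "h = 0"
proof -
  have hT: "h \<bullet> dG s y a u = 0" if "u \<bullet> y = 0" for a u
  proof -
    have "dG s y a u \<in> tangent_space N G (s, y)" using that unfolding tangent_space_G[OF sy] by blast
    then show ?thesis using h by (simp add: orthogonal_comp_def orthogonal_def inner_commute[of h])
  qed
  obtain k where k: "h = P k" using surj_P by (metis surjD)
  define l where "l = inverse (\<gamma> s) *s k"
  define a b where "a = vec_Re l" and "b = vec_Im l"
  have "k = \<gamma> s *s l" unfolding l_def vector_scalar_mult_cancel(1)[OF \<gamma>_nz[OF sy(1)]] ..
  also have "\<dots> = \<gamma> s *s cvec a + (\<i> * \<gamma> s) *s cvec b"
    using arg_cong[OF cvec_decomp[of l], of "\<lambda>l. \<gamma> s *s l"]
    by (simp add: a_def b_def vector_add_ldistrib cvec_assoc mult.commute)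
  finally have k_eq: "k = \<gamma> s *s cvec a + (\<i> * \<gamma> s) *s cvec b" .
  have \<gamma>2: "Re (cnj (\<gamma> s) * \<gamma> s) \<noteq> 0"
    using \<gamma>_nz[OF sy(1)] by (simp add: complex_eq_iff sum_squares_eq_zero_iff)
  have a_perp: "a \<bullet> u = 0" if "u \<bullet> y = 0" for u
  proof -
    have "dG s y 0 u = P (\<gamma> s *s cvec u)" by (simp add: dG_def)
    then have "k \<bullet> (\<gamma> s *s cvec u) = 0" using hT[OF that, of 0] k by (simp add: inner_P)
    then have "Re (cnj (\<gamma> s) * \<gamma> s) * (a \<bullet> u) = 0"
      unfolding k_eq inner_add_left inner_cvec by (simp add: algebra_simps)
    then show ?thesis using \<gamma>2 mult_eq_0_iff by blast
  qed
  have b_perp: "b \<bullet> u = 0" if "u \<bullet> y = 0" for u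
  proof -
    have "normal_q u (s, y) = P ((\<i> * \<gamma> s) *s cvec u)" using that by (simp add: normal_q_def)
    then have "k \<bullet> ((\<i> * \<gamma> s) *s cvec u) = 0" using q[OF that] k by (simp add: inner_P)
    then have "Re (cnj (\<gamma> s) * \<gamma> s) * (b \<bullet> u) = 0"
      unfolding k_eq inner_add_left inner_cvec by (simp add: algebra_simps)
    then show ?thesis using \<gamma>2 mult_eq_0_iff by blast
  qed
  have radial: "c = (c \<bullet> y) *\<^sub>R y" if "\<And>u. u \<bullet> y = 0 \<Longrightarrow> c \<bullet> u = 0" for c
  proof -
    let ?u = "c - (c \<bullet> y) *\<^sub>R y"
    have "?u \<bullet> y = 0" using unit[OF sy(2)] by (simp add: inner_diff_left)
    then have "?u \<bullet> ?u = 0" using that[of ?u] inner_diff_left[of c "(c \<bullet> y) *\<^sub>R y" ?u]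
      by (simp add: inner_commute[of y ?u])
    then show ?thesis by simp
  qed
  define \<kappa> where "\<kappa> = \<gamma> s * Complex (a \<bullet> y) (b \<bullet> y)"
  have rad: "a = (a \<bullet> y) *\<^sub>R y" "b = (b \<bullet> y) *\<^sub>R y"
    using radial a_perp b_perp by blast+
  have "k = \<gamma> s *s cvec ((a \<bullet> y) *\<^sub>R y) + (\<i> * \<gamma> s) *s cvec ((b \<bullet> y) *\<^sub>R y)"
    by (subst rad(1)[symmetric], subst rad(2)[symmetric], rule k_eq)
  also have "\<dots> = (of_real (a \<bullet> y) * \<gamma> s + of_real (b \<bullet> y) * (\<i> * \<gamma> s)) *s cvec y"
    by (simp only: cvec_scaleR cvec.add_left)
  also have "of_real (a \<bullet> y) * \<gamma> s + of_real (b \<bullet> y) * (\<i> * \<gamma> s) = \<kappa>"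
    by (simp add: \<kappa>_def Complex_eq algebra_simps)
  finally have k\<kappa>: "k = \<kappa> *s cvec y" .
  have "h \<bullet> P (\<zeta> s y *s cvec y) = 0"
    using h \<zeta>_tangent[OF sy] unfolding orthogonal_comp_def orthogonal_def by (simp add: inner_commute[of h])
  then have 1: "Re (cnj \<kappa> * \<zeta> s y) = 0"
    unfolding k k\<kappa> inner_P inner_cvec unit[OF sy(2)] by simp
  have "Re (cnj \<kappa> * (\<i> * \<gamma>' s)) * (y \<bullet> y) + Re (cnj \<kappa> * (\<i> * \<gamma> s)) * (y \<bullet> w s) = 0"
    using 0 unfolding normal_0_eq[OF sy(1)] k k\<kappa> inner_P inner_add_right inner_cvec .
  then have 2: "Im (cnj \<kappa> * \<zeta> s y) = 0"
    unfolding unit[OF sy(2)] \<zeta>_def by (simp add: inner_commute[of y "w s"] algebra_simps)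
  have "cnj \<kappa> * \<zeta> s y = 0" using 1 2 by (simp add: complex_eq_iff)
  then have "\<kappa> = 0" using \<zeta>_nz[OF sy] by simp
  then show ?thesis using k k\<kappa> by (simp add: P_simps)
qed

definition normal_fields :: "(real \<times> (real^'n) \<Rightarrow> complex^'n) set" where
  "normal_fields = insert normal_0 (range normal_q)"

section \<open>Mean curvature of the family\<close>

lemma normal_q_deriv:
  assumes "s \<in> J"
  shows "(normal_q q has_derivative (\<lambda>h. P ((\<i> * \<gamma> s) *s cvec (- ((q \<bullet> y) *\<^sub>R snd h + (q \<bullet> snd h) *\<^sub>R y))
      + (fst h *\<^sub>R (\<i> * \<gamma>' s)) *s cvec (q - (q \<bullet> y) *\<^sub>R y)))) (at (s, y))"
proof -
  have "((\<lambda>s. \<i> * \<gamma> s) has_vector_derivative \<i> * \<gamma>' s) (at s)"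
    using deriv_\<gamma>[OF assms] by (rule has_vector_derivative_mult_right)
  note 1 = has_derivative_fst_vector[OF this]
  have 2: "((\<lambda>p. q - (q \<bullet> snd p) *\<^sub>R snd p) has_derivative
      (\<lambda>h. - ((q \<bullet> y) *\<^sub>R snd h + (q \<bullet> snd h) *\<^sub>R y))) (at (s, y))"
    by (auto intro!: derivative_eq_intros)
  show ?thesis
    unfolding normal_q_def
    using bounded_bilinear.FDERIV[OF bounded_bilinear_cvec 1 2]
    by (intro bounded_linear.has_derivative[OF bounded_linear_P]) simp
qed

lemma normal_0_deriv:
  assumes "s \<in> J"
  shows "(normal_0 has_derivative (\<lambda>h. P ((\<i> * \<gamma>' s) *s cvec (snd h)
      + (fst h *\<^sub>R (\<i> * \<gamma>'' s)) *s cvec y + fst h *\<^sub>R (\<i> *s V'' s)))) (at (s, y))"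
proof -
  have "((\<lambda>s. \<i> * \<gamma>' s) has_vector_derivative \<i> * \<gamma>'' s) (at s)"
    using deriv_\<gamma>'[OF assms] by (rule has_vector_derivative_mult_right)
  note 1 = has_derivative_fst_vector[OF this]
  have "bounded_linear (\<lambda>v :: complex^'n. \<i> *s v)"
    by (rule bounded_bilinear.bounded_linear_right[OF bounded_bilinear_vector_scalar_mult])
  note 2 = has_derivative_fst_vector[OF bounded_linear.has_vector_derivative[OF this deriv_V'[OF assms]]]
  show ?thesis
    unfolding normal_0_def
    using bounded_bilinear.FDERIV[OF bounded_bilinear_cvec 1 has_derivative_snd[OF has_derivative_ident]]
    by (intro bounded_linear.has_derivative[OF bounded_linear_P] has_derivative_add 2) simp
qed

lemma mean_curvature_G:
  assumes sy: "s \<in> J" "y \<in> sphere 0 1"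
    and dim: "dim (tangent_space N G (s, y)) = CARD('n)"
  obtains B u where "orthonormal_basis_of (tangent_space N G (s, y)) B"
    "\<And>e. e \<in> B \<Longrightarrow> e = dG s y (fst (u e)) (snd (u e)) \<and> snd (u e) \<bullet> y = 0"
    "mean_curvature N G (s, y) \<in> orthogonal_comp (tangent_space N G (s, y))"
    "\<And>\<nu> D. \<nu> \<in> normal_fields \<Longrightarrow> (\<nu> has_derivative D) (at (s, y)) \<Longrightarrow>
      real CARD('n) * (mean_curvature N G (s, y) \<bullet> \<nu> (s, y)) = - (\<Sum>e\<in>B. e \<bullet> D (u e))"
proof -
  \<comment> \<open>The inverse of the differential; by \<open>dG_inj\<close> the description has a
    single solution for every tangent vector.\<close>
  define u where "u v = (THE p. snd p \<bullet> y = 0 \<and> dG s y (fst p) (snd p) = v)" for v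
  have u: "u (dG s y a b) = (a, b)" if "b \<bullet> y = 0" for a b
    unfolding u_def
  proof (rule the_equality)
    show "p = (a, b)" if "snd p \<bullet> y = 0 \<and> dG s y (fst p) (snd p) = dG s y a b" for p
      using dG_inj[OF sy _ \<open>b \<bullet> y = 0\<close>, of "snd p" "fst p" a] that by (simp add: prod_eq_iff)
  qed (use that in simp)
  obtain B where B: "orthonormal_basis_of (tangent_space N G (s, y)) B"
    "mean_curvature N G (s, y) \<in> orthogonal_comp (tangent_space N G (s, y))"
    "\<And>\<nu>. \<nu> \<in> normal_fields \<Longrightarrow> real (dim (tangent_space N G (s, y))) * (mean_curvature N G (s, y) \<bullet> \<nu> (s, y))
       = - (\<Sum>e\<in>B. e \<bullet> frechet_derivative \<nu> (at (s, y)) (u e))"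
  proof (rule mean_curvature_inner[of N G "(s, y)" normal_fields "\<lambda>\<nu>. frechet_derivative \<nu> (at (s, y))" u])
    show "subspace (tangent_space N G (s, y))" by (rule subspace_tangent_space_G[OF sy])
    show "dim (tangent_space N G (s, y)) \<noteq> 0" unfolding dim by simp
    show "\<nu> p \<in> orthogonal_comp (tangent_space N G p)" if "\<nu> \<in> normal_fields" "p \<in> N" for \<nu> p
      using that normal_0_normal normal_q_normal by (auto simp: normal_fields_def)
    show "h = 0" if "h \<in> orthogonal_comp (tangent_space N G (s, y))"
      "\<And>\<nu>. \<nu> \<in> normal_fields \<Longrightarrow> h \<bullet> \<nu> (s, y) = 0" for h
      using normals_total[OF sy that(1)] that(2) by (auto simp: normal_fields_def)
    show "(\<nu> has_derivative frechet_derivative \<nu> (at (s, y))) (at (s, y))" if "\<nu> \<in> normal_fields" for \<nu>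
      using that normal_0_deriv[OF sy(1), of y] normal_q_deriv[OF sy(1), of _ y]
      unfolding frechet_derivative_works[symmetric] differentiable_def normal_fields_def by auto
    show "\<exists>e>0. smooth_on {-e<..<e} (G \<circ> c)" if "curve_through N (s, y) c" for c
      using that by (rule smooth_along_curve)
    show "vector_derivative c (at 0) = u (vector_derivative (G \<circ> c) (at 0))"
      if "curve_through N (s, y) c" for c
      using velocity[OF that, of "fst (vector_derivative c (at 0))" "snd (vector_derivative c (at 0))"] u
      by simp
  qed (rule that)
  show ?thesis
  proof (rule that[OF B(1) _ B(2)])
    show "e = dG s y (fst (u e)) (snd (u e)) \<and> snd (u e) \<bullet> y = 0" if "e \<in> B" for e
    proof -
      have "e \<in> tangent_space N G (s, y)"
        using B(1) that unfolding orthonormal_basis_of_def by (metis span_base)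
      then show ?thesis unfolding tangent_space_G[OF sy] using u by auto
    qed
    show "real CARD('n) * (mean_curvature N G (s, y) \<bullet> \<nu> (s, y)) = - (\<Sum>e\<in>B. e \<bullet> D (u e))"
      if "\<nu> \<in> normal_fields" "(\<nu> has_derivative D) (at (s, y))" for \<nu> D
      using B(3)[OF that(1)] frechet_derivative_at[OF that(2)] by (simp add: dim)
  qed
qed

lemma mean_curvature_normal:
  assumes "s \<in> J" "y \<in> sphere 0 1" "dim (tangent_space N G (s, y)) = CARD('n)"
  shows "mean_curvature N G (s, y) \<in> orthogonal_comp (tangent_space N G (s, y))"
  using mean_curvature_G[OF assms] by metis

text \<open>The trace consists of a mixed term in the tangent vectors \<open>f\<close> and
  \<open>g\<close> and a square in \<open>f\<close>. Since \<open>f\<close> and \<open>g\<close> are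
  orthogonal, Parseval removes the mixed term and only the square survives.\<close>

lemma mean_curvature_normal_q:
  assumes sy: "s \<in> J" "y \<in> sphere 0 1"
    and dim: "dim (tangent_space N G (s, y)) = CARD('n)" and q: "q \<bullet> y = 0"
  shows "real CARD('n) * (mean_curvature N G (s, y) \<bullet> normal_q q (s, y))
    = - \<mu> s * (w s \<bullet> q) / (cmod (\<zeta> s y))\<^sup>2"
proof -
  obtain B u where B: "orthonormal_basis_of (tangent_space N G (s, y)) B"
    "\<And>e. e \<in> B \<Longrightarrow> e = dG s y (fst (u e)) (snd (u e)) \<and> snd (u e) \<bullet> y = 0"
    "\<And>\<nu> D. \<nu> \<in> normal_fields \<Longrightarrow> (\<nu> has_derivative D) (at (s, y)) \<Longrightarrow>
      real CARD('n) * (mean_curvature N G (s, y) \<bullet> \<nu> (s, y)) = - (\<Sum>e\<in>B. e \<bullet> D (u e))"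
    by (rule mean_curvature_G[OF sy dim]) (rule that)
  define f g where "f = P (\<zeta> s y *s cvec y)" and "g = P (\<gamma> s *s cvec q)"
  define Z c where "Z = (cmod (\<zeta> s y))\<^sup>2" and "c = (cmod (\<gamma> s))\<^sup>2"
  have Zc: "Z \<noteq> 0" "c \<noteq> 0" using \<zeta>_nz[OF sy] \<gamma>_nz[OF sy(1)] by (simp_all add: Z_def c_def)
  \<comment> \<open>Obtained by substituting \<open>a = (e \<bullet> f) / Z\<close> and
    \<open>(b + a w) \<bullet> q = (e \<bullet> g) / c\<close> into the derivative of
    \<open>normal_q\<close>.\<close>
  have summand: "- (e \<bullet> P ((\<i> * \<gamma> s) *s cvec (- ((q \<bullet> y) *\<^sub>R snd (u e) + (q \<bullet> snd (u e)) *\<^sub>R y))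
      + (fst (u e) *\<^sub>R (\<i> * \<gamma>' s)) *s cvec (q - (q \<bullet> y) *\<^sub>R y)))
      = (2 * \<mu> s / (Z * c)) * ((e \<bullet> f) * (e \<bullet> g)) - (\<mu> s * (w s \<bullet> q) / Z\<^sup>2) * ((e \<bullet> f) * (e \<bullet> f))"
    if eB: "e \<in> B" for e
  proof -
    obtain a b where "u e = (a, b)" by fastforce
    then have ab: "u e = (a, b)" "e = dG s y a b" "b \<bullet> y = 0"
      using B(2)[OF eB] by simp_all
    have "- (e \<bullet> P ((\<i> * \<gamma> s) *s cvec (- ((q \<bullet> y) *\<^sub>R b + (q \<bullet> b) *\<^sub>R y))
        + (a *\<^sub>R (\<i> * \<gamma>' s)) *s cvec (q - (q \<bullet> y) *\<^sub>R y)))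
      = a * \<mu> s * (2 * ((b + a *\<^sub>R w s) \<bullet> q) - a * (w s \<bullet> q))"
      unfolding ab dG_def inner_P inner_add_left inner_add_right inner_cvec \<mu>_def
      using q ab(3) unit[OF sy(2)]
      by (simp add: inner_add_left inner_commute[of q b] inner_commute[of y q] inner_commute[of y b] inner_commute[of y "w s"] inner_commute[of q "w s"] algebra_simps)
    moreover have "e \<bullet> f = a * Z" "e \<bullet> g = ((b + a *\<^sub>R w s) \<bullet> q) * c"
      unfolding ab f_def g_def Z_def c_def using inner_dG_\<zeta>[OF sy(2) ab(3)] inner_dG_\<gamma>[OF q] by auto
    ultimately show ?thesis
      unfolding ab(1) fst_conv snd_conv using Zc by (simp add: field_simps power2_eq_square)
  qed
  have f: "f \<in> tangent_space N G (s, y)" unfolding f_def by (rule \<zeta>_tangent[OF sy])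
  have ff: "f \<bullet> f = Z"
    unfolding f_def inner_P inner_cvec unit[OF sy(2)] Z_def cmod_power2 by (simp add: power2_eq_square)
  have fg: "f \<bullet> g = 0"
    unfolding f_def g_def inner_P inner_cvec using q by (simp add: inner_commute)
  have "normal_q q \<in> normal_fields" by (simp add: normal_fields_def)
  from B(3)[OF this normal_q_deriv[OF sy(1)]]
  have "real CARD('n) * (mean_curvature N G (s, y) \<bullet> normal_q q (s, y)) =
      (\<Sum>e\<in>B. (2 * \<mu> s / (Z * c)) * ((e \<bullet> f) * (e \<bullet> g)) - (\<mu> s * (w s \<bullet> q) / Z\<^sup>2) * ((e \<bullet> f) * (e \<bullet> f)))"
    by (simp only: sum_negf[symmetric]) (rule sum.cong[OF refl summand])
  also have "\<dots> = (2 * \<mu> s / (Z * c)) * (f \<bullet> g) - (\<mu> s * (w s \<bullet> q) / Z\<^sup>2) * (f \<bullet> f)"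
    unfolding sum_subtractf sum_distrib_left[symmetric] orthonormal_basis_of_parseval[OF B(1) f] ..
  finally show ?thesis
    using Zc unfolding ff fg Z_def[symmetric] by (simp add: power2_eq_square)
qed

text \<open>The first term is the rate at which the direction of \<open>\<gamma>'\<close> turns. In
  the second, the constant part of the summands contributes \<open>n\<close> times, once for each
  basis vector, and the radial direction takes one copy back, leaving \<open>n - 1\<close>.\<close>

lemma mean_curvature_normal_0:
  assumes sy: "s \<in> J" "y \<in> sphere 0 1"
    and dim: "dim (tangent_space N G (s, y)) = CARD('n)" and w: "w s = 0" "V'' s = 0"
  shows "real CARD('n) * (mean_curvature N G (s, y) \<bullet> normal_0 (s, y))
    = Im (cnj (\<gamma>' s) * \<gamma>'' s) / (cmod (\<gamma>' s))\<^sup>2 + (real CARD('n) - 1) * \<mu> s / (cmod (\<gamma> s))\<^sup>2"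
proof -
  obtain B u where B: "orthonormal_basis_of (tangent_space N G (s, y)) B"
    "\<And>e. e \<in> B \<Longrightarrow> e = dG s y (fst (u e)) (snd (u e)) \<and> snd (u e) \<bullet> y = 0"
    "\<And>\<nu> D. \<nu> \<in> normal_fields \<Longrightarrow> (\<nu> has_derivative D) (at (s, y)) \<Longrightarrow>
      real CARD('n) * (mean_curvature N G (s, y) \<bullet> \<nu> (s, y)) = - (\<Sum>e\<in>B. e \<bullet> D (u e))"
    by (rule mean_curvature_G[OF sy dim]) (rule that)
  have \<zeta>: "\<zeta> s y = \<gamma>' s" by (simp add: \<zeta>_def w)
  define f where "f = P (\<gamma>' s *s cvec y)"
  define Z c \<kappa> where "Z = (cmod (\<gamma>' s))\<^sup>2" and "c = (cmod (\<gamma> s))\<^sup>2" and "\<kappa> = Im (cnj (\<gamma>' s) * \<gamma>'' s)"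
  have Zc: "Z \<noteq> 0" "c \<noteq> 0" using \<zeta>_nz[OF sy] \<gamma>_nz[OF sy(1)] by (simp_all add: Z_def c_def \<zeta>)
  have summand: "- (e \<bullet> P ((\<i> * \<gamma>' s) *s cvec (snd (u e))
      + (fst (u e) *\<^sub>R (\<i> * \<gamma>'' s)) *s cvec y + fst (u e) *\<^sub>R (\<i> *s V'' s)))
      = (\<kappa> / Z\<^sup>2 - \<mu> s / (Z * c)) * ((e \<bullet> f) * (e \<bullet> f)) + \<mu> s / c"
    if eB: "e \<in> B" for e
  proof -
    obtain a b where "u e = (a, b)" by fastforce
    then have ab: "u e = (a, b)" "e = dG s y a b" "b \<bullet> y = 0"
      using B(2)[OF eB] by simp_all
    have "- (e \<bullet> P ((\<i> * \<gamma>' s) *s cvec b + (a *\<^sub>R (\<i> * \<gamma>'' s)) *s cvec y + a *\<^sub>R (\<i> *s V'' s)))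
      = a\<^sup>2 * \<kappa> + (b \<bullet> b) * \<mu> s"
      unfolding ab dG_def inner_P inner_add_left inner_add_right inner_cvec \<mu>_def \<kappa>_def w
      using ab(3) unit[OF sy(2)]
      by (simp add: inner_commute[of y b] algebra_simps power2_eq_square)
    moreover have "e \<bullet> f = a * Z"
      unfolding ab f_def Z_def using inner_dG_\<zeta>[OF sy(2) ab(3), of s a] by (simp add: \<zeta>)
    \<comment> \<open>The unit length of \<open>e\<close> eliminates the spherical component, so
      that the summand becomes a square of \<open>e \<bullet> f\<close> plus a constant.\<close>
    moreover have "b \<bullet> b = (1 - a\<^sup>2 * Z) / c"
    proof -
      have "e \<bullet> e = 1" using B(1) eB by (simp add: orthonormal_basis_of_def flip: norm_eq_1)
      moreover have "e \<bullet> e = a\<^sup>2 * Z + (b \<bullet> b) * c"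
        unfolding ab dG_def inner_P inner_add_left inner_add_right inner_cvec Z_def c_def cmod_power2 w
        using ab(3) unit[OF sy(2)]
        by (simp add: inner_commute[of y b] algebra_simps power2_eq_square)
      ultimately show ?thesis using Zc by (simp add: field_simps)
    qed
    ultimately show ?thesis
      unfolding ab(1) fst_conv snd_conv using Zc by (simp add: field_simps power2_eq_square)
  qed
  have f: "f \<in> tangent_space N G (s, y)" unfolding f_def using \<zeta>_tangent[OF sy] by (simp add: \<zeta>)
  have ff: "f \<bullet> f = Z"
    unfolding f_def inner_P inner_cvec unit[OF sy(2)] Z_def cmod_power2 by (simp add: power2_eq_square)
  have "normal_0 \<in> normal_fields" by (simp add: normal_fields_def)
  from B(3)[OF this normal_0_deriv[OF sy(1)]]
  have "real CARD('n) * (mean_curvature N G (s, y) \<bullet> normal_0 (s, y)) =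
      (\<Sum>e\<in>B. (\<kappa> / Z\<^sup>2 - \<mu> s / (Z * c)) * ((e \<bullet> f) * (e \<bullet> f)) + \<mu> s / c)"
    by (simp only: sum_negf[symmetric]) (rule sum.cong[OF refl summand])
  also have "\<dots> = (\<kappa> / Z\<^sup>2 - \<mu> s / (Z * c)) * (f \<bullet> f) + real CARD('n) * (\<mu> s / c)"
    unfolding sum.distrib sum_distrib_left[symmetric] orthonormal_basis_of_parseval[OF B(1) f]
    using orthonormal_basis_of_finite(2)[OF B(1)] by (simp add: dim)
  also have "\<dots> = \<kappa> / Z + (real CARD('n) - 1) * \<mu> s / c"
    unfolding ff using Zc by (simp add: field_simps power2_eq_square)
  finally show ?thesis unfolding Z_def c_def \<kappa>_def .
qed

end

section \<open>Self-translating and self-similar families\<close>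

text \<open>Dimension enters through this count: two vectors in \<open>A\<close> leave a unit vector
  orthogonal to both as soon as the dimension is at least three.\<close>

lemma exists_orthogonal_unit:
  fixes A :: "(real^'n) set"
  assumes "finite A" "card A < CARD('n)"
  obtains y where "y \<in> sphere 0 1" "\<And>a. a \<in> A \<Longrightarrow> y \<bullet> a = 0"
proof -
  have "dim A < DIM(real^'n)" using dim_le_card'[OF assms(1)] assms(2) by simp
  from orthogonal_to_subspace_exists[OF this]
  obtain x where x: "x \<noteq> 0" "\<And>y. y \<in> span A \<Longrightarrow> orthogonal x y" by blast
  show ?thesis
    by (rule that[of "(1 / norm x) *\<^sub>R x"])
      (use x span_base[of _ A] in \<open>auto simp: orthogonal_def\<close>)
qed

text \<open>If \<open>w \<noteq> 0\<close>, the left-hand side divided by \<open>w \<bullet> q\<close> is constant, whereas the right-hand side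
  depends quadratically on \<open>w \<bullet> y\<close>; three values of \<open>w \<bullet> y\<close> suffice to see this.\<close>

lemma quadratic_rigidity:
  fixes w b :: "real^'n" and g g' :: complex
  assumes n: "CARD('n) \<ge> 3" and g: "g \<noteq> 0" and c: "c \<noteq> 0"
    and nz: "\<And>y. y \<in> sphere 0 1 \<Longrightarrow> g' + g * of_real (w \<bullet> y) \<noteq> 0"
    and eq: "\<And>y q. y \<in> sphere 0 1 \<Longrightarrow> q \<bullet> y = 0 \<Longrightarrow>
      m * (w \<bullet> q) = c * (b \<bullet> q) * (cmod (g' + g * of_real (w \<bullet> y)))\<^sup>2"
  shows "b = 0"
proof (rule ccontr)
  assume b: "b \<noteq> 0"
  \<comment> \<open>So \<open>b\<close> is a multiple of \<open>w\<close>: at a point of the sphere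
    orthogonal to \<open>q\<close> the left side of \<open>eq\<close> vanishes, and the factors
    other than \<open>b \<bullet> q\<close> are nonzero.\<close>
  have perp: "b \<bullet> q = 0" if "w \<bullet> q = 0" for q
  proof -
    obtain y where "y \<in> sphere 0 1" "\<And>a. a \<in> {q} \<Longrightarrow> y \<bullet> a = 0"
      using exists_orthogonal_unit[of "{q}"] n by auto
    then show ?thesis using eq[of y q] nz[of y] that c by (simp add: inner_commute)
  qed
  define w1 where "w1 = (1 / norm w) *\<^sub>R w"
  have w: "w \<noteq> 0" using perp[of b] b by auto
  then have w1: "w1 \<bullet> w1 = 1" "w \<bullet> w1 = norm w"
    by (auto simp: w1_def dot_square_norm power2_eq_square)
  obtain e where "e \<in> sphere 0 1" and e1: "\<And>a. a \<in> {w1} \<Longrightarrow> e \<bullet> a = 0"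
    using exists_orthogonal_unit[of "{w1}"] n by auto
  then have e: "e \<bullet> e = 1" "e \<bullet> w1 = 0" by (auto simp: norm_eq_1)
  have we: "w \<bullet> e = 0" using e(2) w by (simp add: w1_def inner_commute)
  then have be: "b \<bullet> e = 0" by (rule perp)
  have key: "m * norm w = c * (b \<bullet> w1) * (cmod (g' + g * of_real (norm w * x)))\<^sup>2"
    if "x\<^sup>2 + z\<^sup>2 = 1" "z > 0" for x z
  proof -
    \<comment> \<open>A point on the great circle through the directions of \<open>w\<close> and
      \<open>e\<close>, and the unit tangent \<open>q\<close> there. With \<open>z > 0\<close> the
      common factor \<open>z\<close> of both sides can be cancelled.\<close>
    define y q where "y = x *\<^sub>R w1 + z *\<^sub>R e" and "q = x *\<^sub>R e - z *\<^sub>R w1"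
    have "y \<bullet> y = 1" "q \<bullet> y = 0"
      using w1(1) e that(1) by (simp_all add: y_def q_def inner_add_left inner_add_right inner_diff_left
          inner_commute[of w1 e] power2_eq_square)
    moreover have "w \<bullet> q = - (z * norm w)" "b \<bullet> q = - (z * (b \<bullet> w1))" "w \<bullet> y = norm w * x"
      using w1(2) we be by (simp_all add: y_def q_def inner_diff_right inner_add_right)
    ultimately show ?thesis using eq[of y q] that(2) by (simp add: norm_eq_1 algebra_simps)
  qed
  define \<rho> where "\<rho> = Re (cnj g * g')"
  have expand: "(cmod (g' + g * of_real t))\<^sup>2 = (cmod g')\<^sup>2 + 2 * t * \<rho> + t\<^sup>2 * (cmod g)\<^sup>2" for t
    unfolding cmod_power2 \<rho>_def by (simp add: power2_eq_square algebra_simps)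
  define X Y where "X = c * (b \<bullet> w1) * (norm w * \<rho>)"
    and "Y = c * (b \<bullet> w1) * ((norm w)\<^sup>2 * (cmod g)\<^sup>2)"
  have quad: "m * norm w = c * (b \<bullet> w1) * (cmod g')\<^sup>2 + 2 * x * X + x\<^sup>2 * Y"
    if "x\<^sup>2 + z\<^sup>2 = 1" "z > 0" for x z
    using key[OF that] unfolding expand X_def Y_def
    by (simp add: power_mult_distrib distrib_left mult_ac)
  \<comment> \<open>The values at \<open>3/5\<close> and \<open>-3/5\<close>, rational points of the
    circle, cancel the linear term when added; comparison with \<open>x = 0\<close> leaves a nonzero
    multiple of \<open>Y\<close>.\<close>
  have "Y = 0"
    using quad[of 0 1] quad[of "3/5" "4/5"] quad[of "-3/5" "4/5"]
    by (simp add: power2_eq_square)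
  then have "b \<bullet> w1 = 0" using c g w by (simp add: Y_def)
  then have bw: "b \<bullet> w = 0" using w by (simp add: w1_def)
  then show False using perp[of b] b by (simp add: inner_commute)
qed

text \<open>The vanishing of \<open>vec_Im (cnj z *s u)\<close> is the division-free form of saying
  that \<open>u\<close> lies in \<open>z\<close> times the real space, since
  \<open>inverse (cnj z)\<close> is a positive multiple of \<open>z\<close>. In this form the
  condition can be differentiated.\<close>

lemma vec_Im_zero_imp:
  assumes "vec_Im (cnj z *s u) = 0" "z \<noteq> 0"
  obtains Q where "u = z *s cvec Q"
proof -
  have "cnj z *s u = 1 *s cvec (vec_Re (cnj z *s u))"
    using cvec_decomp[of "cnj z *s u"] assms(1) by (simp add: cvec.zero_right)
  then have "u = inverse (cnj z) *s (1 *s cvec (vec_Re (cnj z *s u)))"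
    using vector_scalar_mult_cancel(2)[of "cnj z" u] assms(2) by simp
  also have "\<dots> = z *s cvec ((1 / (cmod z)\<^sup>2) *\<^sub>R vec_Re (cnj z *s u))"
  proof -
    have "inverse (cnj z) = of_real (1 / (cmod z)\<^sup>2) * z"
      using assms(2) by (simp add: complex_norm_square[symmetric] field_simps)
    then show ?thesis by (simp add: cvec_scaleR cvec_assoc)
  qed
  finally show ?thesis by (rule that)
qed

lemma symp_inner: "symp u v = (\<i> *s u) \<bullet> v"
  by (simp add: symp_def inner_vec_def inner_complex_def)

context immersed_sphere_family
begin

section \<open>Consequences of the translator and self-similar equations\<close>

lemma \<gamma>'_nz:
  assumes "s \<in> J" "CARD('n) \<ge> 3"
  shows "\<gamma>' s \<noteq> 0"
proof -
  obtain y where "y \<in> sphere 0 1" "\<And>a. a \<in> {w s} \<Longrightarrow> y \<bullet> a = 0"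
    using exists_orthogonal_unit[of "{w s}"] assms(2) by auto
  then show ?thesis using nondeg[of s y] assms(1) by (simp add: inner_commute)
qed

lemma inner_normal_q:
  assumes "q \<bullet> y = 0"
  shows "P u \<bullet> normal_q q (s, y) = vec_Im (cnj (\<gamma> s) *s u) \<bullet> q"
proof -
  have "vec_Re (cnj (\<i> * \<gamma> s) *s u) = vec_Im (cnj (\<gamma> s) *s u)"
    by (simp add: vec_Re_def vec_Im_def vec_eq_iff)
  then show ?thesis using assms by (simp add: normal_q_def inner_P inner_cvec_right)
qed

text \<open>Differentiating the real-multiple condition leaves, besides the term in
  \<open>u'\<close>, the imaginary part of \<open>cnj \<gamma>' * \<gamma>\<close> times
  \<open>Q\<close>, that is \<open>- \<mu> Q\<close>. It is applied to a constant \<open>u\<close>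
  for translators and to the centers \<open>V\<close> for self-similar families.\<close>

lemma real_multiple_rigid:
  assumes J_int: "\<And>t. t \<in> J \<Longrightarrow> vec_Im (cnj (\<gamma> t) *s u t) = 0"
    and s: "s \<in> J" and u: "(u has_vector_derivative u') (at s)"
    and u': "vec_Im (cnj (\<gamma> s) *s u') = 0"
  shows "\<mu> s = 0 \<or> u s = 0"
proof -
  obtain Q where Q: "u s = \<gamma> s *s cvec Q"
    using vec_Im_zero_imp[OF J_int[OF s] \<gamma>_nz[OF s]] by blast
  have "((\<lambda>t. cnj (\<gamma> t)) has_vector_derivative cnj (\<gamma>' s)) (at s)"
    by (rule bounded_linear.has_vector_derivative[OF bounded_linear_cnj deriv_\<gamma>[OF s]])
  from bounded_linear.has_vector_derivative[OF bounded_linear_vec_Im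
      bounded_bilinear.has_vector_derivative[OF bounded_bilinear_vector_scalar_mult this u]]
  have d: "((\<lambda>t. vec_Im (cnj (\<gamma> t) *s u t)) has_vector_derivative
      vec_Im (cnj (\<gamma> s) *s u' + cnj (\<gamma>' s) *s u s)) (at s)" .
  have "((\<lambda>t. 0) has_vector_derivative vec_Im (cnj (\<gamma> s) *s u' + cnj (\<gamma>' s) *s u s)) (at s)"
    by (rule has_vector_derivative_transform_within_open[OF d J s J_int])
  then have "vec_Im (cnj (\<gamma> s) *s u' + cnj (\<gamma>' s) *s u s) = 0"
    using vector_derivative_unique_at has_vector_derivative_const by blast
  then have "vec_Im ((cnj (\<gamma>' s) * \<gamma> s) *s cvec Q) = 0"
    using u' by (simp add: linear_add[OF linear_vec_Im] Q cvec_assoc)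
  then have "\<mu> s = 0 \<or> Q = 0" by (auto simp: \<mu>_def algebra_simps)
  then show ?thesis using Q cvec.zero_right by metis
qed

lemma translator_flat:
  assumes n: "CARD('n) \<ge> 3" and dim: "\<And>p. p \<in> N \<Longrightarrow> dim (tangent_space N G p) = CARD('n)"
    and trans: "self_translator N G V0" and V0: "V0 \<noteq> 0" and s: "s \<in> J"
  shows "\<mu> s = 0"
proof -
  obtain u where u: "V0 = P u" using surj_P by (metis surjD)
  have "vec_Im (cnj (\<gamma> t) *s u) = 0" if t: "t \<in> J" for t
  \<comment> \<open>The factor \<open>- real CARD('n)\<close> collects the normalization of the mean
    curvature and the sign in \<open>mean_curvature_normal_q\<close>.\<close>
  proof (rule quadratic_rigidity[OF n \<gamma>_nz[OF t], of "- real CARD('n)" "\<gamma>' t" "w t" "\<mu> t"])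
    fix y q :: "real^'n" assume y: "y \<in> sphere 0 1" and q: "q \<bullet> y = 0"
    have "mean_curvature N G (t, y) = normal_part (tangent_space N G (t, y)) V0"
      using trans t y unfolding self_translator_def by auto
    then have "mean_curvature N G (t, y) \<bullet> normal_q q (t, y) = vec_Im (cnj (\<gamma> t) *s u) \<bullet> q"
      using normal_part_inner[OF subspace_tangent_space_G[OF t y] normal_q_normal[OF t y]]
        inner_normal_q[OF q] u by simp
    then have "real CARD('n) * (vec_Im (cnj (\<gamma> t) *s u) \<bullet> q) = - \<mu> t * (w t \<bullet> q) / (cmod (\<zeta> t y))\<^sup>2"
      using mean_curvature_normal_q[OF t y dim q] t y by simp
    then show "\<mu> t * (w t \<bullet> q) = - real CARD('n) * (vec_Im (cnj (\<gamma> t) *s u) \<bullet> q) *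
        (cmod (\<gamma>' t + \<gamma> t * of_real (w t \<bullet> y)))\<^sup>2"
      using \<zeta>_nz[OF t y] unfolding \<zeta>_def[symmetric] by (simp add: field_simps)
  qed (use nondeg t in auto)
  from real_multiple_rigid[OF this s has_vector_derivative_const]
  moreover have "vec_Im (cnj (\<gamma> s) *s (0 :: complex^'n)) = 0"
    by (simp add: vec_Im_def vec_eq_iff)
  ultimately show ?thesis using V0 u P_simps(4) by metis
qed

lemma self_similar_inner:
  assumes "self_similar N G lam" "s \<in> J" "y \<in> sphere 0 1"
    "\<nu> \<in> orthogonal_comp (tangent_space N G (s, y))"
  shows "mean_curvature N G (s, y) \<bullet> \<nu> = - lam * (P (\<gamma> s *s cvec y + V s) \<bullet> \<nu>)"
proof -
  have "mean_curvature N G (s, y) + lam *\<^sub>R normal_part (tangent_space N G (s, y)) (G (s, y)) = 0"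
    using assms(1-3) unfolding self_similar_def by auto
  then have "(mean_curvature N G (s, y) + lam *\<^sub>R normal_part (tangent_space N G (s, y)) (G (s, y))) \<bullet> \<nu> = 0"
    by simp
  then show ?thesis
    using normal_part_inner[OF subspace_tangent_space_G[OF assms(2,3)] assms(4)]
    by (simp add: inner_add_left G_def)
qed

text \<open>The spherical part \<open>\<gamma> y\<close> of the position is itself a real multiple
  of \<open>\<gamma>\<close> and pairs to zero with \<open>normal_q\<close>; so the right-hand side
  sees the center only and is linear in \<open>q\<close>, as the rigidity argument requires.\<close>

lemma self_similar_real_multiple:
  assumes n: "CARD('n) \<ge> 3" and dim: "\<And>p. p \<in> N \<Longrightarrow> dim (tangent_space N G p) = CARD('n)"
    and ss: "self_similar N G lam" and lam: "lam \<noteq> 0" and t: "t \<in> J"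
  shows "vec_Im (cnj (\<gamma> t) *s V t) = 0"
proof (rule quadratic_rigidity[OF n \<gamma>_nz[OF t], of "real CARD('n) * lam" "\<gamma>' t" "w t" "\<mu> t"])
  fix y q :: "real^'n" assume y: "y \<in> sphere 0 1" and q: "q \<bullet> y = 0"
  have "vec_Im (cnj (\<gamma> t) *s (\<gamma> t *s cvec y)) = 0" by (simp add: cvec_assoc mult.commute)
  then have "vec_Im (cnj (\<gamma> t) *s (\<gamma> t *s cvec y + V t)) = vec_Im (cnj (\<gamma> t) *s V t)"
    by (simp add: vector_add_ldistrib linear_add[OF linear_vec_Im])
  then have "mean_curvature N G (t, y) \<bullet> normal_q q (t, y) = - lam * (vec_Im (cnj (\<gamma> t) *s V t) \<bullet> q)"
    using self_similar_inner[OF ss t y normal_q_normal[OF t y]] inner_normal_q[OF q] by simp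
  then have "real CARD('n) * (- lam * (vec_Im (cnj (\<gamma> t) *s V t) \<bullet> q)) = - \<mu> t * (w t \<bullet> q) / (cmod (\<zeta> t y))\<^sup>2"
    using mean_curvature_normal_q[OF t y dim q] t y by simp
  then show "\<mu> t * (w t \<bullet> q) = real CARD('n) * lam * (vec_Im (cnj (\<gamma> t) *s V t) \<bullet> q) *
      (cmod (\<gamma>' t + \<gamma> t * of_real (w t \<bullet> y)))\<^sup>2"
    using \<zeta>_nz[OF t y] unfolding \<zeta>_def[symmetric] by (simp add: field_simps)
qed (use nondeg t lam in auto)

text \<open>Both \<open>V\<close> and its derivative \<open>\<gamma> w\<close> are real multiples of
  \<open>\<gamma>\<close>, which is the situation of \<open>real_multiple_rigid\<close>.\<close>

lemma V_zero:
  assumes n: "CARD('n) \<ge> 3" and dim: "\<And>p. p \<in> N \<Longrightarrow> dim (tangent_space N G p) = CARD('n)"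
    and ss: "self_similar N G lam" and lam: "lam \<noteq> 0" and s: "s \<in> J" and \<mu>: "\<mu> s \<noteq> 0"
  shows "V s = 0"
proof -
  have "vec_Im (cnj (\<gamma> s) *s (\<gamma> s *s cvec (w s))) = 0" by (simp add: cvec_assoc mult.commute)
  with real_multiple_rigid[OF self_similar_real_multiple[OF n dim ss lam] s V'[OF s]] \<mu>
  show ?thesis by blast
qed

lemma continuous_\<mu>: "continuous_on J \<mu>"
proof -
  have "continuous_on J \<gamma>" "continuous_on J \<gamma>'"
    using smooth_on_continuous smooth_\<gamma> smooth_on_vector_derivative[OF smooth_\<gamma>] by blast+
  then show ?thesis unfolding \<mu>_def[abs_def] by (intro continuous_intros)
qed

lemma center_vanishes:
  assumes S: "open S" "s \<in> S" "S \<subseteq> J" and V0: "\<And>t. t \<in> S \<Longrightarrow> V t = 0" and y: "y \<in> sphere 0 1"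
  shows "w s = 0" "V'' s = 0" "P (\<gamma> s *s cvec y + V s) \<bullet> normal_0 (s, y) = - \<mu> s"
proof -
  have s: "s \<in> J" using S by blast
  have V'0: "vector_derivative V (at t) = 0" if "t \<in> S" for t
    using vector_derivative_at[OF has_vector_derivative_transform_within_open
        [OF has_vector_derivative_const[of 0] S(1) that, of V]] V0 by auto
  show "V'' s = 0"
    using vector_derivative_at[OF has_vector_derivative_transform_within_open
        [OF has_vector_derivative_const[of 0] S(1,2), of "\<lambda>t. vector_derivative V (at t)"]] V'0 by auto
  show w: "w s = 0"
  proof -
    have "\<gamma> s *s cvec (w s) = 0" using V'0[OF S(2)] V'_eq[OF s] by simp
    then have "(\<gamma> s *s cvec (w s)) \<bullet> (\<gamma> s *s cvec (w s)) = 0" by simp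
    then show ?thesis unfolding inner_cvec using \<gamma>_nz[OF s] by (auto simp: complex_eq_iff sum_squares_eq_zero_iff)
  qed
  show "P (\<gamma> s *s cvec y + V s) \<bullet> normal_0 (s, y) = - \<mu> s"
    unfolding normal_0_eq[OF s] w V0[OF S(2)] inner_P
    using y by (simp add: inner_cvec cvec.zero_right \<mu>_def norm_eq_1)
qed

lemma profile_equation:
  assumes n: "CARD('n) \<ge> 3" and dim: "\<And>p. p \<in> N \<Longrightarrow> dim (tangent_space N G p) = CARD('n)"
    and ss: "self_similar N G lam" and lam: "lam \<noteq> 0" and s: "s \<in> J" and \<mu>: "\<mu> s \<noteq> 0"
  shows "Im (cnj (\<gamma>' s) * \<gamma>'' s) / (cmod (\<gamma>' s))\<^sup>2 + (real CARD('n) - 1) * \<mu> s / (cmod (\<gamma> s))\<^sup>2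
    = real CARD('n) * lam * \<mu> s"
proof -
  obtain y :: "real^'n" where y: "y \<in> sphere 0 1"
    using exists_orthogonal_unit[of "{}"] by auto
  \<comment> \<open>By continuity of \<open>\<mu>\<close> the centers vanish on a whole
    neighbourhood of \<open>s\<close>, so that \<open>w\<close> and the second derivative of
    \<open>V\<close> vanish at \<open>s\<close> as well.\<close>
  define S where "S = J \<inter> \<mu> -` (- {0})"
  have S: "open S" "s \<in> S" "S \<subseteq> J"
    using continuous_open_preimage[OF continuous_\<mu> J, of "- {0}"] s \<mu> by (auto simp: S_def)
  have V0: "V t = 0" if "t \<in> S" for t
    using V_zero[OF n dim ss lam] that by (auto simp: S_def)
  note zero = center_vanishes[OF S V0 y]
  from zero(3)
  have "mean_curvature N G (s, y) \<bullet> normal_0 (s, y) = lam * \<mu> s"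
    using self_similar_inner[OF ss s y normal_0_normal[OF s y]] by simp
  then show ?thesis
    using mean_curvature_normal_0[OF s y dim zero(1,2)] s y by simp
qed

text \<open>The function \<open>\<mu>\<^sup>2 |\<gamma>|\<^sup>2\<^sup>(\<^sup>n\<^sup>-\<^sup>1\<^sup>) exp (- n lam |\<gamma>|\<^sup>2) / |\<gamma>'|\<^sup>2\<close>, the square of
  \<open>r\<^sup>n sin \<alpha> exp (- n lam r\<^sup>2 / 2)\<close>, is a first integral of the profile equation. Since the latter is
  only known where \<open>\<mu> \<noteq> 0\<close>, the factor \<open>\<mu>\<close> of its derivative takes care of the other points.\<close>

lemma \<mu>_dichotomy:
  assumes J_int: "open_interval J" and n: "CARD('n) \<ge> 3"
    and dim: "\<And>p. p \<in> N \<Longrightarrow> dim (tangent_space N G p) = CARD('n)"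
    and ss: "self_similar N G lam" and lam: "lam \<noteq> 0"
  shows "(\<forall>s\<in>J. \<mu> s = 0) \<or> (\<forall>s\<in>J. \<mu> s \<noteq> 0)"
proof -
  define \<rho> \<sigma> where "\<rho> s = (Re (\<gamma> s))\<^sup>2 + (Im (\<gamma> s))\<^sup>2" and "\<sigma> s = (Re (\<gamma>' s))\<^sup>2 + (Im (\<gamma>' s))\<^sup>2" for s
  \<comment> \<open>The exponential has no zeros, so \<open>\<Psi>\<close> vanishes exactly where
    \<open>\<mu>\<close> does, and the logarithms turn the derivatives of the powers into simple
    quotients.\<close>
  define \<Psi> where "\<Psi> s = (\<mu> s)\<^sup>2 * exp ((real CARD('n) - 1) * ln (\<rho> s) - real CARD('n) * lam * \<rho> s - ln (\<sigma> s))" for s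
  have "(\<Psi> has_vector_derivative 0) (at s)" if s: "s \<in> J" for s
  proof -
    have pos: "\<rho> s > 0" "\<sigma> s > 0"
      using \<gamma>_nz[OF s] \<gamma>'_nz[OF s n]
      by (auto simp: \<rho>_def \<sigma>_def complex_eq_iff sum_power2_gt_zero_iff)
    have re: "((\<lambda>s. Re (\<gamma> s)) has_real_derivative Re (\<gamma>' s)) (at s)"
      and im: "((\<lambda>s. Im (\<gamma> s)) has_real_derivative Im (\<gamma>' s)) (at s)"
      and re': "((\<lambda>s. Re (\<gamma>' s)) has_real_derivative Re (\<gamma>'' s)) (at s)"
      and im': "((\<lambda>s. Im (\<gamma>' s)) has_real_derivative Im (\<gamma>'' s)) (at s)"
      unfolding has_real_derivative_iff_has_vector_derivative
      using deriv_\<gamma>[OF s] deriv_\<gamma>'[OF s]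
      by (auto intro: bounded_linear.has_vector_derivative[OF bounded_linear_Re]
          bounded_linear.has_vector_derivative[OF bounded_linear_Im])
    define \<mu>1 \<rho>1 \<sigma>1 \<kappa> where "\<mu>1 = Im (cnj (\<gamma> s) * \<gamma>'' s)" and "\<rho>1 = 2 * Re (cnj (\<gamma> s) * \<gamma>' s)"
      and "\<sigma>1 = 2 * Re (cnj (\<gamma>' s) * \<gamma>'' s)" and "\<kappa> = Im (cnj (\<gamma>' s) * \<gamma>'' s)"
    have \<mu>': "(\<mu> has_real_derivative \<mu>1) (at s)"
      using DERIV_diff[OF DERIV_mult[OF re im'] DERIV_mult[OF im re']]
      by (simp add: \<mu>_def[abs_def] \<mu>1_def algebra_simps)
    have \<rho>': "(\<rho> has_real_derivative \<rho>1) (at s)"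
      using DERIV_add[OF DERIV_mult[OF re re] DERIV_mult[OF im im]]
      by (simp add: \<rho>_def[abs_def] \<rho>1_def power2_eq_square algebra_simps)
    have \<sigma>': "(\<sigma> has_real_derivative \<sigma>1) (at s)"
      using DERIV_add[OF DERIV_mult[OF re' re'] DERIV_mult[OF im' im']]
      by (simp add: \<sigma>_def[abs_def] \<sigma>1_def power2_eq_square algebra_simps)
    define k where "k = real CARD('n) - 1"
    define h h1 where "h = (real CARD('n) - 1) * ln (\<rho> s) - real CARD('n) * lam * \<rho> s - ln (\<sigma> s)"
      and "h1 = (real CARD('n) - 1) * (\<rho>1 / \<rho> s) - real CARD('n) * lam * \<rho>1 - \<sigma>1 / \<sigma> s"
    have "(\<Psi> has_real_derivative exp h * \<mu> s * (2 * \<mu>1 + \<mu> s * h1)) (at s)"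
      unfolding \<Psi>_def[abs_def] h1_def h_def using pos
      by (auto intro!: derivative_eq_intros \<mu>' \<rho>' \<sigma>' simp: algebra_simps power2_eq_square)
    moreover have "\<mu> s * (2 * \<mu>1 + \<mu> s * h1) = 0"
    proof (cases "\<mu> s = 0")
      case False
      have ode: "\<kappa> / \<sigma> s + (real CARD('n) - 1) * \<mu> s / \<rho> s = real CARD('n) * lam * \<mu> s"
        using profile_equation[OF n dim ss lam s False]
        by (simp add: \<kappa>_def \<sigma>_def \<rho>_def cmod_power2)
      \<comment> \<open>Twice the imaginary part of the product of
        \<open>cnj \<gamma> * \<gamma>'\<close> and
        \<open>cnj \<gamma>' * \<gamma>''\<close>.\<close>
      have "2 * \<sigma> s * \<mu>1 = \<mu> s * \<sigma>1 + \<kappa> * \<rho>1"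
        by (simp add: \<sigma>_def \<mu>1_def \<mu>_def \<sigma>1_def \<kappa>_def \<rho>1_def power2_eq_square algebra_simps)
      then have "2 * \<mu>1 = \<mu> s * \<sigma>1 / \<sigma> s + \<kappa> * \<rho>1 / \<sigma> s"
        using pos by (simp add: field_simps)
      then have "2 * \<mu>1 + \<mu> s * h1 = \<rho>1 * (\<kappa> / \<sigma> s + (real CARD('n) - 1) * \<mu> s / \<rho> s - real CARD('n) * lam * \<mu> s)"
        unfolding h1_def k_def[symmetric] by (simp add: algebra_simps)
      then show ?thesis using ode by simp
    qed simp
    ultimately show ?thesis
      by (simp add: has_real_derivative_iff_has_vector_derivative mult.assoc)
  qed
  then have "\<Psi> s = \<Psi> t" if "s \<in> J" "t \<in> J" for s t
    using open_interval_constant[OF J_int, of \<Psi> s t] that by blast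
  moreover have "\<Psi> s = 0 \<longleftrightarrow> \<mu> s = 0" for s by (simp add: \<Psi>_def)
  ultimately show ?thesis by metis
qed

text \<open>Since \<open>\<mu>\<close> is \<open>r\<^sup>2 \<phi>'\<close>, the phase is a constant
  \<open>c\<close>, and \<open>V' = \<gamma> w\<close> moves the centers only along \<open>c\<close>
  times the real space. This gives a translate of one Lagrangian subspace; the stronger condition on
  \<open>V\<close>, available for self-similar families, removes the translation.\<close>

lemma flat_lagrangian:
  assumes J_int: "open_interval J" and flat: "\<And>s. s \<in> J \<Longrightarrow> \<mu> s = 0"
    and polar: "\<And>s. s \<in> J \<Longrightarrow> \<gamma> s = of_real (r s) * cis (\<phi> s)"
    and r: "smooth_on J r" and \<phi>: "smooth_on J \<phi>"
    and complex_P: "\<And>z u. P (z *s u) = z *s P u"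
  shows "\<exists>a L. lagrangian_subspace L \<and> G ` N \<subseteq> (\<lambda>v. a + v) ` L \<and>
    ((\<forall>s\<in>J. vec_Im (cnj (\<gamma> s) *s V s) = 0) \<longrightarrow> G ` N \<subseteq> L)"
proof -
  obtain s0 where s0: "s0 \<in> J" using J_int by (auto simp: open_interval_def)
  have r_nz: "r s \<noteq> 0" if "s \<in> J" for s using \<gamma>_nz[OF that] polar[OF that] by auto
  have "(\<phi> has_vector_derivative 0) (at s)" if s: "s \<in> J" for s
  proof -
    let ?r' = "vector_derivative r (at s)" and ?\<phi>' = "vector_derivative \<phi> (at s)"
    have "((\<lambda>s. of_real (r s) * cis (\<phi> s)) has_vector_derivative
        of_real (r s) * (\<i> * of_real ?\<phi>' * cis (\<phi> s)) + of_real ?r' * cis (\<phi> s)) (at s)"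
      by (intro has_vector_derivative_mult has_vector_derivative_cis
          bounded_linear.has_vector_derivative[OF bounded_linear_of_real] smooth_on_derivative[OF _ s] r \<phi>)
    then have "(\<gamma> has_vector_derivative
        of_real (r s) * (\<i> * of_real ?\<phi>' * cis (\<phi> s)) + of_real ?r' * cis (\<phi> s)) (at s)"
      by (rule has_vector_derivative_transform_within_open[OF _ J s]) (simp add: polar)
    then have "\<gamma>' s = of_real (r s) * (\<i> * of_real ?\<phi>' * cis (\<phi> s)) + of_real ?r' * cis (\<phi> s)"
      by (rule vector_derivative_at)
    then have "\<mu> s = r s * cos (\<phi> s) * (?r' * sin (\<phi> s) + r s * cos (\<phi> s) * ?\<phi>')
        - r s * sin (\<phi> s) * (?r' * cos (\<phi> s) - r s * sin (\<phi> s) * ?\<phi>')"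
      unfolding \<mu>_def polar[OF s] by (simp add: algebra_simps)
    also have "\<dots> = (r s)\<^sup>2 * ((cos (\<phi> s))\<^sup>2 + (sin (\<phi> s))\<^sup>2) * ?\<phi>'"
      by (simp only: power2_eq_square algebra_simps)
    finally have "\<mu> s = (r s)\<^sup>2 * ?\<phi>'" by simp
    then have "?\<phi>' = 0" using flat[OF s] r_nz[OF s] by simp
    then show ?thesis using smooth_on_derivative[OF \<phi> s] by simp
  qed
  then have const: "\<phi> s = \<phi> s0" if "s \<in> J" for s
    using open_interval_constant[OF J_int _ that s0] by blast
  define c where "c = cis (\<phi> s0)"
  have c: "cnj c * c = 1" "c \<noteq> 0" by (simp_all add: c_def cis_cnj cis_mult)
  have \<gamma>_c: "\<gamma> s = of_real (r s) * c" if "s \<in> J" for s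
    using polar[OF that] const[OF that] by (simp add: c_def)
  define e where "e x = P (c *s cvec x)" for x :: "real^'n"
  have lin: "linear e"
    unfolding e_def by (intro linearI) (simp_all add: cvec.add_right cvec.scaleR_right P_simps)
  have inner_e: "e x \<bullet> e y = x \<bullet> y" for x y
    using c(1) by (simp add: e_def inner_P inner_cvec)
  have "inj e"
  proof (rule injI)
    fix x y assume "e x = e y"
    then have "e (x - y) \<bullet> e (x - y) = 0" using lin by (simp add: linear_diff)
    then show "x = y" by (simp add: inner_e)
  qed
  have lagr: "lagrangian_subspace (range e)"
    unfolding lagrangian_subspace_def
  proof (intro conjI ballI)
    show "subspace (range e)" using lin by (simp add: linear_subspace_image)
    have "dim (range e) = dim (UNIV :: (real^'n) set)"
      using lin \<open>inj e\<close> by (intro dim_image_eq) (auto simp: inj_on_subset)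
    then show "dim (range e) = CARD('n)" by simp
    show "symp u v = 0" if uv: "u \<in> range e" "v \<in> range e" for u v
    proof -
      obtain x y where "u = e x" "v = e y" using uv by auto
      then have "symp u v = P ((\<i> * c) *s cvec x) \<bullet> P (c *s cvec y)"
        by (simp add: symp_inner e_def cvec_assoc flip: complex_P)
      then show ?thesis using c(1) by (simp add: inner_P inner_cvec)
    qed
  qed
  have ball: "P (\<gamma> s *s cvec y) = e (r s *\<^sub>R y)" if "s \<in> J" for s y
    by (simp add: e_def \<gamma>_c[OF that] cvec_scaleR)
  have dV: "vec_Im (cnj c *s (V s - V s0)) = 0" if s: "s \<in> J" for s
  proof -
    have "((\<lambda>t. vec_Im (cnj c *s V t)) has_vector_derivative 0) (at t)" if t: "t \<in> J" for t
    proof -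
      have real: "vec_Im (cnj c *s (\<gamma> t *s cvec (w t))) = 0"
        using c(1) by (simp add: cvec_assoc \<gamma>_c[OF t] mult.left_commute[of "cnj c"])
      moreover have "((\<lambda>t. vec_Im (cnj c *s V t)) has_vector_derivative
          vec_Im (cnj c *s (\<gamma> t *s cvec (w t)))) (at t)"
        by (intro bounded_linear.has_vector_derivative[OF bounded_linear_vec_Im]
            bounded_linear.has_vector_derivative[OF
              bounded_bilinear.bounded_linear_right[OF bounded_bilinear_vector_scalar_mult]] V'[OF t])
      ultimately show ?thesis by (simp only: real)
    qed
    from open_interval_constant[OF J_int this s s0]
    show ?thesis by (simp add: vec_eq_iff vec_Im_def right_diff_distrib)
  qed
  have "G p \<in> (\<lambda>v. P (V s0) + v) ` range e" if pN: "p \<in> N" for p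
  proof -
    obtain s y where p: "p = (s, y)" "s \<in> J" using pN by auto
    obtain Q where "V s - V s0 = c *s cvec Q" using vec_Im_zero_imp[OF dV[OF p(2)] c(2)] by blast
    then have "P (V s) = P (V s0) + e Q" by (simp add: e_def algebra_simps flip: P_simps(1))
    then have "G p = P (V s0) + e (r s *\<^sub>R y + Q)"
      using ball[OF p(2), of y] by (simp add: p G_def P_simps linear_add[OF lin])
    then show ?thesis by simp
  qed
  moreover have "G p \<in> range e" if pN: "p \<in> N" and real: "\<forall>s\<in>J. vec_Im (cnj (\<gamma> s) *s V s) = 0" for p
  proof -
    obtain s y where p: "p = (s, y)" "s \<in> J" using pN by auto
    obtain Q where Q: "V s = \<gamma> s *s cvec Q"
      using vec_Im_zero_imp[OF _ \<gamma>_nz[OF p(2)], of "V s"] real p(2) by blast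
    have "G p = e (r s *\<^sub>R y + r s *\<^sub>R Q)"
      using ball[OF p(2)] Q by (simp add: p G_def P_simps linear_add[OF lin])
    then show ?thesis by simp
  qed
  ultimately show ?thesis using lagr by blast
qed

end

section \<open>Normal form of a Lagrangian family of spheres\<close>

definition adjoint_matrix :: "complex^'n^'n \<Rightarrow> complex^'n^'n" where
  "adjoint_matrix A = (\<chi> i j. cnj (A $ j $ i))"

lemma unitary_matrix_adjoint: "unitary_matrix A \<longleftrightarrow> adjoint_matrix A ** A = mat 1"
  by (simp add: unitary_matrix_def adjoint_matrix_def)

lemma inner_cnj_mult: "z \<bullet> w = Re (cnj z * w)"
  by (simp add: inner_complex_def)

lemma adjoint_matrix_works: "(A *v u) \<bullet> v = u \<bullet> (adjoint_matrix A *v v)"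
proof -
  have "(A *v u) \<bullet> v = (\<Sum>i\<in>UNIV. \<Sum>j\<in>UNIV. Re (cnj (A $ i $ j * u $ j) * v $ i))"
  proof -
    have "(A *v u) \<bullet> v = (\<Sum>i\<in>UNIV. Re (cnj (\<Sum>j\<in>UNIV. A $ i $ j * u $ j) * v $ i))"
      unfolding matrix_vector_mult_def inner_vec_def by (simp only: inner_cnj_mult vec_lambda_beta)
    then show ?thesis by (simp only: cnj_sum sum_distrib_right Re_sum)
  qed
  also have "\<dots> = (\<Sum>j\<in>UNIV. \<Sum>i\<in>UNIV. Re (cnj (u $ j) * (cnj (A $ i $ j) * v $ i)))"
    by (subst sum.swap) (intro sum.cong refl arg_cong[of _ _ Re], simp)
  also have "\<dots> = u \<bullet> (adjoint_matrix A *v v)"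
    unfolding inner_vec_def matrix_vector_mult_def adjoint_matrix_def
    by (simp only: inner_cnj_mult vec_lambda_beta sum_distrib_left Re_sum)
  finally show ?thesis .
qed

lemma unitary_matrix_inner:
  assumes "unitary_matrix A"
  shows "(A *v u) \<bullet> (A *v v) = u \<bullet> v"
  using assms by (simp add: adjoint_matrix_works unitary_matrix_adjoint matrix_vector_mul_assoc)

lemma unitary_matrix_cancel:
  assumes "unitary_matrix A"
  shows "adjoint_matrix A *v (A *v v) = v" "A *v (adjoint_matrix A *v v) = v"
  using assms matrix_left_right_inverse[of "adjoint_matrix A" A]
  by (simp_all add: unitary_matrix_adjoint matrix_vector_mul_assoc)

lemma linear_cvec: "linear cvec"
  by (intro linearI) (simp_all add: cvec_def vec_eq_iff complex_eq_iff)

lemma bounded_bilinear_matrix_vector_mult_real: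
  "bounded_bilinear (\<lambda>(A :: real^'n^'m) v. A *v v)"
  unfolding bilinear_conv_bounded_bilinear[symmetric] bilinear_def
  by (auto intro!: linearI simp: vec_eq_iff matrix_vector_mult_def algebra_simps sum.distrib sum_distrib_left)

lemma bounded_bilinear_matrix_matrix_mult_complex:
  "bounded_bilinear (\<lambda>(A :: complex^'n^'m) (B :: complex^'l^'n). A ** B)"
  unfolding bilinear_conv_bounded_bilinear[symmetric] bilinear_def
  by (auto intro!: linearI simp: vec_eq_iff matrix_matrix_mult_def algebra_simps sum.distrib scaleR_sum_right)

lemma bounded_linear_adjoint_matrix: "bounded_linear adjoint_matrix"
  unfolding linear_conv_bounded_linear[symmetric]
  by (intro linearI) (simp_all add: adjoint_matrix_def vec_eq_iff)

lemma cvec_0 [simp]: "cvec 0 = 0"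
  by (simp add: cvec_def vec_eq_iff)

lemma bounded_bilinear_matrix_cvec: "bounded_bilinear (\<lambda>(A :: complex^'n^'n) x. A *v cvec x)"
  unfolding bilinear_conv_bounded_bilinear[symmetric] bilinear_def
  by (auto intro!: linearI simp: vec_eq_iff matrix_vector_mult_def cvec_def complex_eq_iff algebra_simps
      sum.distrib sum_distrib_left)

lemma matrix_vector_mult_scalar: "(A :: complex^'n^'m) *v (z *s v) = z *s (A *v v)"
  by (simp add: vec_eq_iff matrix_vector_mult_def sum_distrib_left algebra_simps)

lemma cvec_cnj_inner: "cvec x \<bullet> u = x \<bullet> vec_Re u" "(\<i> *s cvec x) \<bullet> u = x \<bullet> vec_Im u"
  by (simp_all add: inner_vec_def cvec_def vec_Re_def vec_Im_def inner_complex_def)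

lemma vec_eqI_inner: "(\<And>x. x \<bullet> u = x \<bullet> v) \<Longrightarrow> u = (v :: 'a::real_inner)"
  by (metis inner_commute vector_eq_ldot)

lemma vec_decomp: "u = cvec (vec_Re u) + \<i> *s cvec (vec_Im u)"
  using cvec_decomp[of u] by simp

text \<open>Inner product and symplectic form are, up to sign, the real and imaginary parts of the
  Hermitian product. The two hypotheses therefore say that \<open>adjoint_matrix U ** U\<close>
  fixes all real vectors, and complex linearity does the rest.\<close>

lemma unitary_matrixI:
  assumes "\<And>x y. (U *v cvec x) \<bullet> (U *v cvec y) = x \<bullet> y"
    and "\<And>x y. symp (U *v cvec x) (U *v cvec y) = 0"
  shows "unitary_matrix U"
proof -
  let ?H = "adjoint_matrix U ** U"
  have real: "?H *v cvec y = cvec y" for y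
  proof -
    have "x \<bullet> vec_Re (?H *v cvec y) = x \<bullet> y" for x
      using assms(1)[of x y] by (simp add: adjoint_matrix_works matrix_vector_mul_assoc cvec_cnj_inner)
    moreover have "x \<bullet> vec_Im (?H *v cvec y) = x \<bullet> 0" for x
      using assms(2)[of x y]
      by (simp add: symp_inner adjoint_matrix_works matrix_vector_mul_assoc cvec_cnj_inner
          flip: matrix_vector_mult_scalar)
    ultimately have "vec_Re (?H *v cvec y) = y" "vec_Im (?H *v cvec y) = 0"
      using vec_eqI_inner by blast+
    then show ?thesis using cvec_decomp[of "?H *v cvec y"] by (simp add: cvec.zero_right)
  qed
  have "?H *v u = mat 1 *v u" for u
    by (subst (1 2) vec_decomp[of u]) (simp add: matrix_vector_right_distrib matrix_vector_mult_scalar real)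
  then show ?thesis unfolding unitary_matrix_adjoint matrix_eq by blast
qed

text \<open>Each \<open>T x\<close> is orthogonal to the complement of \<open>x\<close>, so every
  vector is an eigenvector, and then all eigenvalues agree.\<close>

lemma linear_orthogonality_scalar:
  fixes T :: "real^'n \<Rightarrow> real^'n"
  assumes "linear T" "\<And>x v. x \<bullet> v = 0 \<Longrightarrow> T x \<bullet> v = 0" "e \<bullet> e = 1"
  shows "T x = (T e \<bullet> e) *\<^sub>R x"
proof -
  have self: "T u = (T u \<bullet> u) *\<^sub>R u" if "u \<bullet> u = 1" for u
  proof (rule vec_eqI_inner)
    fix v
    have "u \<bullet> (v - (v \<bullet> u) *\<^sub>R u) = 0" using that by (simp add: inner_diff_right inner_commute)
    from assms(2)[OF this] show "v \<bullet> T u = v \<bullet> ((T u \<bullet> u) *\<^sub>R u)"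
      by (simp add: inner_diff_right inner_commute)
  qed
  define y where "y = x - (x \<bullet> e) *\<^sub>R e"
  have ye: "y \<bullet> e = 0" using assms(3) by (simp add: y_def inner_diff_left)
  have "T y = (T e \<bullet> e) *\<^sub>R y"
  proof (cases "y = 0")
    case True
    then show ?thesis using assms(1) by (simp add: linear_0)
  next
    case False
    define f where "f = (1 / norm y) *\<^sub>R y"
    have f: "f \<bullet> f = 1" "f \<bullet> e = 0" "y = norm y *\<^sub>R f"
      using False ye by (simp_all add: f_def dot_square_norm power2_eq_square)
    \<comment> \<open>Testing \<open>T\<close> on this orthogonal pair equates the eigenvalues of
      \<open>e\<close> and \<open>f\<close>.\<close>
    have "(e + f) \<bullet> (e - f) = 0"
      using f assms(3) by (simp add: inner_add_left inner_diff_right inner_commute[of e f])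
    then have "T (e + f) \<bullet> (e - f) = 0" by (rule assms(2))
    moreover have "T f \<bullet> e = 0" "T e \<bullet> f = 0" using assms(2) f(2) by (simp_all add: inner_commute)
    ultimately have "T e \<bullet> e = T f \<bullet> f"
      using assms(1) by (simp add: linear_add inner_add_left inner_diff_right)
    then have "norm y *\<^sub>R T f = (T e \<bullet> e) *\<^sub>R (norm y *\<^sub>R f)" by (subst self[OF f(1)]) simp
    then show ?thesis
      using linear_cmul[OF assms(1), of "norm y" f] unfolding f(3)[symmetric] by simp
  qed
  moreover have x: "x = y + (x \<bullet> e) *\<^sub>R e" by (simp add: y_def)
  moreover have "T x = T y + (x \<bullet> e) *\<^sub>R T e"
    using arg_cong[OF x, of T] assms(1) by (simp add: linear_add linear_cmul)
  ultimately have "T x = (T e \<bullet> e) *\<^sub>R y + (x \<bullet> e) *\<^sub>R ((T e \<bullet> e) *\<^sub>R e)"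
    using self[OF assms(3)] by simp
  also have "\<dots> = (T e \<bullet> e) *\<^sub>R x" by (simp add: y_def scaleR_diff_right)
  finally show ?thesis .
qed

text \<open>A rotation of real 2n-space need not be complex linear, but it is applied to real
  vectors only, and there the half of its columns indexed by \<open>Inl\<close> acts as a complex
  matrix.\<close>

definition complex_columns :: "real^('n + 'n)^('n + 'n) \<Rightarrow> complex^'n::finite^'n" where
  "complex_columns M = (\<chi> i j. Complex (M $ Inl i $ Inl j) (M $ Inr i $ Inl j))"

lemma bounded_linear_complex_columns: "bounded_linear complex_columns"
  unfolding linear_conv_bounded_linear[symmetric]
  by (intro linearI) (simp_all add: complex_columns_def vec_eq_iff complex_eq_iff)

lemma sum_UNIV_Plus:
  "(\<Sum>k\<in>(UNIV :: ('n::finite + 'n) set). f k) = (\<Sum>i\<in>UNIV. f (Inl i)) + (\<Sum>i\<in>UNIV. f (Inr i))"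
  using sum.Plus[of "UNIV :: 'n set" "UNIV :: 'n set" f] by (simp add: UNIV_Plus_UNIV comp_def)

lemma complex_columns_mult: "to_cplx (M *v to_real (cvec x)) = complex_columns M *v cvec x"
  by (simp add: to_cplx_def to_real_def cvec_def complex_columns_def vec_eq_iff matrix_vector_mult_def
      sum_UNIV_Plus complex_eq_iff)

lemma complex_columns_inner:
  fixes M :: "real^('n::finite + 'n)^('n + 'n)"
  assumes "rotation_matrix M"
  shows "(complex_columns M *v cvec x) \<bullet> (complex_columns M *v cvec y) = x \<bullet> y"
proof -
  have to_cplx: "to_cplx u \<bullet> to_cplx v = u \<bullet> v" for u v :: "real^('n + 'n)"
    by (simp add: to_cplx_def inner_vec_def sum_UNIV_Plus inner_complex_def sum.distrib)
  have "transpose M ** M = mat 1"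
    using assms by (simp add: rotation_matrix_def orthogonal_matrix)
  then have M: "(M *v u) \<bullet> (M *v v) = u \<bullet> v" for u v
    using dot_lmul_matrix[of "M *v u" M v]
    by (simp add: transpose_matrix_vector[symmetric] matrix_vector_mul_assoc)
  have "to_real (cvec x) \<bullet> to_real (cvec y) = x \<bullet> y"
    by (simp add: to_real_def cvec_def inner_vec_def sum_UNIV_Plus)
  then show ?thesis by (simp add: complex_columns_mult[symmetric] to_cplx M)
qed

lemma inner_adjoint_imaginary: "(\<i> *s u) \<bullet> (A *v cvec v) = - (vec_Im (adjoint_matrix A *v u) \<bullet> v)"
proof -
  have "(\<i> *s u) \<bullet> (A *v cvec v) = (A *v cvec v) \<bullet> (\<i> *s u)" by (rule inner_commute)
  also have "\<dots> = cvec v \<bullet> (\<i> *s (adjoint_matrix A *v u))"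
    by (simp add: adjoint_matrix_works matrix_vector_mult_scalar)
  also have "\<dots> = - (vec_Im (adjoint_matrix A *v u) \<bullet> v)"
    unfolding cvec_cnj_inner(1) by (simp add: inner_vec_def vec_Re_def vec_Im_def sum_negf algebra_simps)
  finally show ?thesis .
qed

lemma matrix_family_velocity:
  fixes Z :: "real \<Rightarrow> complex^'n^'n"
  assumes F: "\<And>s x. s \<in> I \<Longrightarrow> x \<in> sphere 0 1 \<Longrightarrow> F (s, x) = Z s *v cvec x + V s"
    and Z: "(Z has_vector_derivative Z') (at s)" and V: "(V has_vector_derivative V') (at s)"
    and c: "curve_through (I \<times> sphere 0 1) (s, x) c" "vector_derivative c (at 0) = (a, u)"
  shows "vector_derivative (F \<circ> c) (at 0) = a *\<^sub>R (Z' *v cvec x + V') + Z s *v cvec u"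
proof -
  have c0: "c 0 = (s, x)" using curve_through_base[OF c(1)] by simp
  note ds = curve_through_pair_derivatives(1)[OF c]
  note dZ = curve_through_pair_derivatives(2)[OF c Z] and dV = curve_through_pair_derivatives(2)[OF c V]
  have "((\<lambda>t. Z (fst (c t)) *v cvec (snd (c t)) + V (fst (c t))) has_vector_derivative
      (Z (fst (c 0)) *v cvec u + (a *\<^sub>R Z') *v cvec (snd (c 0))) + a *\<^sub>R V') (at 0)"
    by (intro has_vector_derivative_add dV
        bounded_bilinear.has_vector_derivative[OF bounded_bilinear_matrix_cvec dZ ds])
  then have deriv: "vector_derivative (\<lambda>t. Z (fst (c t)) *v cvec (snd (c t)) + V (fst (c t))) (at 0)
      = (Z s *v cvec u + (a *\<^sub>R Z') *v cvec x) + a *\<^sub>R V'"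
    by (simp add: c0 vector_derivative_at)
  have "\<forall>\<^sub>F t in nhds 0. (F \<circ> c) t = Z (fst (c t)) *v cvec (snd (c t)) + V (fst (c t))"
    using curve_through_eventually[OF c(1)]
  proof eventually_elim
    case (elim t)
    then show ?case using F[of "fst (c t)" "snd (c t)"] by (auto simp: mem_Times_iff)
  qed
  from vector_derivative_eventually_cong[OF this] show ?thesis
    using deriv bounded_bilinear.scaleR_left[OF bounded_bilinear_matrix_cvec, of a Z' x]
    by (simp add: scaleR_add_right o_def)
qed

text \<open>For \<open>n \<ge> 3\<close> any two real directions are tangent to a common point
  of the sphere, which forces \<open>U s\<close> to be unitary. Comparing antipodal points \<open>x\<close> and \<open>-x\<close>
  separates the motion of the center from that of the sphere.\<close>

lemma lagrangian_family_infinitesimal: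
  fixes F :: "real \<times> (real^'n) \<Rightarrow> complex^'n" and U :: "real \<Rightarrow> complex^'n^'n"
  assumes n: "CARD('n) \<ge> 3" and I: "open I"
    and F: "\<And>s x. s \<in> I \<Longrightarrow> x \<in> sphere 0 1 \<Longrightarrow> F (s, x) = (r s *\<^sub>R U s) *v cvec x + V s"
    and lagr: "lagrangian_on (I \<times> sphere 0 1) F"
    and r: "smooth_on I r" and U: "smooth_on I U" and V: "smooth_on I V"
    and r_pos: "r s > 0"
    and iso: "\<And>x y. (U s *v cvec x) \<bullet> (U s *v cvec y) = x \<bullet> y"
    and s: "s \<in> I"
  shows "unitary_matrix (U s)"
    and "vec_Im (adjoint_matrix (U s) *v vector_derivative V (at s)) = 0"
    and "x \<bullet> v = 0 \<Longrightarrow> vec_Im (adjoint_matrix (U s) *v (vector_derivative U (at s) *v cvec x)) \<bullet> v = 0"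
proof -
  let ?N = "I \<times> sphere (0 :: real^'n) 1"
  let ?r' = "vector_derivative r (at s)" and ?U' = "vector_derivative U (at s)"
    and ?V' = "vector_derivative V (at s)"
  have Z: "((\<lambda>s. r s *\<^sub>R U s) has_vector_derivative r s *\<^sub>R ?U' + ?r' *\<^sub>R U s) (at s)"
    by (rule bounded_bilinear.has_vector_derivative[OF bounded_bilinear_scaleR
          smooth_on_derivative[OF r s] smooth_on_derivative[OF U s]])
  have tangent: "a *\<^sub>R ((r s *\<^sub>R ?U' + ?r' *\<^sub>R U s) *v cvec x + ?V') + (r s *\<^sub>R U s) *v cvec u
      \<in> tangent_space ?N F (s, x)" if x: "x \<in> sphere 0 1" and u: "u \<bullet> x = 0" for a x u
  proof -
    obtain c where c: "curve_through ?N (s, x) c" "vector_derivative c (at 0) = (a, u)"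
      using curve_through_product_sphere[OF I s x u] .
    show ?thesis
      using matrix_family_velocity[OF F Z smooth_on_derivative[OF V s] c] c(1)
      unfolding tangent_space_def by (auto intro!: exI[of _ c])
  qed
  have symp0: "symp t1 t2 = 0" if "x \<in> sphere 0 1" "t1 \<in> tangent_space ?N F (s, x)" "t2 \<in> tangent_space ?N F (s, x)"
    for t1 t2 x
    using lagr s that unfolding lagrangian_on_def lagrangian_subspace_def by (metis mem_Times_iff fst_conv snd_conv)
  have scale: "(k *\<^sub>R A) *v cvec x = k *\<^sub>R (A *v cvec x)" for k and A :: "complex^'n^'n" and x
    by (rule bounded_bilinear.scaleR_left[OF bounded_bilinear_matrix_cvec])
  have UU: "symp (U s *v cvec v) (U s *v cvec v') = 0" for v v'
  proof -
    have "card {v, v'} < CARD('n)" using n card_insert_le_m1[of 2 "{v'}" v] by simp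
    then obtain x where x: "x \<in> sphere 0 1" "\<And>a. a \<in> {v, v'} \<Longrightarrow> x \<bullet> a = 0"
      using exists_orthogonal_unit[of "{v, v'}"] by auto
    have "symp (r s *\<^sub>R (U s *v cvec v)) (r s *\<^sub>R (U s *v cvec v')) = 0"
      using symp0[OF x(1) tangent[OF x(1), of v 0] tangent[OF x(1), of v' 0]] x(2)
      by (simp add: inner_commute scale)
    moreover have "symp (r s *\<^sub>R a) (r s *\<^sub>R b) = (r s)\<^sup>2 * symp a b" for a b :: "complex^'n"
      by (simp add: symp_def sum_distrib_left power2_eq_square algebra_simps)
    ultimately show ?thesis using r_pos by simp
  qed
  show unitary: "unitary_matrix (U s)"
    by (rule unitary_matrixI[OF iso UU])
  have key: "symp ?V' (U s *v cvec v) = 0 \<and> symp (?U' *v cvec x) (U s *v cvec v) = 0"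
    if x: "x \<in> sphere 0 1" and v: "v \<bullet> x = 0" for x v
  proof -
    \<comment> \<open>The term with \<open>?r'\<close> drops out by \<open>UU\<close>. Of the two
      that remain, the first is odd in \<open>y\<close> and the second does not depend on
      it.\<close>
    have *: "r s * symp (?U' *v cvec y) (U s *v cvec v) + symp ?V' (U s *v cvec v) = 0"
      if y: "y \<in> sphere 0 1" "v \<bullet> y = 0" for y
    proof -
      have "symp ((r s *\<^sub>R ?U' + ?r' *\<^sub>R U s) *v cvec y + ?V') (r s *\<^sub>R (U s *v cvec v)) = 0"
        using symp0[OF y(1) tangent[OF y(1), of 0 1] tangent[OF y, of 0]]
        by (simp add: scale)
      then have "(\<i> *s (r s *\<^sub>R (?U' *v cvec y) + ?r' *\<^sub>R (U s *v cvec y) + ?V')) \<bullet> (U s *v cvec v) = 0"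
        using r_pos by (simp add: symp_inner matrix_vector_mult_add_rdistrib scale)
      moreover have "\<i> *s (k *\<^sub>R a) = k *\<^sub>R (\<i> *s a)" for k and a :: "complex^'n"
        by (simp add: vec_eq_iff)
      ultimately show ?thesis
        using UU[of y v] by (simp add: inner_add_left symp_inner vector_add_ldistrib)
    qed
    have "?U' *v cvec (- x) = - (?U' *v cvec x)"
      using bounded_linear.linear[OF bounded_bilinear.bounded_linear_right[OF bounded_bilinear_matrix_cvec]]
      by (rule linear_neg)
    then have "symp (?U' *v cvec (- x)) (U s *v cvec v) = - symp (?U' *v cvec x) (U s *v cvec v)"
      by (simp add: symp_def flip: sum_negf)
    then have "r s * symp (?U' *v cvec x) (U s *v cvec v) = 0" "symp ?V' (U s *v cvec v) = 0"
      using *[OF x v] *[of "- x"] x v by simp_all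
    then show ?thesis using r_pos by simp
  qed
  show "vec_Im (adjoint_matrix (U s) *v ?V') = 0"
  proof (rule vec_eqI_inner)
    fix v :: "real^'n"
    obtain x where "x \<in> sphere 0 1" "\<And>a. a \<in> {v} \<Longrightarrow> x \<bullet> a = 0"
      using exists_orthogonal_unit[of "{v}"] n by auto
    then have "symp ?V' (U s *v cvec v) = 0" using key[of x v] by (simp add: inner_commute)
    then show "v \<bullet> vec_Im (adjoint_matrix (U s) *v ?V') = v \<bullet> 0"
      by (simp add: symp_inner inner_adjoint_imaginary inner_commute[of v])
  qed
  show "vec_Im (adjoint_matrix (U s) *v (?U' *v cvec x)) \<bullet> v = 0" if xv: "x \<bullet> v = 0" for x v
  proof (cases "x = 0")
    case True
    then show ?thesis
      by (simp add: linear_0[OF linear_vec_Im])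
  next
    case False
    define y where "y = (1 / norm x) *\<^sub>R x"
    have y: "y \<in> sphere 0 1" "v \<bullet> y = 0" "x = norm x *\<^sub>R y"
      using False xv by (simp_all add: y_def inner_commute)
    have 0: "vec_Im (adjoint_matrix (U s) *v (?U' *v cvec y)) \<bullet> v = 0"
      using key[OF y(1,2)] by (simp add: symp_inner inner_adjoint_imaginary)
    have "linear (\<lambda>x. vec_Im (adjoint_matrix (U s) *v (?U' *v cvec x)))"
      using linear_compose[OF bounded_linear.linear[OF bounded_bilinear.bounded_linear_right[OF
          bounded_bilinear_matrix_cvec, of "adjoint_matrix (U s) ** ?U'"]] linear_vec_Im]
      by (simp add: matrix_vector_mul_assoc o_def)
    from linear_cmul[OF this, of "norm x" y] show ?thesis
      using 0 unfolding y(3)[symmetric] by simp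
  qed
qed

lemma bounded_bilinear_Re_mult:
  "bounded_bilinear (\<lambda>z (D :: complex^'n^'m). (\<chi> i j. Re (z * D $ i $ j)) :: real^'n^'m)"
  unfolding bilinear_conv_bounded_bilinear[symmetric] bilinear_def
  by (auto intro!: linearI simp: vec_eq_iff algebra_simps)

lemma orthogonal_matrixI:
  fixes R :: "real^'n^'n"
  assumes "\<And>x y. (R *v x) \<bullet> (R *v y) = x \<bullet> y"
  shows "orthogonal_matrix R"
proof -
  have "orthogonal_transformation ((*v) R)"
    using assms by (simp add: orthogonal_transformation_def matrix_vector_mul_linear)
  then show ?thesis
    by (simp add: orthogonal_transformation_matrix)
qed

text \<open>The matrix \<open>B = adjoint_matrix U ** U'\<close> has real part \<open>S\<close>,
  antisymmetric since \<open>U\<close> is isometric, and a scalar imaginary part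
  \<open>\<tau>\<close> by \<open>linear_orthogonality_scalar\<close>. With
  \<open>\<phi>' = \<tau>\<close>, the frame \<open>\<rho>\<close> obtained from \<open>U\<close> by
  removing the phase and the fixed matrix \<open>U s0\<close> satisfies
  \<open>\<rho>' = \<rho> S\<close> and starts at the identity. So it stays real, and it is the
  rotation \<open>R\<close>.\<close>

lemma lagrangian_sphere_normal_form:
  fixes F :: "real \<times> (real^'n) \<Rightarrow> complex^'n"
  assumes n: "CARD('n) \<ge> 3" and foliated: "sphere_foliated I F"
    and lagr: "lagrangian_on (I \<times> sphere 0 1) F"
  obtains A r \<phi> V w R where "unitary_matrix A"
    "smooth_on I r" "smooth_on I \<phi>" "smooth_on I V" "smooth_on I R"
    "\<And>s. s \<in> I \<Longrightarrow> r s > 0" "\<And>s. s \<in> I \<Longrightarrow> orthogonal_matrix (R s)"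
    "\<And>s. s \<in> I \<Longrightarrow> (V has_vector_derivative (of_real (r s) * cis (\<phi> s)) *s cvec (w s)) (at s)"
    "\<And>s x. s \<in> I \<Longrightarrow> x \<in> sphere 0 1 \<Longrightarrow>
      F (s, x) = A *v ((of_real (r s) * cis (\<phi> s)) *s cvec (R s *v x) + V s)"
proof -
  have I: "open_interval I" "open I" using foliated by (auto simp: sphere_foliated_def open_interval_def)
  then obtain s0 where s0: "s0 \<in> I" by (auto simp: open_interval_def)
  obtain r :: "real \<Rightarrow> real" and M :: "real \<Rightarrow> real^('n + 'n)^('n + 'n)" and C :: "real \<Rightarrow> complex^'n"
    where r: "smooth_on I r" and M: "smooth_on I M" and C: "smooth_on I C"
      and r_pos: "\<And>s. s \<in> I \<Longrightarrow> r s > 0" and rot: "\<And>s. s \<in> I \<Longrightarrow> rotation_matrix (M s)"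
      and F0: "\<And>s x. s \<in> I \<Longrightarrow> x \<in> sphere 0 1 \<Longrightarrow> F (s, x) = r s *\<^sub>R to_cplx (M s *v to_real (cvec x)) + C s"
    using foliated unfolding sphere_foliated_def by blast
  define U where "U s = complex_columns (M s)" for s
  have U: "smooth_on I U"
    unfolding U_def by (rule smooth_on_linear[OF I(2) M bounded_linear_complex_columns])
  have iso: "(U s *v cvec x) \<bullet> (U s *v cvec y) = x \<bullet> y" if "s \<in> I" for s x y
    unfolding U_def by (rule complex_columns_inner[OF rot[OF that]])
  have F: "F (s, x) = (r s *\<^sub>R U s) *v cvec x + C s" if "s \<in> I" "x \<in> sphere 0 1" for s x
    using F0[OF that] bounded_bilinear.scaleR_left[OF bounded_bilinear_matrix_cvec, of "r s" "U s" x]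
    by (simp add: complex_columns_mult U_def)
  define U' where "U' s = vector_derivative U (at s)" for s
  define C' where "C' s = vector_derivative C (at s)" for s
  have unitary: "unitary_matrix (U s)" and C'_real: "vec_Im (adjoint_matrix (U s) *v C' s) = 0"
    and perp: "\<And>x v. x \<bullet> v = 0 \<Longrightarrow> vec_Im (adjoint_matrix (U s) *v (U' s *v cvec x)) \<bullet> v = 0"
    if s: "s \<in> I" for s
    using lagrangian_family_infinitesimal[OF n I(2) F lagr r U C r_pos[OF s] iso[OF s] s]
    unfolding U'_def C'_def by blast+
  define B where "B s = adjoint_matrix (U s) ** U' s" for s
  define S where "S s x = vec_Re (B s *v cvec x)" for s x
  \<comment> \<open>An arbitrary unit vector, at which the scalar \<open>\<tau>\<close> is read
    off.\<close>
  define e where "e = (axis undefined 1 :: real^'n)"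
  have e: "e \<bullet> e = 1" by (simp add: e_def inner_axis_axis)
  define \<tau> where "\<tau> s = vec_Im (B s *v cvec e) \<bullet> e" for s
  have lin_B: "linear (\<lambda>x. B s *v cvec x)" for s
    by (rule bounded_linear.linear[OF bounded_bilinear.bounded_linear_right[OF bounded_bilinear_matrix_cvec]])
  have "vec_Im (B s *v cvec x) = \<tau> s *\<^sub>R x" if "s \<in> I" for s x
    unfolding \<tau>_def
  proof (rule linear_orthogonality_scalar[OF _ _ e])
    show "linear (\<lambda>x. vec_Im (B s *v cvec x))"
      using linear_compose[OF lin_B linear_vec_Im] by (simp add: o_def)
  qed (use perp[OF that] in \<open>simp add: B_def matrix_vector_mul_assoc\<close>)
  then have B_decomp: "B s *v cvec x = cvec (S s x) + (\<i> * of_real (\<tau> s)) *s cvec x" if "s \<in> I" for s x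
    using cvec_decomp[of "B s *v cvec x"] that by (simp add: S_def cvec_scaleR cvec_assoc mult.commute)
  have UB: "U' s *v cvec x = U s *v (B s *v cvec x)" if "s \<in> I" for s x
    using unitary_matrix_cancel(2)[OF unitary[OF that], of "U' s *v cvec x"]
    by (simp add: B_def matrix_vector_mul_assoc matrix_mul_assoc)
  have U_deriv: "(U has_vector_derivative U' s) (at s)" if "s \<in> I" for s
    unfolding U'_def by (rule smooth_on_derivative[OF U that])
  have antisym: "x \<bullet> S s y = - (y \<bullet> S s x)" if s: "s \<in> I" for s x y
  proof -
    have Ux: "((\<lambda>t. U t *v cvec x) has_vector_derivative U' s *v cvec x) (at s)" for x
      by (rule bounded_linear.has_vector_derivative[OF
            bounded_bilinear.bounded_linear_left[OF bounded_bilinear_matrix_cvec] U_deriv[OF s]])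
    have "((\<lambda>t. (U t *v cvec x) \<bullet> (U t *v cvec y)) has_vector_derivative
        (U s *v cvec x) \<bullet> (U' s *v cvec y) + (U' s *v cvec x) \<bullet> (U s *v cvec y)) (at s)"
      by (rule bounded_bilinear.has_vector_derivative[OF bounded_bilinear_inner Ux Ux])
    then have "((\<lambda>t. x \<bullet> y) has_vector_derivative
        (U s *v cvec x) \<bullet> (U' s *v cvec y) + (U' s *v cvec x) \<bullet> (U s *v cvec y)) (at s)"
      by (rule has_vector_derivative_transform_within_open[OF _ I(2) s iso])
    then have "(U s *v cvec x) \<bullet> (U' s *v cvec y) + (U' s *v cvec x) \<bullet> (U s *v cvec y) = 0"
      using vector_derivative_unique_at has_vector_derivative_const by blast
    moreover have "(U s *v cvec a) \<bullet> (U' s *v cvec b) = a \<bullet> S s b" for a b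
      by (simp add: adjoint_matrix_works B_def[symmetric] matrix_vector_mul_assoc cvec_cnj_inner S_def)
    ultimately show ?thesis by (simp add: inner_commute[of "U' s *v cvec x"])
  qed
  have \<tau>: "smooth_on I \<tau>"
  proof -
    have B: "smooth_on I B"
      unfolding B_def U'_def
      by (intro smooth_on_bilinear[OF I(2) _ _ bounded_bilinear_matrix_matrix_mult_complex]
          smooth_on_linear[OF I(2) U bounded_linear_adjoint_matrix] smooth_on_vector_derivative U)
    show ?thesis
      unfolding \<tau>_def
      by (intro smooth_on_linear[OF I(2) _ bounded_linear_inner_left] smooth_on_linear[OF I(2) _ bounded_linear_vec_Im]
          smooth_on_linear[OF I(2) B bounded_bilinear.bounded_linear_left[OF bounded_bilinear_matrix_cvec]])
  qed
  obtain \<phi> where \<phi>: "smooth_on I \<phi>" "\<phi> s0 = 0" "\<And>s. s \<in> I \<Longrightarrow> (\<phi> has_vector_derivative \<tau> s) (at s)"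
    by (rule smooth_on_antiderivative[OF I(1) \<tau> s0, of 0]) (rule that)
  define D where "D s = adjoint_matrix (U s0) ** U s" for s
  define \<rho> where "\<rho> s x = cis (- \<phi> s) *s (D s *v cvec x)" for s x
  have D: "smooth_on I D"
    unfolding D_def
    by (rule smooth_on_linear[OF I(2) U bounded_bilinear.bounded_linear_right[OF bounded_bilinear_matrix_matrix_mult_complex]])
  have lin_\<rho>: "linear (\<rho> s)" for s
    unfolding \<rho>_def
    by (intro linearI)
      (simp_all add: linear_add[OF linear_cvec] vec_eq_iff
        linear_cmul[OF linear_cvec]
        matrix_vector_mult_def algebra_simps sum.distrib scaleR_sum_right sum_distrib_left)
  have \<rho>_deriv: "((\<lambda>s. \<rho> s x) has_vector_derivative \<rho> s (S s x)) (at s)" if s: "s \<in> I" for s x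
  proof -
    have "((\<lambda>s. cis (- \<phi> s)) has_vector_derivative - (\<i> * of_real (\<tau> s)) * cis (- \<phi> s)) (at s)"
      using has_vector_derivative_cis[OF has_vector_derivative_minus[OF \<phi>(3)[OF s]]] by simp
    moreover have "((\<lambda>s. D s *v cvec x) has_vector_derivative (adjoint_matrix (U s0) ** U' s) *v cvec x) (at s)"
      unfolding D_def
      by (intro bounded_linear.has_vector_derivative[OF bounded_bilinear.bounded_linear_left[OF bounded_bilinear_matrix_cvec]]
          bounded_linear.has_vector_derivative[OF bounded_bilinear.bounded_linear_right[OF bounded_bilinear_matrix_matrix_mult_complex]]
          U_deriv[OF s])
    ultimately have "((\<lambda>s. \<rho> s x) has_vector_derivative
        cis (- \<phi> s) *s ((adjoint_matrix (U s0) ** U' s) *v cvec x)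
        + (- (\<i> * of_real (\<tau> s)) * cis (- \<phi> s)) *s (D s *v cvec x)) (at s)"
      unfolding \<rho>_def by (rule bounded_bilinear.has_vector_derivative[OF bounded_bilinear_vector_scalar_mult])
    moreover have "(adjoint_matrix (U s0) ** U' s) *v cvec x = D s *v cvec (S s x) + (\<i> * of_real (\<tau> s)) *s (D s *v cvec x)"
      by (simp add: D_def UB[OF s] B_decomp[OF s] matrix_vector_right_distrib matrix_vector_mult_scalar
          flip: matrix_vector_mul_assoc)
    ultimately show ?thesis
      by (simp add: \<rho>_def vector_add_ldistrib mult.commute)
  qed
  define X where "X s x = vec_Im (\<rho> s x)" for s x
  have lin_X: "linear (X s)" for s
    using linear_compose[OF lin_\<rho> linear_vec_Im] by (simp add: X_def[abs_def] o_def)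
  have X_deriv: "((\<lambda>s. X s x) has_vector_derivative X s (S s x)) (at s)" if "s \<in> I" for s x
    unfolding X_def by (rule bounded_linear.has_vector_derivative[OF bounded_linear_vec_Im \<rho>_deriv[OF that]])
  text \<open>The imaginary part solves a linear equation with antisymmetric coefficients and vanishes
    at \<open>s0\<close>.\<close>
  define f where "f s = (\<Sum>j\<in>UNIV. X s (axis j 1) \<bullet> X s (axis j 1))" for s
  have f_deriv: "(f has_vector_derivative 0) (at s)" if s: "s \<in> I" for s
  proof -
    define a where "a j k = S s (axis j 1) $ k" for j k
    have anti: "a j k = - a k j" for j k
      using antisym[OF s, of "axis k 1" "axis j 1"] by (simp add: a_def inner_axis')
    have expand: "X s (S s (axis j 1)) = (\<Sum>k\<in>UNIV. a j k *\<^sub>R X s (axis k 1))" for j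
    proof -
      have "S s (axis j 1) = (\<Sum>k\<in>UNIV. a j k *\<^sub>R axis k 1)"
        using basis_expansion[of "S s (axis j 1)"] by (simp add: a_def scalar_mult_eq_scaleR)
      then show ?thesis using lin_X by (simp add: linear_sum linear_cmul)
    qed
    \<comment> \<open>Antisymmetric coefficients against a symmetric Gram matrix: exchanging the
      indices changes the sign of the sum. Thus \<open>f\<close> is constant, and no uniqueness
      theorem for differential equations is invoked.\<close>
    let ?T = "\<Sum>j\<in>UNIV. \<Sum>k\<in>UNIV. a j k * (X s (axis j 1) \<bullet> X s (axis k 1))"
    have "?T = (\<Sum>j\<in>UNIV. \<Sum>k\<in>UNIV. a k j * (X s (axis j 1) \<bullet> X s (axis k 1)))"
      by (subst sum.swap) (simp add: inner_commute)
    also have "\<dots> = - ?T"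
      by (subst anti) (simp add: sum_negf)
    finally have T: "?T = 0" by simp
    have "(f has_vector_derivative (\<Sum>j\<in>UNIV. X s (axis j 1) \<bullet> X s (S s (axis j 1)) + X s (S s (axis j 1)) \<bullet> X s (axis j 1))) (at s)"
      (is "(f has_vector_derivative ?D) _")
      unfolding f_def
      by (intro has_vector_derivative_sum bounded_bilinear.has_vector_derivative[OF bounded_bilinear_inner] X_deriv s)
    also have "?D = 2 * ?T"
      by (simp add: expand inner_sum_left inner_sum_right inner_commute flip: sum_distrib_left)
    finally show ?thesis using T by simp
  qed
  have X0: "X s x = 0" if s: "s \<in> I" for s x
  proof -
    have "X s0 x = 0" for x
      using unitary_matrix_cancel(1)[OF unitary[OF s0], of "cvec x"] vec_cvec(2)[of 1 x]
      by (simp add: X_def \<rho>_def D_def \<phi>(2) flip: matrix_vector_mul_assoc)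
    then have "f s0 = 0" by (simp add: f_def)
    then have "f s = 0" using open_interval_constant[OF I(1) f_deriv s s0] by simp
    then have "X s (axis j 1) = 0" for j
      unfolding f_def by (subst (asm) sum_nonneg_eq_0_iff) auto
    then have "X s (\<Sum>j\<in>UNIV. x $ j *\<^sub>R axis j 1) = 0"
      using lin_X by (simp add: linear_sum linear_cmul)
    then show ?thesis using basis_expansion[of x] by (simp add: scalar_mult_eq_scaleR)
  qed
  define R where "R s = (\<chi> i j. Re (cis (- \<phi> s) * D s $ i $ j))" for s
  have R_mult: "R s *v x = vec_Re (\<rho> s x)" for s x
    by (simp add: R_def \<rho>_def vec_Re_def vec_eq_iff matrix_vector_mult_def cvec_def sum_distrib_left
        sum_subtractf sum.distrib algebra_simps)
  have \<rho>_R: "\<rho> s x = cvec (R s *v x)" if "s \<in> I" for s x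
    using cvec_decomp[of "\<rho> s x"] X0[OF that, of x] by (simp add: X_def R_mult)
  have U_R: "adjoint_matrix (U s0) *v (U s *v cvec x) = cis (\<phi> s) *s cvec (R s *v x)" if "s \<in> I" for s x
    using \<rho>_R[OF that, of x, symmetric]
    by (simp add: \<rho>_def D_def matrix_vector_mul_assoc vec_eq_iff cis_mult flip: mult.assoc)
  define V where "V s = adjoint_matrix (U s0) *v C s" for s
  \<comment> \<open>Read off from \<open>C' = U q\<close> with \<open>q\<close> real: in the frame
    \<open>U s0\<close> this becomes \<open>cis \<phi>\<close> times \<open>R q\<close>, and the
    factor \<open>1 / r\<close> completes \<open>cis \<phi>\<close> to
    \<open>\<gamma>\<close>.\<close>
  define w where "w s = (1 / r s) *\<^sub>R (R s *v vec_Re (adjoint_matrix (U s) *v C' s))" for s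
  show ?thesis
  proof (rule that[of "U s0" r \<phi> V R w])
    show "unitary_matrix (U s0)" by (rule unitary[OF s0])
    show "smooth_on I r" "smooth_on I \<phi>" by fact+
    show "smooth_on I V"
      unfolding V_def
      by (rule smooth_on_linear[OF I(2) C matrix_vector_mul_bounded_linear])
    show "smooth_on I R"
      unfolding R_def
      by (intro smooth_on_bilinear[OF I(2) _ D bounded_bilinear_Re_mult] smooth_on_cis smooth_on_minus \<phi>(1) I(2))
    show "r s > 0" if "s \<in> I" for s using that by (rule r_pos)
    show "orthogonal_matrix (R s)" if s: "s \<in> I" for s
    proof (rule orthogonal_matrixI)
      fix x y
      have adj: "(adjoint_matrix (U s0) *v u) \<bullet> (adjoint_matrix (U s0) *v v) = u \<bullet> v" for u v
        using adjoint_matrix_works[of "U s0" "adjoint_matrix (U s0) *v u" v]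
          unitary_matrix_cancel(2)[OF unitary[OF s0], of u] by simp
      have "(cis (\<phi> s) *s cvec (R s *v x)) \<bullet> (cis (\<phi> s) *s cvec (R s *v y)) = x \<bullet> y"
        unfolding U_R[OF s, symmetric] adj by (rule iso[OF s])
      then show "(R s *v x) \<bullet> (R s *v y) = x \<bullet> y"
        by (simp add: inner_cvec power2_eq_square[symmetric])
    qed
    show "(V has_vector_derivative (of_real (r s) * cis (\<phi> s)) *s cvec (w s)) (at s)" if s: "s \<in> I" for s
    proof -
      have "(V has_vector_derivative adjoint_matrix (U s0) *v C' s) (at s)"
        unfolding V_def C'_def
        by (rule bounded_linear.has_vector_derivative[OF
              matrix_vector_mul_bounded_linear smooth_on_derivative[OF C s]])
      moreover have "C' s = U s *v cvec (vec_Re (adjoint_matrix (U s) *v C' s))"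
        using unitary_matrix_cancel(2)[OF unitary[OF s], of "C' s"]
          cvec_decomp[of "adjoint_matrix (U s) *v C' s"] C'_real[OF s]
        by simp
      then have "adjoint_matrix (U s0) *v C' s = cis (\<phi> s) *s cvec (R s *v vec_Re (adjoint_matrix (U s) *v C' s))"
        using U_R[OF s] by metis
      moreover have "\<dots> = (of_real (r s) * cis (\<phi> s)) *s cvec (w s)"
        using r_pos[OF s] by (simp add: w_def cvec_scaleR)
      ultimately show ?thesis by simp
    qed
    show "F (s, x) = U s0 *v ((of_real (r s) * cis (\<phi> s)) *s cvec (R s *v x) + V s)"
      if sx: "s \<in> I" "x \<in> sphere 0 1" for s x
    proof -
      have "U s0 *v ((of_real (r s) * cis (\<phi> s)) *s cvec (R s *v x)) = of_real (r s) *s (U s0 *v (cis (\<phi> s) *s cvec (R s *v x)))"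
        by (simp add: cvec_assoc flip: matrix_vector_mult_scalar)
      also have "\<dots> = of_real (r s) *s (U s *v cvec x)"
        using U_R[OF sx(1), of x] unitary_matrix_cancel(2)[OF unitary[OF s0]] by metis
      also have "\<dots> = (r s *\<^sub>R U s) *v cvec x"
        using bounded_bilinear.scaleR_left[OF bounded_bilinear_matrix_cvec, of "r s" "U s" x]
        by (simp add: vec_eq_iff scaleR_conv_of_real[of _ "_ :: complex"])
      finally show ?thesis
        using F[OF sx] unitary_matrix_cancel(2)[OF unitary[OF s0], of "C s"]
        by (simp add: matrix_vector_right_distrib V_def)
    qed
  qed
qed

section \<open>Reparametrizations of families of spheres\<close>

text \<open>The derivative of the inverse is expressed through the inverse itself, so each round of
  the induction gains one order of differentiability.\<close>

lemma smooth_on_inv_into: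
  fixes \<psi> :: "real \<Rightarrow> real"
  assumes I: "open I" and \<psi>: "smooth_on I \<psi>" and inj: "inj_on \<psi> I"
    and nz: "\<And>s. s \<in> I \<Longrightarrow> vector_derivative \<psi> (at s) \<noteq> 0"
  shows "open (\<psi> ` I)" and "smooth_on (\<psi> ` I) (inv_into I \<psi>)"
    and "\<And>t. t \<in> \<psi> ` I \<Longrightarrow> (inv_into I \<psi> has_vector_derivative
      inverse (vector_derivative \<psi> (at (inv_into I \<psi> t)))) (at t)"
proof -
  let ?\<eta> = "inv_into I \<psi>" and ?\<psi>' = "\<lambda>s. vector_derivative \<psi> (at s)"
  show op: "open (\<psi> ` I)"
    by (rule invariance_of_domain[OF smooth_on_continuous[OF \<psi>] I inj])
  show deriv: "(?\<eta> has_vector_derivative inverse (?\<psi>' (?\<eta> t))) (at t)" if t: "t \<in> \<psi> ` I" for t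
  proof -
    obtain s where s: "s \<in> I" "t = \<psi> s" "?\<eta> t = s" using t inj by auto
    have "(?\<eta> has_derivative (\<lambda>h. h *\<^sub>R inverse (?\<psi>' s))) (at (\<psi> s))"
    proof (rule has_derivative_inverse_strong[OF I s(1) smooth_on_continuous[OF \<psi>]])
      show "(\<psi> has_derivative (\<lambda>h. h *\<^sub>R ?\<psi>' s)) (at s)"
        using smooth_on_derivative[OF \<psi> s(1)] by (simp add: has_vector_derivative_def)
    qed (use inj nz[OF s(1)] in \<open>auto simp: fun_eq_iff\<close>)
    then show ?thesis using s by (simp add: has_vector_derivative_def)
  qed
  have sub: "?\<eta> ` \<psi> ` I \<subseteq> I" by (auto intro: inv_into_into)
  have "smooth_on I (\<lambda>s. inverse (?\<psi>' s))"
    by (rule smooth_on_inverse[OF I smooth_on_vector_derivative[OF \<psi>] nz])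
  then have "Ck_on k (\<psi> ` I) ?\<eta>" for k
  proof (induction k)
    case 0
    have "continuous_on (\<psi> ` I) ?\<eta>"
      by (intro continuous_at_imp_continuous_on ballI has_vector_derivative_continuous[OF deriv])
    then show ?case by simp
  next
    case (Suc k)
    have "Ck_on k (\<psi> ` I) (\<lambda>t. inverse (?\<psi>' (?\<eta> t)))"
      by (rule Ck_on_compose[OF op Suc.IH[OF Suc.prems] sub]) (use Suc.prems in \<open>simp add: smooth_on_def\<close>)
    from Ck_on_SucI[OF deriv op this] show ?case by simp
  qed
  then show "smooth_on (\<psi> ` I) ?\<eta>" by (simp add: smooth_on_def)
qed

lemma curve_equivalence_image: "curve_equivalence N N' \<Phi> \<Longrightarrow> \<Phi> ` N = N'"
  by (simp add: curve_equivalence_def)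

lemma curve_equivalence_lift:
  assumes "curve_equivalence N N' \<Phi>" "p \<in> N" "curve_through N' (\<Phi> p) d"
  obtains c where "curve_through N p c" "\<forall>\<^sub>F t in nhds 0. d t = \<Phi> (c t)"
  using assms unfolding curve_equivalence_def by blast

lemma orthogonal_matrix_sphere:
  fixes R :: "real^'n^'n"
  assumes "orthogonal_matrix R" "x \<in> sphere 0 1"
  shows "R *v x \<in> sphere 0 1"
proof -
  have "orthogonal_transformation ((*v) R)"
    using assms(1) by (simp add: orthogonal_transformation_matrix)
  then show ?thesis using assms(2) by (simp add: orthogonal_transformation_norm)
qed

text \<open>The inverse map is explicit, the transpose undoing the rotation, so curves are lifted by
  composing with it.\<close>

lemma curve_equivalence_rotation:
  fixes R :: "real \<Rightarrow> real^'n^'n" and \<psi> :: "real \<Rightarrow> real"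
  assumes J: "open J" and \<psi>: "smooth_on I \<psi>" "\<psi> ` I = J" and \<eta>: "smooth_on J \<eta>" "\<eta> ` J \<subseteq> I"
    and inv: "\<And>t. t \<in> J \<Longrightarrow> \<psi> (\<eta> t) = t" "\<And>s. s \<in> I \<Longrightarrow> \<eta> (\<psi> s) = s"
    and R: "smooth_on I R" "\<And>s. s \<in> I \<Longrightarrow> orthogonal_matrix (R s)"
  shows "curve_equivalence (I \<times> sphere 0 1) (J \<times> sphere 0 1) (\<lambda>(s, x). (\<psi> s, R s *v x))"
proof -
  let ?\<Phi> = "\<lambda>(s, x). (\<psi> s, R s *v x)"
  let ?\<Psi> = "\<lambda>(t, y). (\<eta> t, transpose (R (\<eta> t)) *v y)"
  have RT: "R s *v (transpose (R s) *v x) = x" "transpose (R s) *v (R s *v x) = x" if "s \<in> I" for s x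
    using R(2)[OF that]
    by (simp_all add: orthogonal_matrix_def matrix_vector_mul_assoc del: transpose_matrix_vector)
  have \<Phi>: "?\<Phi> p \<in> J \<times> sphere 0 1" "?\<Psi> (?\<Phi> p) = p" if "p \<in> I \<times> sphere 0 1" for p
    using that \<psi>(2) inv(2) RT(2) orthogonal_matrix_sphere[OF R(2)] by auto
  have \<Psi>: "?\<Psi> q \<in> I \<times> sphere 0 1" "?\<Phi> (?\<Psi> q) = q" if q: "q \<in> J \<times> sphere 0 1" for q
  proof -
    obtain t y where ty: "q = (t, y)" "t \<in> J" "y \<in> sphere 0 1" using q by auto
    have "\<eta> t \<in> I" using \<eta>(2) ty by auto
    moreover from this have "orthogonal_matrix (transpose (R (\<eta> t)))"
      using R(2) by (simp add: orthogonal_matrix_def)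
    from orthogonal_matrix_sphere[OF this ty(3)]
    have "transpose (R (\<eta> t)) *v y \<in> sphere 0 1" .
    ultimately show "?\<Psi> q \<in> I \<times> sphere 0 1" "?\<Phi> (?\<Psi> q) = q"
      using ty inv(1) RT(1) by auto
  qed
  have smooth: "smooth_on T (\<lambda>t. Q (fst (c t)) *v snd (c t))" "smooth_on T (\<lambda>t. g (fst (c t)))"
    if "open T" "smooth_on T c" "smooth_on K Q" "smooth_on K g" "c ` T \<subseteq> K \<times> sphere 0 1"
    for T K and c :: "real \<Rightarrow> real \<times> (real^'n)" and Q :: "real \<Rightarrow> real^'n^'n" and g :: "real \<Rightarrow> real"
  proof -
    have fst: "smooth_on T (\<lambda>t. fst (c t))" and snd: "smooth_on T (\<lambda>t. snd (c t))"
      using smooth_on_linear[OF that(1,2) bounded_linear_fst] smooth_on_linear[OF that(1,2) bounded_linear_snd]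
      by auto
    have sub: "(\<lambda>t. fst (c t)) ` T \<subseteq> K" using that(5) by auto
    show "smooth_on T (\<lambda>t. Q (fst (c t)) *v snd (c t))" "smooth_on T (\<lambda>t. g (fst (c t)))"
      using smooth_on_bilinear[OF that(1) smooth_on_compose[OF that(1) fst that(3) sub] snd
          bounded_bilinear_matrix_vector_mult_real]
        smooth_on_compose[OF that(1) fst that(4) sub] by auto
  qed
  \<comment> \<open>Stated for arbitrary \<open>g\<close> and \<open>Q\<close> because it is used
    both for the map and for its inverse.\<close>
  have curve: "\<exists>e>0. smooth_on {-e<..<e} (h \<circ> c) \<and> (h \<circ> c) ` {-e<..<e} \<subseteq> L \<times> sphere 0 1"
    if c: "curve_through (K \<times> sphere 0 1) p c" and h: "h = (\<lambda>(t, y). (g t, Q t *v y))"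
      and gQ: "smooth_on K g" "smooth_on K Q" and hK: "\<And>q. q \<in> K \<times> sphere 0 1 \<Longrightarrow> h q \<in> L \<times> sphere 0 1"
    for K L p c h and g :: "real \<Rightarrow> real" and Q :: "real \<Rightarrow> real^'n^'n"
  proof -
    obtain e where e: "e > 0" "smooth_on {-e<..<e} c" "c ` {-e<..<e} \<subseteq> K \<times> sphere 0 1"
      using c unfolding curve_through_def by auto
    have "smooth_on {-e<..<e} (\<lambda>t. (g (fst (c t)), Q (fst (c t)) *v snd (c t)))"
      by (intro smooth_on_Pair smooth[OF _ e(2) gQ(2,1) e(3)]) auto
    then have "smooth_on {-e<..<e} (h \<circ> c)" by (simp add: h o_def case_prod_beta)
    moreover have "(h \<circ> c) t \<in> L \<times> sphere 0 1" if "t \<in> {-e<..<e}" for t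
      using hK[of "c t"] e(3) that by (simp add: image_subset_iff)
    ultimately show ?thesis using e(1) by blast
  qed
  have "curve_through (J \<times> sphere 0 1) (?\<Phi> p) (?\<Phi> \<circ> c)" if "curve_through (I \<times> sphere 0 1) p c" for p c
    using curve[OF that refl \<psi>(1) R(1) \<Phi>(1)] curve_through_base[OF that] unfolding curve_through_def by auto
  moreover have "\<exists>c. curve_through (I \<times> sphere 0 1) p c \<and> (\<forall>\<^sub>F t in nhds 0. d t = ?\<Phi> (c t))"
    if p: "p \<in> I \<times> sphere 0 1" and d: "curve_through (J \<times> sphere 0 1) (?\<Phi> p) d" for p d
  proof -
    have "linear (transpose :: real^'n^'n \<Rightarrow> real^'n^'n)"
      by (intro linearI) (simp_all add: transpose_def vec_eq_iff)
    then have RT_smooth: "smooth_on J (\<lambda>t. transpose (R (\<eta> t)))"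
      using smooth_on_linear[OF J smooth_on_compose[OF J \<eta>(1) R(1) \<eta>(2)]]
      by (simp add: linear_conv_bounded_linear)
    have "curve_through (I \<times> sphere 0 1) p (?\<Psi> \<circ> d)"
      using curve[OF d refl \<eta>(1) RT_smooth \<Psi>(1)] curve_through_base[OF d] \<Phi>(2)[OF p] unfolding curve_through_def by auto
    moreover have "\<forall>\<^sub>F t in nhds 0. d t = ?\<Phi> ((?\<Psi> \<circ> d) t)"
      using curve_through_eventually[OF d] by eventually_elim (simp only: o_apply \<Psi>(2))
    ultimately show ?thesis by blast
  qed
  moreover have "?\<Phi> ` (I \<times> sphere 0 1) = J \<times> sphere 0 1"
  proof (intro subset_antisym subsetI)
    show "q \<in> J \<times> sphere 0 1" if "q \<in> ?\<Phi> ` (I \<times> sphere 0 1)" for q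
      using that \<Phi>(1) by blast
    show "q \<in> ?\<Phi> ` (I \<times> sphere 0 1)" if "q \<in> J \<times> sphere 0 1" for q
      using \<Psi>[OF that] by (rule image_eqI[rotated, OF _ sym])
  qed
  ultimately show ?thesis
    unfolding curve_equivalence_def by blast
qed

section \<open>Flat families and centered families\<close>

text \<open>The derivative is orthogonal to the orthogonal complement of \<open>L\<close>, whose
  complement is \<open>L\<close> again.\<close>

lemma derivative_in_subspace:
  fixes L :: "'b::euclidean_space set"
  assumes "subspace L" "\<forall>\<^sub>F t in nhds 0. W t \<in> L" "(W has_vector_derivative W') (at 0)"
  shows "W' \<in> L"
proof -
  have "W' \<bullet> n = 0" if "n \<in> orthogonal_comp L" for n
  proof -
    have "\<forall>\<^sub>F t in nhds 0. W t \<bullet> n = 0"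
      using assms(2) by eventually_elim (use that in \<open>simp add: orthogonal_comp_def orthogonal_def\<close>)
    then have "vector_derivative (\<lambda>t. W t \<bullet> n) (at 0) = 0"
      using vector_derivative_eventually_cong[of "\<lambda>t. W t \<bullet> n" "\<lambda>_. 0" 0] by simp
    then show ?thesis
      using vector_derivative_at[OF bounded_linear.has_vector_derivative[OF bounded_linear_inner_left assms(3)]]
      by simp
  qed
  then have "W' \<in> orthogonal_comp (orthogonal_comp L)"
    by (simp add: orthogonal_comp_def[of "orthogonal_comp L"] orthogonal_def inner_commute)
  then show ?thesis using orthogonal_comp_self[OF assms(1)] by simp
qed

lemma normal_part_zero: "subspace T \<Longrightarrow> v \<in> T \<Longrightarrow> normal_part T v = 0"
  by (rule normal_part_eqI) (simp_all add: subspace_0 subspace_orthogonal_comp)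

text \<open>By dimension every tangent space is \<open>L\<close> itself. Tangent fields and the
  position then stay in \<open>L\<close>, so both terms of the equation vanish, for every value of
  \<open>lam\<close>.\<close>

lemma self_similar_in_subspace:
  fixes f :: "'a::real_normed_vector \<Rightarrow> 'b::euclidean_space"
  assumes L: "subspace L" "f ` N \<subseteq> L"
    and T: "\<And>p. p \<in> N \<Longrightarrow> subspace (tangent_space N f p) \<and> dim (tangent_space N f p) = dim L"
    and smooth: "\<And>p c. curve_through N p c \<Longrightarrow> \<exists>e>0. smooth_on {-e<..<e} (f \<circ> c)"
  shows "self_similar N f lam"
proof -
  have TL: "tangent_space N f p = L" if p: "p \<in> N" for p
  proof -
    have "v \<in> L" if "v \<in> tangent_space N f p" for v
    proof -
      obtain c where c: "curve_through N p c" "v = vector_derivative (f \<circ> c) (at 0)"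
        using \<open>v \<in> tangent_space N f p\<close> unfolding tangent_space_def by auto
      obtain e where "e > 0" "smooth_on {-e<..<e} (f \<circ> c)" using smooth[OF c(1)] by blast
      then have "(f \<circ> c has_vector_derivative v) (at 0)"
        using smooth_on_derivative[of "{-e<..<e}" "f \<circ> c" 0] c(2) by simp
      moreover have "\<forall>\<^sub>F t in nhds 0. (f \<circ> c) t \<in> L"
        using curve_through_eventually[OF c(1)] by eventually_elim (use L(2) in auto)
      ultimately show ?thesis by (rule derivative_in_subspace[OF L(1), rotated])
    qed
    then show ?thesis
      using subspace_dim_equal[of "tangent_space N f p" L] T[OF p] L(1) by auto
  qed
  have sff: "second_fundamental_form N f p v v = 0" if p: "p \<in> N" and v: "v \<in> L" for p v
    unfolding second_fundamental_form_def
  proof (rule the_equality)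
    obtain c where c: "curve_through N p c" "vector_derivative (f \<circ> c) (at 0) = v"
      using v TL[OF p] unfolding tangent_space_def by auto
    have "\<forall>\<^sub>F t in nhds 0. v \<in> tangent_space N f (c t)"
      using curve_through_eventually[OF c(1)] by eventually_elim (simp add: TL v)
    then have "tangent_field_along N f c (\<lambda>_. v)"
      unfolding tangent_field_along_def eventually_nhds_0_interval by auto
    then show "\<exists>c W. curve_through N p c \<and> vector_derivative (f \<circ> c) (at 0) = v \<and>
        tangent_field_along N f c W \<and> W 0 = v \<and>
        0 = normal_part (tangent_space N f p) (vector_derivative W (at 0))"
      using c normal_part_zero[OF L(1) subspace_0[OF L(1)]]
      by (intro exI[of _ c] exI[of _ "\<lambda>_. v"]) (simp add: TL[OF p])
  next
    fix h
    assume "\<exists>c W. curve_through N p c \<and> vector_derivative (f \<circ> c) (at 0) = v \<and>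
        tangent_field_along N f c W \<and> W 0 = v \<and>
        h = normal_part (tangent_space N f p) (vector_derivative W (at 0))"
    then obtain c W where c: "curve_through N p c" "tangent_field_along N f c W"
        and h: "h = normal_part L (vector_derivative W (at 0))"
      by (auto simp: TL[OF p])
    obtain e where e: "e > 0" "smooth_on {-e<..<e} W" "\<forall>t\<in>{-e<..<e}. W t \<in> tangent_space N f (c t)"
      using c(2) unfolding tangent_field_along_def by auto
    have "\<forall>\<^sub>F t in nhds 0. W t \<in> tangent_space N f (c t)"
      unfolding eventually_nhds_0_interval using e by auto
    then have "\<forall>\<^sub>F t in nhds 0. W t \<in> L"
      using curve_through_eventually[OF c(1)] by eventually_elim (simp add: TL)
    moreover have "(W has_vector_derivative vector_derivative W (at 0)) (at 0)"
      using smooth_on_derivative[OF e(2), of 0] e(1) by simp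
    ultimately show "h = 0"
      using h normal_part_zero[OF L(1)] derivative_in_subspace[OF L(1)] by blast
  qed
  show ?thesis
    unfolding self_similar_def
  proof
    fix p assume p: "p \<in> N"
    define B where "B = (SOME B. orthonormal_basis_of L B)"
    have "orthonormal_basis_of L B"
      unfolding B_def by (rule orthonormal_basis_of_some[OF L(1)])
    then have "e \<in> L" if "e \<in> B" for e
      using span_base[OF that] by (simp add: orthonormal_basis_of_def)
    then have "mean_curvature N f p = 0"
      unfolding mean_curvature_def TL[OF p] B_def[symmetric] using sff[OF p] by simp
    moreover have "normal_part (tangent_space N f p) (f p) = 0"
      unfolding TL[OF p] using L p by (intro normal_part_zero) auto
    ultimately show "mean_curvature N f p + lam *\<^sub>R normal_part (tangent_space N f p) (f p) = 0" by simp
  qed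
qed

text \<open>The defect of the equation is a normal vector, so it is enough to test it on the normal
  fields. With centers at the origin the pairings with \<open>normal_q\<close> vanish term by term,
  and the one with \<open>normal_0\<close> is the hypothesis \<open>ode\<close>.\<close>

lemma (in immersed_sphere_family) self_similarI:
  assumes dim: "\<And>p. p \<in> N \<Longrightarrow> dim (tangent_space N G p) = CARD('n)"
    and V0: "\<And>s. s \<in> J \<Longrightarrow> V s = 0"
    and ode: "\<And>s. s \<in> J \<Longrightarrow> Im (cnj (\<gamma>' s) * \<gamma>'' s) / (cmod (\<gamma>' s))\<^sup>2
      + (real CARD('n) - 1) * \<mu> s / (cmod (\<gamma> s))\<^sup>2 = real CARD('n) * lam * \<mu> s"
  shows "self_similar N G lam"
  unfolding self_similar_def
proof
  fix p assume p: "p \<in> N"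
  then obtain s y where sy: "p = (s, y)" "s \<in> J" "y \<in> sphere 0 1" by auto
  let ?T = "tangent_space N G (s, y)"
  let ?h = "mean_curvature N G (s, y) + lam *\<^sub>R normal_part ?T (G (s, y))"
  have T: "subspace ?T" by (rule subspace_tangent_space_G[OF sy(2,3)])
  have d: "dim ?T = CARD('n)" using dim p sy(1) by simp
  note zero = center_vanishes[OF J sy(2) order_refl V0 sy(3)]
  have inner: "?h \<bullet> \<nu> = mean_curvature N G (s, y) \<bullet> \<nu> + lam * (P (\<gamma> s *s cvec y + V s) \<bullet> \<nu>)"
    if "\<nu> \<in> orthogonal_comp ?T" for \<nu>
    using normal_part_inner[OF T that] by (simp add: inner_add_left G_def)
  have "?h = 0"
  proof (rule normals_total[OF sy(2,3)])
    show "?h \<in> orthogonal_comp ?T"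
      by (intro subspace_add subspace_scale subspace_orthogonal_comp normal_part_in(1)[OF T]
          mean_curvature_normal[OF sy(2,3) d])
    show "?h \<bullet> normal_q q (s, y) = 0" if q: "q \<bullet> y = 0" for q
    proof -
      have "mean_curvature N G (s, y) \<bullet> normal_q q (s, y) = 0"
        using mean_curvature_normal_q[OF sy(2,3) d q] zero(1) by simp
      moreover have "P (\<gamma> s *s cvec y + V s) \<bullet> normal_q q (s, y) = 0"
        unfolding inner_normal_q[OF q] using V0[OF sy(2)] by (simp add: cvec_assoc mult.commute)
      ultimately show ?thesis using inner[OF normal_q_normal[OF sy(2,3)]] by simp
    qed
    show "?h \<bullet> normal_0 (s, y) = 0"
      using mean_curvature_normal_0[OF sy(2,3) d zero(1,2)] ode[OF sy(2)] zero(3)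
        inner[OF normal_0_normal[OF sy(2,3)]] by simp
  qed
  then show "mean_curvature N G p + lam *\<^sub>R normal_part (tangent_space N G p) (G p) = 0"
    using sy(1) by simp
qed

text \<open>The angle \<open>\<theta>\<close> is obtained by integrating the profile equation itself: it prescribes the
  derivative of the argument of \<open>\<gamma>'\<close>.\<close>

lemma arclength_profile:
  fixes r \<phi> :: "real \<Rightarrow> real" and n :: nat
  assumes \<gamma>_def: "\<gamma> = (\<lambda>s. of_real (r s) * cis (\<phi> s))"
    and I: "open_interval I" and r: "smooth_on I r" and \<phi>: "smooth_on I \<phi>"
    and r_pos: "\<And>s. s \<in> I \<Longrightarrow> r s > 0"
    and nz: "\<And>s. s \<in> I \<Longrightarrow> vector_derivative \<gamma> (at s) \<noteq> 0"
    and ode: "\<And>s. s \<in> I \<Longrightarrow>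
      Im (cnj (vector_derivative \<gamma> (at s)) * vector_derivative (\<lambda>s. vector_derivative \<gamma> (at s)) (at s))
        / (cmod (vector_derivative \<gamma> (at s)))\<^sup>2
      + (real n - 1) * Im (cnj (\<gamma> s) * vector_derivative \<gamma> (at s)) / (cmod (\<gamma> s))\<^sup>2
      = real n * lam * Im (cnj (\<gamma> s) * vector_derivative \<gamma> (at s))"
  obtains \<psi> J g where "open_interval J" "self_similar_profile n lam J g" "bij_betw \<psi> I J"
    "smooth_on I \<psi>" "\<And>s. s \<in> I \<Longrightarrow> deriv \<psi> s \<noteq> 0" "\<And>s. s \<in> I \<Longrightarrow> g (\<psi> s) = \<gamma> s"
proof -
  have I_open: "open I" using I by (simp add: open_interval_def)
  obtain s0 where s0: "s0 \<in> I" using I by (auto simp: open_interval_def)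
  define g1 where "g1 s = vector_derivative \<gamma> (at s)" for s
  define g2 where "g2 s = vector_derivative g1 (at s)" for s
  define \<mu> where "\<mu> s = Im (cnj (\<gamma> s) * g1 s)" for s
  have \<gamma>: "smooth_on I \<gamma>"
    unfolding \<gamma>_def by (intro smooth_on_mult smooth_on_of_real smooth_on_cis I_open r \<phi>)
  have g1: "smooth_on I g1"
    unfolding g1_def[abs_def] by (rule smooth_on_vector_derivative[OF \<gamma>])
  have d\<gamma>: "(\<gamma> has_vector_derivative g1 s) (at s)" and dg1: "(g1 has_vector_derivative g2 s) (at s)"
    if "s \<in> I" for s
    using smooth_on_derivative[OF \<gamma> that] smooth_on_derivative[OF g1 that] by (simp_all add: g1_def g2_def)
  have g1_nz: "g1 s \<noteq> 0" if "s \<in> I" for s using nz[OF that] by (simp add: g1_def)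
  have norm_\<gamma>: "cmod (\<gamma> s) = r s" if "s \<in> I" for s
    using r_pos[OF that] by (simp add: \<gamma>_def norm_mult)
  define a where "a s = real n * lam * \<mu> s - (real n - 1) * \<mu> s / (r s)\<^sup>2" for s
  have a_eq: "a s = Im (cnj (g1 s) * g2 s) / (cmod (g1 s))\<^sup>2" if "s \<in> I" for s
    using ode[OF that] norm_\<gamma>[OF that]
    unfolding a_def \<mu>_def g1_def[symmetric] g2_def[symmetric] by (simp add: g1_def[abs_def, symmetric] g2_def)
  have \<mu>: "smooth_on I \<mu>"
    unfolding \<mu>_def[abs_def] by (intro smooth_on_Im smooth_on_mult smooth_on_cnj I_open \<gamma> g1)
  have "smooth_on I a"
    unfolding a_def[abs_def] power2_eq_square
    by (intro smooth_on_diff smooth_on_mult smooth_on_divide smooth_on_const \<mu> r I_open) (use r_pos in force)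
  from smooth_on_antiderivative[OF I this s0, of "Arg (g1 s0)"]
  obtain \<theta> where \<theta>: "smooth_on I \<theta>" "\<theta> s0 = Arg (g1 s0)" "\<And>s. s \<in> I \<Longrightarrow> (\<theta> has_vector_derivative a s) (at s)"
    by blast
  \<comment> \<open>The speed, written so that the smoothness rules for products, sums and square
    roots apply.\<close>
  define l where "l s = sqrt (Re (g1 s) * Re (g1 s) + Im (g1 s) * Im (g1 s))" for s
  have l_cmod: "l s = cmod (g1 s)" for s by (simp add: l_def cmod_def power2_eq_square)
  have l_pos: "l s > 0" if "s \<in> I" for s using g1_nz[OF that] by (simp add: l_cmod)
  have pos: "Re (g1 s) * Re (g1 s) + Im (g1 s) * Im (g1 s) > 0" if "s \<in> I" for s
    using l_pos[OF that] by (simp add: l_def)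
  have l: "smooth_on I l"
    unfolding l_def[abs_def]
    by (intro smooth_on_sqrt smooth_on_add smooth_on_mult smooth_on_Re smooth_on_Im I_open g1 pos)
  have dl: "(l has_vector_derivative Re (cnj (g1 s) * g2 s) / l s) (at s)" if s: "s \<in> I" for s
  proof -
    have re: "((\<lambda>s. Re (g1 s)) has_real_derivative Re (g2 s)) (at s)"
      and im: "((\<lambda>s. Im (g1 s)) has_real_derivative Im (g2 s)) (at s)"
      unfolding has_real_derivative_iff_has_vector_derivative
      using bounded_linear.has_vector_derivative[OF bounded_linear_Re dg1[OF s]]
        bounded_linear.has_vector_derivative[OF bounded_linear_Im dg1[OF s]] by auto
    have "(l has_real_derivative (inverse (l s) / 2) *
        ((Re (g2 s) * Re (g1 s) + Re (g2 s) * Re (g1 s)) + (Im (g2 s) * Im (g1 s) + Im (g2 s) * Im (g1 s)))) (at s)"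
      unfolding l_def[abs_def]
      by (rule DERIV_chain2[OF DERIV_real_sqrt[OF pos[OF s]] DERIV_add[OF DERIV_mult[OF re re] DERIV_mult[OF im im]]])
    moreover have "(inverse (l s) / 2) * ((Re (g2 s) * Re (g1 s) + Re (g2 s) * Re (g1 s)) +
        (Im (g2 s) * Im (g1 s) + Im (g2 s) * Im (g1 s))) = Re (cnj (g1 s) * g2 s) / l s"
      using l_pos[OF s] by (simp add: field_simps)
    ultimately show ?thesis by (simp only: has_real_derivative_iff_has_vector_derivative)
  qed
  have polar: "g1 s = of_real (l s) * cis (\<theta> s)" if s: "s \<in> I" for s
  proof -
    \<comment> \<open>Shows that \<open>\<theta>\<close> is the argument of \<open>g1\<close>
      without differentiating \<open>Arg\<close>, which has jumps: the quotient \<open>q\<close> has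
      derivative 0, and \<open>Arg\<close> enters only through the initial value.\<close>
    define q where "q s = of_real (inverse (l s)) * (cis (- \<theta> s) * g1 s)" for s
    have "(q has_vector_derivative 0) (at t)" if t: "t \<in> I" for t
    proof -
      define \<sigma> where "\<sigma> = (l t)\<^sup>2"
      have lt: "l t \<noteq> 0" using l_pos[OF t] by simp
      have "((\<lambda>s. complex_of_real (inverse (l s))) has_vector_derivative
          of_real (- (inverse (l t) * (Re (cnj (g1 t) * g2 t) / l t) * inverse (l t)))) (at t)"
        using DERIV_inverse'[OF dl[OF t, folded has_real_derivative_iff_has_vector_derivative] lt]
        by (intro bounded_linear.has_vector_derivative[OF bounded_linear_of_real])
          (simp add: has_real_derivative_iff_has_vector_derivative)
      moreover have "((\<lambda>s. cis (- \<theta> s) * g1 s) has_vector_derivative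
          cis (- \<theta> t) * g2 t + (\<i> * of_real (- a t) * cis (- \<theta> t)) * g1 t) (at t)"
        by (intro has_vector_derivative_mult has_vector_derivative_cis has_vector_derivative_minus \<theta>(3) dg1 t)
      ultimately have "(q has_vector_derivative
          of_real (inverse (l t)) * (cis (- \<theta> t) * g2 t + (\<i> * of_real (- a t) * cis (- \<theta> t)) * g1 t)
          + of_real (- (inverse (l t) * (Re (cnj (g1 t) * g2 t) / l t) * inverse (l t))) * (cis (- \<theta> t) * g1 t)) (at t)"
        (is "(q has_vector_derivative ?D) _")
        unfolding q_def[abs_def] by (rule has_vector_derivative_mult)
      also have "?D = of_real (inverse (l t)) * cis (- \<theta> t) *
          (g2 t - g1 t * (\<i> * of_real (Im (cnj (g1 t) * g2 t) / \<sigma>) + of_real (Re (cnj (g1 t) * g2 t) / \<sigma>)))"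
        unfolding a_eq[OF t] l_cmod[symmetric] \<sigma>_def using lt
        by (simp add: field_simps power2_eq_square)
      \<comment> \<open>The bracket is the logarithmic derivative of \<open>g1\<close>: its real
        part is the derivative of \<open>l\<close> over \<open>l\<close>, its imaginary part is
        \<open>a\<close>.\<close>
      also have "g1 t * (\<i> * of_real (Im (cnj (g1 t) * g2 t) / \<sigma>) + of_real (Re (cnj (g1 t) * g2 t) / \<sigma>)) = g2 t"
      proof -
        have "\<i> * of_real (Im (cnj (g1 t) * g2 t) / \<sigma>) + of_real (Re (cnj (g1 t) * g2 t) / \<sigma>)
            = cnj (g1 t) * g2 t / of_real \<sigma>"
          using complex_eq[of "cnj (g1 t) * g2 t / of_real \<sigma>"] by (simp add: add.commute)
        moreover have "of_real \<sigma> = g1 t * cnj (g1 t)"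
          unfolding \<sigma>_def l_cmod by (rule complex_norm_square)
        ultimately show ?thesis using g1_nz[OF t] by simp
      qed
      finally show ?thesis by simp
    qed
    from open_interval_constant[OF I this s s0] have "q s = q s0" .
    also have "q s0 = 1"
    proof -
      have "g1 s0 = of_real (l s0) * cis (\<theta> s0)"
        using rcis_cmod_Arg[of "g1 s0"] by (simp add: rcis_def l_cmod \<theta>(2))
      then have "cis (- \<theta> s0) * g1 s0 = cis (- \<theta> s0) * (of_real (l s0) * cis (\<theta> s0))"
        by (rule arg_cong)
      also have "\<dots> = of_real (l s0) * (cis (- \<theta> s0) * cis (\<theta> s0))" by (rule mult.left_commute)
      finally have "cis (- \<theta> s0) * g1 s0 = of_real (l s0)" by (simp add: cis_mult)
      then show ?thesis using l_pos[OF s0] by (simp add: q_def)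
    qed
    finally have "cis (- \<theta> s) * g1 s = of_real (l s)"
      using l_pos[OF s] by (simp add: q_def field_simps)
    then have "cis (\<theta> s) * (cis (- \<theta> s) * g1 s) = cis (\<theta> s) * of_real (l s)" by simp
    moreover have "cis (\<theta> s) * (cis (- \<theta> s) * g1 s) = g1 s"
      by (simp only: mult.assoc[symmetric] cis_mult) simp
    ultimately show ?thesis by (simp only: mult.commute)
  qed
  obtain \<psi> where \<psi>: "smooth_on I \<psi>" "\<And>s. s \<in> I \<Longrightarrow> (\<psi> has_vector_derivative l s) (at s)"
    using smooth_on_antiderivative[OF I l s0, of 0] by blast
  have \<psi>_real: "(\<psi> has_real_derivative l s) (at s)" if "s \<in> I" for s
    using \<psi>(2)[OF that] by (simp add: has_real_derivative_iff_has_vector_derivative)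
  have mono: "\<psi> s < \<psi> t" if st: "s \<in> I" "t \<in> I" "s < t" for s t
  proof (rule DERIV_pos_imp_increasing[OF st(3)])
    fix x assume "s \<le> x" "x \<le> t"
    then have "x \<in> I" using I st unfolding open_interval_def is_interval_1 by blast
    then show "\<exists>y. DERIV \<psi> x :> y \<and> 0 < y" using \<psi>_real l_pos by blast
  qed
  have inj: "inj_on \<psi> I"
    by (rule inj_onI) (metis mono less_irrefl linorder_less_linear)
  have \<psi>1: "vector_derivative \<psi> (at s) = l s" if "s \<in> I" for s
    by (rule vector_derivative_at[OF \<psi>(2)[OF that]])
  then have "vector_derivative \<psi> (at s) \<noteq> 0" if "s \<in> I" for s
    using that l_pos by force
  note \<eta> = smooth_on_inv_into[OF I_open \<psi>(1) inj this]
  define J \<eta>' where "J = \<psi> ` I" and "\<eta>' = inv_into I \<psi>"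
  have \<eta>'_I: "\<eta>' t \<in> I" "\<psi> (\<eta>' t) = t" if "t \<in> J" for t
    using that by (auto simp: J_def \<eta>'_def inv_into_into f_inv_into_f)
  have \<eta>'_\<psi>: "\<eta>' (\<psi> s) = s" if "s \<in> I" for s
    using that inj by (simp add: \<eta>'_def)
  have d\<eta>: "(\<eta>' has_vector_derivative inverse (l (\<eta>' t))) (at t)" if "t \<in> J" for t
    using \<eta>(3)[of t] that \<psi>1[OF \<eta>'_I(1)[OF that]] by (simp add: J_def \<eta>'_def)
  have \<eta>'_smooth: "smooth_on J \<eta>'" "open J" "\<eta>' ` J \<subseteq> I"
    using \<eta>(1,2) \<eta>'_I(1) by (auto simp: J_def \<eta>'_def)
  define g where "g t = \<gamma> (\<eta>' t)" for t
  show ?thesis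
  proof (rule that[of J g \<psi>])
    have "connected J"
      unfolding J_def using I smooth_on_continuous[OF \<psi>(1)]
      by (intro connected_continuous_image) (auto simp: open_interval_def is_interval_connected_1)
    then show "open_interval J"
      using \<eta>'_smooth(2) s0 by (auto simp: open_interval_def is_interval_connected_1 J_def)
    show "bij_betw \<psi> I J" using inj by (simp add: bij_betw_def J_def)
    show "smooth_on I \<psi>" by fact
    show "deriv \<psi> s \<noteq> 0" if "s \<in> I" for s
      using DERIV_imp_deriv[OF \<psi>_real[OF that]] l_pos[OF that] by simp
    show "g (\<psi> s) = \<gamma> s" if "s \<in> I" for s by (simp add: g_def \<eta>'_\<psi>[OF that])
    have sm: "smooth_on J (\<lambda>t. r (\<eta>' t))" "smooth_on J (\<lambda>t. \<phi> (\<eta>' t))" "smooth_on J (\<lambda>t. \<theta> (\<eta>' t))"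
      using smooth_on_compose[OF \<eta>'_smooth(2,1) _ \<eta>'_smooth(3)] r \<phi> \<theta>(1) by blast+
    have eqs: "r (\<eta>' t) > 0 \<and> g t = of_real (r (\<eta>' t)) * cis (\<phi> (\<eta>' t)) \<and>
        (g has_vector_derivative cis (\<theta> (\<eta>' t))) (at t) \<and>
        deriv (\<lambda>t. \<theta> (\<eta>' t)) t + (real n - 1) * (sin (\<theta> (\<eta>' t) - \<phi> (\<eta>' t)) / r (\<eta>' t))
          = real n * lam * r (\<eta>' t) * sin (\<theta> (\<eta>' t) - \<phi> (\<eta>' t))" if t: "t \<in> J" for t
    proof (intro conjI)
      define s where "s = \<eta>' t"
      have s: "s \<in> I" using \<eta>'_I[OF t] by (simp add: s_def)
      show "r (\<eta>' t) > 0" using r_pos[OF s] by (simp add: s_def)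
      show "g t = of_real (r (\<eta>' t)) * cis (\<phi> (\<eta>' t))" by (simp add: g_def \<gamma>_def)
      have "(g has_vector_derivative inverse (l s) *\<^sub>R g1 s) (at t)"
        using vector_diff_chain_at[OF d\<eta>[OF t], of \<gamma>] d\<gamma>[OF s] by (simp add: g_def[abs_def] o_def s_def)
      moreover have "inverse (l s) *\<^sub>R g1 s = cis (\<theta> s)"
        unfolding polar[OF s] using l_pos[OF s] by (simp add: scaleR_conv_of_real flip: mult.assoc)
      ultimately show "(g has_vector_derivative cis (\<theta> (\<eta>' t))) (at t)"
        by (simp add: s_def)
      have "((\<lambda>t. \<theta> (\<eta>' t)) has_vector_derivative inverse (l s) *\<^sub>R a s) (at t)"
        using vector_diff_chain_at[OF d\<eta>[OF t], of \<theta>] \<theta>(3)[OF s] by (simp add: o_def s_def)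
      then have d: "deriv (\<lambda>t. \<theta> (\<eta>' t)) t = inverse (l s) * a s"
        by (intro DERIV_imp_deriv) (simp add: has_real_derivative_iff_has_vector_derivative)
      \<comment> \<open>\<open>\<theta> - \<phi>\<close> is the angle between velocity and position.
        The factor \<open>l\<close> appearing here is cancelled by the passage to arc
        length.\<close>
      have "\<mu> s = r s * l s * sin (\<theta> s - \<phi> s)"
        by (simp add: \<mu>_def polar[OF s] \<gamma>_def sin_diff algebra_simps)
      then have "a s = l s * (real n * lam * r s * sin (\<theta> s - \<phi> s) - (real n - 1) * (sin (\<theta> s - \<phi> s) / r s))"
        using r_pos[OF s] unfolding a_def by (simp add: field_simps power2_eq_square)
      then have "inverse (l s) * a s = real n * lam * r s * sin (\<theta> s - \<phi> s) - (real n - 1) * (sin (\<theta> s - \<phi> s) / r s)"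
        using l_pos[OF s] by simp
      then show "deriv (\<lambda>t. \<theta> (\<eta>' t)) t + (real n - 1) * (sin (\<theta> (\<eta>' t) - \<phi> (\<eta>' t)) / r (\<eta>' t))
          = real n * lam * r (\<eta>' t) * sin (\<theta> (\<eta>' t) - \<phi> (\<eta>' t))"
        unfolding d s_def[symmetric] by simp
    qed
    show "self_similar_profile n lam J g"
      unfolding self_similar_profile_def
      by (rule exI[of _ "\<lambda>t. r (\<eta>' t)"], rule exI[of _ "\<lambda>t. \<phi> (\<eta>' t)"], rule exI[of _ "\<lambda>t. \<theta> (\<eta>' t)"],
          rule conjI, rule sm(1), rule conjI, rule sm(2), rule conjI, rule sm(3), rule ballI, rule eqs)
  qed
qed

lemma dim_tangent_space_lagrangian:
  fixes F :: "'a::real_normed_vector \<Rightarrow> complex^'n"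
  assumes "lagrangian_on N F" "p \<in> N"
  shows "subspace (tangent_space N F p)" "dim (tangent_space N F p) = CARD('n)"
  using assms by (auto simp: lagrangian_on_def lagrangian_subspace_def)

text \<open>This is the family with \<open>V = 0\<close> and \<open>w = 0\<close>; unit speed makes
  it nondegenerate. Its turning rate is the derivative of \<open>\<theta>\<close> and
  \<open>\<mu>\<close> is \<open>r sin \<alpha>\<close>, so the profile equation times 1 is what
  \<open>self_similarI\<close> asks for.\<close>

lemma centered_with_profile_self_similar:
  fixes F :: "real \<times> (real^'n) \<Rightarrow> complex^'n"
  assumes I: "open I" and lagr: "lagrangian_on (I \<times> sphere 0 1) F"
    and cent: "centered_with_profile lam I F"
  shows "self_similar (I \<times> sphere 0 1) F lam"
proof -
  obtain A :: "complex^'n^'n" and J g \<psi> and R :: "real \<Rightarrow> real^'n^'n" where A: "unitary_matrix A"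
    and J: "open_interval J" and profile: "self_similar_profile CARD('n) lam J g"
    and bij: "bij_betw \<psi> I J" and \<psi>: "smooth_on I \<psi>" "\<And>s. s \<in> I \<Longrightarrow> deriv \<psi> s \<noteq> 0"
    and R: "smooth_on I R" "\<And>s. s \<in> I \<Longrightarrow> orthogonal_matrix (R s)"
    and F: "\<And>s x. s \<in> I \<Longrightarrow> x \<in> sphere 0 1 \<Longrightarrow> F (s, x) = A *v centered_immersion g (\<psi> s, R s *v x)"
    using cent unfolding centered_with_profile_def by blast
  obtain r \<phi> \<theta> :: "real \<Rightarrow> real" where smooth: "smooth_on J r" "smooth_on J \<phi>" "smooth_on J \<theta>"
    and prof: "\<And>s. s \<in> J \<Longrightarrow> r s > 0 \<and> g s = of_real (r s) * cis (\<phi> s) \<and>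
         (g has_vector_derivative cis (\<theta> s)) (at s) \<and>
         deriv \<theta> s + (real CARD('n) - 1) * (sin (\<theta> s - \<phi> s) / r s)
            = real CARD('n) * lam * r s * sin (\<theta> s - \<phi> s)"
    using profile unfolding self_similar_profile_def by blast
  have J_open: "open J" using J by (simp add: open_interval_def)
  have g: "smooth_on J g"
  proof (rule smooth_on_cong[OF _ J_open])
    show "smooth_on J (\<lambda>s. of_real (r s) * cis (\<phi> s))"
      by (intro smooth_on_mult smooth_on_of_real smooth_on_cis J_open smooth)
  qed (use prof in simp)
  have g': "vector_derivative g (at s) = cis (\<theta> s)" if "s \<in> J" for s
    using prof[OF that] by (simp add: vector_derivative_at)
  interpret immersed_sphere_family J "(*v) A" g "\<lambda>_. 0" "\<lambda>_. 0"
  proof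
    show "g s \<noteq> 0" if "s \<in> J" for s using prof[OF that] by auto
    show "vector_derivative g (at s) + g s * of_real (0 \<bullet> y) \<noteq> 0" if "s \<in> J" for s and y :: "real^'n"
      using g'[OF that] by simp
  qed (use J_open g linear_add[OF matrix_vector_mul_linear, of A]
      linear_cmul[OF matrix_vector_mul_linear, of A] unitary_matrix_inner[OF A] in auto)
  have nz: "vector_derivative \<psi> (at s) \<noteq> 0" if s: "s \<in> I" for s
  proof -
    have "(\<psi> has_real_derivative vector_derivative \<psi> (at s)) (at s)"
      using smooth_on_derivative[OF \<psi>(1) s] by (simp add: has_real_derivative_iff_has_vector_derivative)
    then show ?thesis using DERIV_imp_deriv \<psi>(2)[OF s] by metis
  qed
  have inj: "inj_on \<psi> I" and img: "\<psi> ` I = J" using bij by (auto simp: bij_betw_def)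
  define \<Phi> where "\<Phi> = (\<lambda>(s, x). (\<psi> s, R s *v x))"
  have equiv: "curve_equivalence (I \<times> sphere 0 1) N \<Phi>"
    unfolding \<Phi>_def
    by (rule curve_equivalence_rotation[OF J_open \<psi>(1) img smooth_on_inv_into(2)[OF I \<psi>(1) inj nz, unfolded img] _ _ _ R])
      (use inj img in \<open>auto intro: inv_into_into f_inv_into_f\<close>)
  have FG: "F p = G (\<Phi> p)" if "p \<in> I \<times> sphere 0 1" for p
    using that F by (auto simp: G_def centered_immersion_def \<Phi>_def)
  have "self_similar N G lam"
  proof (rule self_similarI)
    fix q assume "q \<in> N"
    then have "q \<in> \<Phi> ` (I \<times> sphere 0 1)" by (simp only: curve_equivalence_image[OF equiv])
    then obtain p where p: "q = \<Phi> p" "p \<in> I \<times> sphere 0 1" by (rule imageE)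
    show "dim (tangent_space N G q) = CARD('n)"
      using tangent_space_reparam[where f=F and g=G, OF equiv FG p(2)] dim_tangent_space_lagrangian(2)[OF lagr p(2)]
      by (simp only: p(1))
  next
    fix s assume s: "s \<in> J"
    have "(\<theta> has_vector_derivative deriv \<theta> s) (at s)"
      using smooth_on_derivative[OF smooth(3) s]
      by (metis DERIV_imp_deriv has_real_derivative_iff_has_vector_derivative)
    then have "((\<lambda>s. cis (\<theta> s)) has_vector_derivative \<i> * of_real (deriv \<theta> s) * cis (\<theta> s)) (at s)"
      by (rule has_vector_derivative_cis)
    then have "((\<lambda>s. vector_derivative g (at s)) has_vector_derivative \<i> * of_real (deriv \<theta> s) * cis (\<theta> s)) (at s)"
      by (rule has_vector_derivative_transform_within_open[OF _ J_open s]) (simp add: g')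
    then have g'': "vector_derivative (\<lambda>s. vector_derivative g (at s)) (at s) = \<i> * of_real (deriv \<theta> s) * cis (\<theta> s)"
      by (rule vector_derivative_at)
    have \<mu>: "\<mu> s = r s * sin (\<theta> s - \<phi> s)"
      using prof[OF s] by (simp add: \<mu>_def g'[OF s] sin_diff algebra_simps)
    have \<kappa>: "Im (cnj (cis (\<theta> s)) * (\<i> * of_real (deriv \<theta> s) * cis (\<theta> s))) = deriv \<theta> s"
      by (simp add: algebra_simps flip: power2_eq_square distrib_left)
    have norm: "cmod (g s) = r s" using prof[OF s] by (simp add: norm_mult)
    show "Im (cnj (vector_derivative g (at s)) * vector_derivative (\<lambda>s. vector_derivative g (at s)) (at s))
        / (cmod (vector_derivative g (at s)))\<^sup>2
      + (real CARD('n) - 1) * \<mu> s / (cmod (g s))\<^sup>2 = real CARD('n) * lam * \<mu> s"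
      unfolding g'' g'[OF s] \<kappa> \<mu> norm using prof[OF s] by (simp add: power2_eq_square)
  qed simp
  then show ?thesis
    using self_similar_reparam[where f=F and g=G, OF equiv FG] by blast
qed

text \<open>Flat pieces need separate mention: an affine Lagrangian subspace has zero mean curvature
  and satisfies the translator equation for every \<open>V0\<close> tangent to it, and a piece of a
  Lagrangian subspace may be foliated by spheres whose centers move, which no centered
  parametrization describes.\<close>

theorem theorem2:
  fixes I :: "real set" and F :: "real \<times> (real^'n) \<Rightarrow> complex^'n"
  assumes "CARD('n) \<ge> 3"
    and "sphere_foliated I F"
    and "lagrangian_on (I \<times> sphere 0 1) F"
  shows "(\<nexists>V0. V0 \<noteq> 0 \<and> self_translator (I \<times> sphere 0 1) F V0 \<and>
              \<not> in_affine_lagrangian_subspace (I \<times> sphere 0 1) F) \<and>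
         (\<forall>lam. lam \<noteq> 0 \<longrightarrow>
            (self_similar (I \<times> sphere 0 1) F lam \<longleftrightarrow>
               in_lagrangian_subspace (I \<times> sphere 0 1) F \<or> centered_with_profile lam I F))"
proof -
  have I: "open_interval I" "open I" using assms(2) by (auto simp: sphere_foliated_def open_interval_def)
  have immersion: "immersion_on (I \<times> sphere 0 1) F" using assms(2) by (simp add: sphere_foliated_def)
  note n = assms(1) and lagr = assms(3)
  obtain A r \<phi> V w R where A: "unitary_matrix A"
    and smooth: "smooth_on I r" "smooth_on I \<phi>" "smooth_on I V" "smooth_on I R"
    and r_pos: "\<And>s. s \<in> I \<Longrightarrow> r s > 0" and R: "\<And>s. s \<in> I \<Longrightarrow> orthogonal_matrix (R s)"
    and V: "\<And>s. s \<in> I \<Longrightarrow> (V has_vector_derivative (of_real (r s) * cis (\<phi> s)) *s cvec (w s)) (at s)"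
    and F: "\<And>s x. s \<in> I \<Longrightarrow> x \<in> sphere 0 1 \<Longrightarrow>
      F (s, x) = A *v ((of_real (r s) * cis (\<phi> s)) *s cvec (R s *v x) + V s)"
    by (rule lagrangian_sphere_normal_form[OF assms]) (rule that)
  define \<gamma> where "\<gamma> s = of_real (r s) * cis (\<phi> s)" for s
  have \<gamma>: "smooth_on I \<gamma>"
    unfolding \<gamma>_def[abs_def] by (intro smooth_on_mult smooth_on_of_real smooth_on_cis I(2) smooth)
  interpret S: sphere_family I "(*v) A" \<gamma> V w
  proof
    show "\<gamma> s \<noteq> 0" if "s \<in> I" for s using r_pos[OF that] by (simp add: \<gamma>_def)
  qed (use I \<gamma> smooth V linear_add[OF matrix_vector_mul_linear, of A]
      linear_cmul[OF matrix_vector_mul_linear, of A] unitary_matrix_inner[OF A] in \<open>auto simp: \<gamma>_def\<close>)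
  define \<Phi> where "\<Phi> = (\<lambda>(s, x). (s, R s *v x))"
  have equiv: "curve_equivalence S.N S.N \<Phi>"
    unfolding \<Phi>_def
    by (rule curve_equivalence_rotation[where \<eta>="\<lambda>s. s"]) (use I smooth R in auto)
  have FG: "F p = S.G (\<Phi> p)" if "p \<in> S.N" for p
    using that F by (auto simp: S.G_def \<Phi>_def \<gamma>_def)
  interpret S: immersed_sphere_family I "(*v) A" \<gamma> V w
  proof
    fix s and y :: "real^'n" assume s: "s \<in> I" and y: "y \<in> sphere 0 1"
    show "vector_derivative \<gamma> (at s) + \<gamma> s * of_real (w s \<bullet> y) \<noteq> 0"
    proof
      assume zero: "vector_derivative \<gamma> (at s) + \<gamma> s * of_real (w s \<bullet> y) = 0"
      \<comment> \<open>If \<open>\<zeta>\<close> vanished, \<open>(1, ?u)\<close> would be in the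
        kernel of the differential of \<open>S.G\<close>. A lift of a curve in this direction has
        zero image velocity under the immersion \<open>F\<close>, hence zero velocity; but
        \<open>\<Phi>\<close> preserves the first parameter, which moves with speed 1.\<close>
      let ?u = "- (w s - (w s \<bullet> y) *\<^sub>R y)"
      have "?u \<bullet> y = 0" using y by (simp add: inner_diff_left norm_eq_1)
      then obtain d where d: "curve_through S.N (s, y) d" "vector_derivative d (at 0) = (1, ?u)"
        using curve_through_product_sphere[OF I(2) s y] by blast
      have "(s, y) \<in> \<Phi> ` S.N" using s y curve_equivalence_image[OF equiv] by simp
      then obtain p where p: "(s, y) = \<Phi> p" "p \<in> S.N" by (rule imageE)
      obtain c where c: "curve_through S.N p c" "\<forall>\<^sub>F t in nhds 0. d t = \<Phi> (c t)"
        using curve_equivalence_lift[OF equiv p(2), of d] d(1) unfolding p(1)[symmetric] by blast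
      have "vector_derivative (F \<circ> c) (at 0) = vector_derivative (S.G \<circ> d) (at 0)"
        by (rule velocity_reparam[where f=F and g=S.G, OF equiv FG c])
      also have "\<dots> = S.dG s y 1 ?u" by (rule S.velocity(1)[OF d])
      also have "\<dots> = 0"
        using zero unfolding S.dG_\<zeta> S.\<zeta>_def by (simp add: cvec.zero_left)
      finally have "vector_derivative c (at 0) = 0"
        using immersion p(2) c(1) unfolding immersion_on_def by blast
      then have "(c has_vector_derivative 0) (at 0)" using curve_through_derivative[OF c(1)] by simp
      from bounded_linear.has_vector_derivative[OF bounded_linear_fst this]
      have "vector_derivative (\<lambda>t. fst (c t)) (at 0) = 0" by (simp add: vector_derivative_at)
      moreover have "vector_derivative (\<lambda>t. fst (c t)) (at 0) = vector_derivative (\<lambda>t. fst (d t)) (at 0)"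
        by (rule vector_derivative_eventually_cong, use c(2) in eventually_elim) (simp add: \<Phi>_def case_prod_beta)
      moreover have "vector_derivative (\<lambda>t. fst (d t)) (at 0) = 1"
        using bounded_linear.has_vector_derivative[OF bounded_linear_fst curve_through_derivative[OF d(1)]] d(2)
        by (simp add: vector_derivative_at)
      ultimately show False by simp
    qed
  qed
  have dim: "dim (tangent_space S.N S.G q) = CARD('n)" if "q \<in> S.N" for q
  proof -
    have "q \<in> \<Phi> ` S.N" using that by (simp only: curve_equivalence_image[OF equiv])
    then obtain p where p: "q = \<Phi> p" "p \<in> S.N" by (rule imageE)
    show ?thesis
      using tangent_space_reparam[where f=F and g=S.G, OF equiv FG p(2)] dim_tangent_space_lagrangian(2)[OF lagr p(2)]
      by (simp only: p(1))
  qed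
  have image: "F ` S.N = S.G ` S.N"
  proof -
    have "F ` S.N = (\<lambda>p. S.G (\<Phi> p)) ` S.N" using FG by (rule image_cong[OF refl])
    also have "\<dots> = S.G ` \<Phi> ` S.N" by (simp only: image_image)
    finally show ?thesis by (simp only: curve_equivalence_image[OF equiv])
  qed
  have flat: "\<exists>a L. lagrangian_subspace L \<and> F ` S.N \<subseteq> (\<lambda>v. a + v) ` L \<and>
      ((\<forall>s\<in>I. vec_Im (cnj (\<gamma> s) *s V s) = 0) \<longrightarrow> F ` S.N \<subseteq> L)"
    if "\<And>s. s \<in> I \<Longrightarrow> S.\<mu> s = 0"
    unfolding image
    by (rule S.flat_lagrangian[OF I(1) that \<gamma>_def smooth(1,2) matrix_vector_mult_scalar])
  have "in_affine_lagrangian_subspace S.N F" if "V0 \<noteq> 0" "self_translator S.N F V0" for V0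
  proof -
    have "self_translator S.N S.G V0" using that self_translator_reparam[where f=F and g=S.G, OF equiv FG] by blast
    then have "S.\<mu> s = 0" if "s \<in> I" for s
      using S.translator_flat[OF n dim _ \<open>V0 \<noteq> 0\<close> that] by blast
    from flat[OF this] show ?thesis unfolding in_affine_lagrangian_subspace_def by blast
  qed
  moreover have "in_lagrangian_subspace S.N F \<or> centered_with_profile lam I F"
    if lam: "lam \<noteq> 0" and ss: "self_similar S.N F lam" for lam
  proof -
    have ssG: "self_similar S.N S.G lam" using ss self_similar_reparam[where f=F and g=S.G, OF equiv FG] by blast
    from S.\<mu>_dichotomy[OF I(1) n dim ssG lam] show ?thesis
    proof
      assume "\<forall>s\<in>I. S.\<mu> s = 0"
      \<comment> \<open>The real-multiple condition on \<open>V\<close> selects the linear subspace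
        in \<open>flat\<close> instead of a translate.\<close>
      then show ?thesis
        using flat S.self_similar_real_multiple[OF n dim ssG lam]
        unfolding in_lagrangian_subspace_def by blast
    next
      assume \<mu>: "\<forall>s\<in>I. S.\<mu> s \<noteq> 0"
      have ode: "Im (cnj (S.\<gamma>' s) * S.\<gamma>'' s) / (cmod (S.\<gamma>' s))\<^sup>2 + (real CARD('n) - 1) * Im (cnj (\<gamma> s) * S.\<gamma>' s) / (cmod (\<gamma> s))\<^sup>2
        = real CARD('n) * lam * Im (cnj (\<gamma> s) * S.\<gamma>' s)" if "s \<in> I" for s
        using S.profile_equation[OF n dim ssG lam that] \<mu> that by (simp add: S.\<mu>_def)
      have \<gamma>_eq: "\<gamma> = (\<lambda>s. of_real (r s) * cis (\<phi> s))" by (simp add: \<gamma>_def fun_eq_iff)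
      obtain \<psi> J g where "open_interval J" "self_similar_profile CARD('n) lam J g" "bij_betw \<psi> I J"
        "smooth_on I \<psi>" "\<And>s. s \<in> I \<Longrightarrow> deriv \<psi> s \<noteq> 0" and g: "\<And>s. s \<in> I \<Longrightarrow> g (\<psi> s) = \<gamma> s"
        by (rule arclength_profile[OF \<gamma>_eq I(1) smooth(1,2) r_pos S.\<gamma>'_nz[OF _ n] ode]) (assumption | rule that)+
      moreover have "F (s, x) = A *v centered_immersion g (\<psi> s, R s *v x)" if sx: "s \<in> I" "x \<in> sphere 0 1" for s x
        using F[OF sx] g[OF sx(1)] S.V_zero[OF n dim ssG lam sx(1)] \<mu> sx(1)
        by (simp add: centered_immersion_def \<gamma>_def)
      ultimately have "centered_with_profile lam I F"
        unfolding centered_with_profile_def using A smooth(4) R by blast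
      then show ?thesis ..
    qed
  qed
  moreover have "self_similar S.N F lam" if sub: "in_lagrangian_subspace S.N F" for lam
  proof -
    obtain L where L: "lagrangian_subspace L" "F ` S.N \<subseteq> L"
      using sub unfolding in_lagrangian_subspace_def by blast
    show ?thesis
    proof (rule self_similar_in_subspace[OF _ L(2)])
      show "\<exists>e>0. smooth_on {-e<..<e} (F \<circ> c)" if "curve_through S.N p c" for p c
        using immersion[unfolded immersion_on_def, rule_format, OF conjunct2[OF curve_through_base[OF that]] that]
        by (rule conjunct1)
    qed (use L(1) dim_tangent_space_lagrangian[OF lagr] in \<open>auto simp: lagrangian_subspace_def\<close>)
  qed
  ultimately show ?thesis
    using centered_with_profile_self_similar[OF I(2) lagr] by blast
qed

end
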